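(* Let $H$, $\mu$, $\alpha$, $L$, $(M_n)$, $\{X_{nj}\}$, $S_n=\sum_{j=1}^nX_{nj}$ and the measures $\nu^{(k)}$ be as in the context (soft truncation regime). Let $k\ge1$ be an integer and suppose that $$P(L>x)=o\left(P(\|H\|>x)^{k-1}\right)\qquad\text{as }x\to\infty.$$ Then, as $n\to\infty$, $$\frac{P(M_n^{-1}S_n\in\cdot)}{\{nP(\|H\|>M_n)\}^k}\ \stackrel{v}{\longrightarrow}\ \frac1{k!}\,\nu^{(k)}(\cdot)\qquad\text{on }\overline{\mathbb R^d}\setminus B_{k-1}.$$
   Context: Notation: $\|\cdot\|$ is the Euclidean norm on $\mathbb R^d$; $B_r:=\{x\in\mathbb R^d:\|x\|\le r\}$ for $r\ge0$, and complements of such balls are denoted $B_r^c$; $\mathcal S:=\{x\in\mathbb R^d:\|x\|=1\}$. $\overline{\mathbb R^d}$ is the compact set obtained by adding to $\mathbb R^d$ a sphere of infinite radius centered at the origin; $\stackrel{v}{\longrightarrow}$ denotes vague convergence of Radon measures on the indicated space (on $\overline{\mathbb R^d}\setminus B_{r}$, relatively compact sets are those contained in $\overline{\mathbb R^d}\setminus B_{r'}$ for some $r'>r$). Setup: $H$ is an $\mathbb R^d$-valued random vector for which there are a non-null Radon measure $\mu$ on $\mathbb R^d\setminus\{0\}$, extended by $\mu(\overline{\mathbb R^d}\setminus\mathbb R^d)=0$, and a sequence $a_n\to\infty$ with $nP(a_n^{-1}H\in\cdot)\stackrel{v}{\longrightarrow}\mu(\cdot)$ on $\overline{\mathbb R^d}\setminus\{0\}$.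 Then there is $\alpha>0$ with $\mu(cA)=c^{-\alpha}\mu(A)$ for all $c>0$ and Borel $A$, and $P(\|H\|>\cdot)$ is regularly varying with index $-\alpha$. If $\alpha=1$, $H$ is assumed to have a symmetric distribution; if $\alpha>1$, $E(H)=0$. $H_1,H_2,\ldots$ are i.i.d. copies of $H$; $L,L_1,L_2,\ldots$ are i.i.d. $[0,\infty)$-valued random variables independent of $(H,H_1,H_2,\ldots)$; $(M_n)$ is a sequence of positive numbers with $M_n\to\infty$; and for $1\le j\le n$ $$X_{nj}:=H_j\mathbf 1(\|H_j\|\le M_n)+\frac{H_j}{\|H_j\|}(M_n+L_j)\mathbf 1(\|H_j\|>M_n).$$ Soft truncation regime (standing assumptions): $\lim_{n\to\infty}nP(\|H\|>M_n)=0$; moreover, if $\alpha=2$, $\lim_n M_n/\sqrt{n^{1+\gamma}}=\infty$ for some $\gamma>0$; and if $\alpha>2$, $\lim_n M_n/\sqrt{n\log M_n}=\infty$. Measures: $\sigma$ is the probability measure on $\mathcal S$ given by $\sigma(A):=\frac1{\mu(B_1^c)}\mu\left(\left\{x\in\mathbb R^d:\|x\|\ge1,\ x/\|x\|\in A\right\}\right)$; $\nu(A):=\frac{\mu(A\cap B_1)}{\mu(B_1^c)}+\sigma(A\cap\mathcal S)$, a measure on $\mathbb R^d\setminus\{0\}$; and for $k\ge1$, $\nu^{(k)}$ is the Radon measure on $\mathbb R^d\setminus B_{k-1}$ given by $$\nu^{(k)}(A):=\int\cdots\int\mathbf 1\Big(\sum_{j=1}^kx_j\in A\Big)\nu(dx_1)\cdots\nu(dx_k),$$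 extended to $\overline{\mathbb R^d}\setminus B_{k-1}$ by $\nu^{(k)}(\overline{\mathbb R^d}\setminus\mathbb R^d)=0$. *)

theory Defs
  imports "HOL-Probability.Probability"
begin

section \<open>Euclidean space with a sphere at infinity\<close>

datatype 'a cpt = Proper 'a | AtInf 'a

definition cpt_points :: "'a::euclidean_space cpt set" where
  "cpt_points = range Proper \<union> AtInf ` sphere 0 1"

text \<open>
  \<open>AtInf u\<close> is the point at infinity in the direction of the unit vector \<open>u\<close>. The topology is
  transported from the closed unit ball, onto which \<open>cpt_points\<close> is mapped bijectively; a
  sequence of proper points tends to \<open>AtInf u\<close> iff its norms tend to infinity and its
  directions tend to \<open>u\<close>.
\<close>

fun cpt_to_ball :: "'a::euclidean_space cpt \<Rightarrow> 'a" where
  "cpt_to_ball (Proper x) = (1 / (1 + norm x)) *\<^sub>R x"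
| "cpt_to_ball (AtInf u) = u"

definition cpt_topology :: "'a::euclidean_space cpt topology" where
  "cpt_topology = pullback_topology cpt_points cpt_to_ball euclidean"

definition cpt_minus_ball :: "real \<Rightarrow> 'a::euclidean_space cpt topology" where
  "cpt_minus_ball r = subtopology cpt_topology (cpt_points - Proper ` cball 0 r)"


section \<open>Radon measures and vague convergence\<close>

definition borel_of_topology :: "'b topology \<Rightarrow> 'b measure" where
  "borel_of_topology X = sigma (topspace X) {U. openin X U}"

text \<open>
  All spaces considered are locally compact, Hausdorff and second countable, so that local
  finiteness already entails inner and outer regularity.
\<close>

definition radon_on :: "'b topology \<Rightarrow> 'b measure \<Rightarrow> bool" where
  "radon_on X N \<longleftrightarrow>
     sets N = sets (borel_of_topology X) \<and> (\<forall>K. compactin X K \<longrightarrow> emeasure N K < \<infinity>)"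

definition vague_conv :: "'b topology \<Rightarrow> (nat \<Rightarrow> 'b measure) \<Rightarrow> 'b measure \<Rightarrow> bool" where
  "vague_conv X N N' \<longleftrightarrow>
     (\<forall>n. radon_on X (N n)) \<and> radon_on X N' \<and>
     (\<forall>f. continuous_map X euclideanreal f \<and>
          (\<exists>K. compactin X K \<and> (\<forall>x \<in> topspace X - K. f x = 0)) \<longrightarrow>
          (\<lambda>n. integral\<^sup>L (N n) f) \<longlonglongrightarrow> integral\<^sup>L N' f)"

text \<open>
  The measure induced by \<open>N\<close> on \<open>cpt_minus_ball r\<close>: restricted to the complement of the closed
  ball of radius \<open>r\<close> and extended by zero to the sphere at infinity.
\<close>

definition cpt_extend :: "real \<Rightarrow> 'a::euclidean_space measure \<Rightarrow> 'a cpt measure" where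
  "cpt_extend r N =
     distr (restrict_space N (- cball 0 r)) (borel_of_topology (cpt_minus_ball r)) Proper"


section \<open>The measures \<open>\<sigma>\<close>, \<open>\<nu>\<close> and \<open>\<nu>\<^sup>(\<^sup>k\<^sup>)\<close>\<close>

definition sigma_meas :: "'a::euclidean_space measure \<Rightarrow> 'a measure" where
  "sigma_meas \<mu> =
     measure_of (sphere 0 1) (sets (restrict_space borel (sphere 0 1)))
       (\<lambda>A. emeasure \<mu> {x. norm x \<ge> 1 \<and> (1 / norm x) *\<^sub>R x \<in> A} / emeasure \<mu> (- cball 0 1))"

definition nu_meas :: "'a::euclidean_space measure \<Rightarrow> 'a measure" where
  "nu_meas \<mu> =
     measure_of (- {0}) (sets (restrict_space borel (- {0})))
       (\<lambda>A. emeasure \<mu> (A \<inter> cball 0 1) / emeasure \<mu> (- cball 0 1)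
            + emeasure (sigma_meas \<mu>) (A \<inter> sphere 0 1))"

text \<open>
  The iterated integral defining \<open>\<nu>\<^sup>(\<^sup>k\<^sup>)\<close> is the integral with respect to the \<open>k\<close>-fold product
  measure (\<open>\<nu>\<close> is sigma-finite), i.e. \<open>\<nu>\<^sup>(\<^sup>k\<^sup>)\<close> is the image of the product under summation. It
  need not be locally finite on the closed ball of radius \<open>k - 1\<close>, which is removed.
\<close>

definition nu_pow :: "'a::euclidean_space measure \<Rightarrow> nat \<Rightarrow> 'a measure" where
  "nu_pow \<mu> k =
     restrict_space
       (distr (Pi\<^sub>M {1..k} (\<lambda>_. nu_meas \<mu>)) borel (\<lambda>x. \<Sum>j = 1..k. x j))
       (- cball 0 (real k - 1))"


section \<open>The truncated row sums\<close>

definition soft_trunc :: "real \<Rightarrow> 'a::euclidean_space \<Rightarrow> real \<Rightarrow> 'a" where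
  "soft_trunc m h l = (if norm h \<le> m then h else (m + l) *\<^sub>R ((1 / norm h) *\<^sub>R h))"

text \<open>
  The families \<open>H\<close> and \<open>L\<close> are indexed so that \<open>H 0\<close> and \<open>L 0\<close> are the generic variables
  \<open>H\<close> and \<open>L\<close>, which do not enter the sums, while \<open>H j\<close> and \<open>L j\<close> for \<open>j \<ge> 1\<close> are
  \<open>H\<^sub>j\<close> and \<open>L\<^sub>j\<close>.
\<close>

definition X_arr ::
  "(nat \<Rightarrow> 'w \<Rightarrow> 'a::euclidean_space) \<Rightarrow> (nat \<Rightarrow> 'w \<Rightarrow> real) \<Rightarrow> (nat \<Rightarrow> real) \<Rightarrow> nat \<Rightarrow> nat \<Rightarrow> 'w \<Rightarrow> 'a"
  where "X_arr H L M n j \<omega> = soft_trunc (M n) (H j \<omega>) (L j \<omega>)"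

definition S_sum ::
  "(nat \<Rightarrow> 'w \<Rightarrow> 'a::euclidean_space) \<Rightarrow> (nat \<Rightarrow> 'w \<Rightarrow> real) \<Rightarrow> (nat \<Rightarrow> real) \<Rightarrow> nat \<Rightarrow> 'w \<Rightarrow> 'a"
  where "S_sum H L M n \<omega> = (\<Sum>j = 1..n. X_arr H L M n j \<omega>)"

definition tail :: "'w measure \<Rightarrow> ('w \<Rightarrow> real) \<Rightarrow> real \<Rightarrow> real" where
  "tail \<Omega> Z x = measure \<Omega> {\<omega> \<in> space \<Omega>. Z \<omega> > x}"

end

theory Submission
  imports Defs "HOL-Real_Asymp.Real_Asymp"
begin

text \<open>
  A sum that exceeds \<open>k - 1\<close> truncation levels needs \<open>k\<close> big jumps, and asymptotically it consists
  of exactly \<open>k\<close> big jumps and nothing else. Write \<open>Q\<close> for the tail of the norm of \<open>H\<close>,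
  \<open>p\<^sub>n = n Q(M\<^sub>n)\<close>, and \<open>clip\<close> for the radial projection onto the closed unit ball.

  Up to the excess \<open>L\<^sub>j\<close>, the scaled summand \<open>X\<^sub>n\<^sub>j / M\<^sub>n\<close> is \<open>clip (H\<^sub>j / M\<^sub>n)\<close>, and \<open>\<nu>\<close> is the image of
  \<open>\<mu>\<close>, normalised, under \<open>clip\<close> (\<open>nu_meas_eq\<close>). So one big jump has asymptotic law \<open>\<nu>\<close> at rate
  \<open>Q(M\<^sub>n)\<close> (\<open>clip_limit\<close>), and \<open>k\<close> independent ones have the product law at rate \<open>Q(M\<^sub>n)\<^sup>k\<close>
  (\<open>weighted_conv_limit\<close>). There are \<open>n choose k\<close> ways to choose their indices; this is the
  factor \<open>n\<^sup>k / k!\<close>.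

  A test function \<open>f\<close> on the complement of the ball of radius \<open>k - 1\<close> is, on Euclidean space,
  bounded, uniformly continuous and zero on a slightly larger ball
  (\<open>test_function_uniformly_continuous\<close>). The value \<open>f (S\<^sub>n / M\<^sub>n)\<close> is compared with the
  U-statistic that sums \<open>f (\<Sum>j\<in>J. clip (H\<^sub>j / M\<^sub>n))\<close> over all index sets \<open>J\<close> of size \<open>k\<close>. By a
  deterministic inequality (\<open>big_jump_approximation\<close>) the two differ only if more than \<open>k\<close> jumps
  exceed a small multiple of \<open>M\<^sub>n\<close>, or a truncated variable has a large excess \<open>L\<^sub>j\<close>, or the small
  jumps add up to a multiple of \<open>M\<^sub>n\<close>, apart from an error controlled by the modulus of continuity
  of \<open>f\<close>. The probability of the first event is at
  most of order \<open>p\<^sub>n\<close> to the power \<open>k + 1\<close>. The second has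
  probability at most \<open>p\<^sub>n P(L > \<delta> M\<^sub>n)\<close>, which the tail condition on \<open>L\<close> makes \<open>o(p\<^sub>n\<^sup>k)\<close>
  (\<open>overshoot_negligible\<close>).

  The third event is the main difficulty (\<open>small_jumps\<close>). The jumps below \<open>\<delta> M\<^sub>n\<close> are bounded, so
  that a Chernoff bound applies, with exponent \<open>A ln (1 / p\<^sub>n) / M\<^sub>n\<close>: the factor gained is a power of
  \<open>p\<^sub>n\<close> as large as desired, while the price is an exponential moment that stays under control when
  \<open>\<delta>\<close> is small compared to \<open>1 / A\<close>. That price is estimated by truncated moments of regularly
  varying variables; for \<open>\<alpha> \<ge> 2\<close> it is there that the growth conditions on \<open>M\<^sub>n\<close> enter.
\<close>

section \<open>Test functions on the compactified space\<close>

text \<open>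
  The inverse of \<open>cpt_to_ball\<close>, viewed as a map from \<open>cpt_points\<close> to the closed unit ball.
\<close>

definition cpt_of_ball :: "'a::euclidean_space \<Rightarrow> 'a cpt" where
  "cpt_of_ball b = (if norm b < 1 then Proper ((1 / (1 - norm b)) *\<^sub>R b) else AtInf b)"

text \<open>
  The radial projection onto the closed ball of radius \<open>R\<close>, that is, truncation without excess.
  The maximum in the denominator replaces a case distinction and makes continuity immediate.
\<close>

definition clip :: "real \<Rightarrow> 'a::euclidean_space \<Rightarrow> 'a" where
  "clip R x = (R / max R (norm x)) *\<^sub>R x"

lemma norm_clip: "R > 0 \<Longrightarrow> norm (clip R x) = min (norm x) R"
  by (auto simp: clip_def max_def min_def)

lemma clip_eq: "R > 0 \<Longrightarrow> norm x \<le> R \<Longrightarrow> clip R x = x"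
  by (auto simp: clip_def max_def)

lemma continuous_on_clip [continuous_intros]:
  assumes "R > 0" "continuous_on S f"
  shows "continuous_on S (\<lambda>x. clip R (f x))"
  unfolding clip_def using assms by (intro continuous_intros) auto

lemma clip_measurable [measurable]: "R > 0 \<Longrightarrow> clip R \<in> borel_measurable borel"
  by (intro borel_measurable_continuous_onI continuous_intros)

lemma norm_cpt_to_ball_Proper: "norm (cpt_to_ball (Proper x)) = norm x / (1 + norm x)"
  using norm_ge_zero[of x] by (simp del: norm_ge_zero)

lemma frac_less_iff: "r \<ge> 0 \<Longrightarrow> t \<ge> 0 \<Longrightarrow> r / (1 + r) < t / (1 + t) \<longleftrightarrow> r < (t::real)"
  by (simp add: field_simps)

lemma cpt_to_of_ball: "norm b \<le> 1 \<Longrightarrow> cpt_to_ball (cpt_of_ball b) = b"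
  by (auto simp: cpt_of_ball_def field_simps)

lemma cpt_of_to_ball: "y \<in> cpt_points \<Longrightarrow> cpt_of_ball (cpt_to_ball y) = y"
proof -
  assume "y \<in> cpt_points"
  then consider x where "y = Proper x" | u where "y = AtInf u" "norm u = 1"
    by (auto simp: cpt_points_def)
  then show ?thesis
  proof cases
    case 1
    have "1 + norm x > 0" by (smt (verit) norm_ge_zero)
    moreover have "1 - norm x / (1 + norm x) = 1 / (1 + norm x)"
      using \<open>1 + norm x > 0\<close> by (simp add: field_simps)
    ultimately show ?thesis using 1 by (auto simp: cpt_of_ball_def)
  qed (auto simp: cpt_of_ball_def)
qed

lemma topspace_cpt_minus_ball:
  "topspace (cpt_minus_ball r) = cpt_points - Proper ` cball 0 r"
  by (auto simp: cpt_minus_ball_def cpt_topology_def topspace_pullback_topology)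

lemma norm_cpt_to_ball_gt:
  assumes "r \<ge> 0" "y \<in> topspace (cpt_minus_ball r)"
  shows "r / (1 + r) < norm (cpt_to_ball y)" "norm (cpt_to_ball y) \<le> 1"
proof -
  from assms consider x where "y = Proper x" "norm x > r" | u where "y = AtInf u" "norm u = 1"
    by (force simp: cpt_points_def topspace_cpt_minus_ball)
  then have "r / (1 + r) < norm (cpt_to_ball y) \<and> norm (cpt_to_ball y) \<le> 1"
  proof cases
    case 1
    then show ?thesis using assms(1) frac_less_iff[of r "norm x"]
      by (simp only: norm_cpt_to_ball_Proper) (auto simp: divide_simps)
  qed (use assms(1) in auto)
  then show "r / (1 + r) < norm (cpt_to_ball y)" "norm (cpt_to_ball y) \<le> 1" by auto
qed

lemma cpt_of_ball_in_topspace: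
  assumes "r \<ge> 0" "r / (1 + r) < norm b" "norm b \<le> 1"
  shows "cpt_of_ball b \<in> topspace (cpt_minus_ball r)"
proof (cases "norm b < 1")
  case True
  have "norm ((1 / (1 - norm b)) *\<^sub>R b) > r"
    using True assms by (simp add: field_simps)
  then show ?thesis using True
    by (auto simp: cpt_of_ball_def topspace_cpt_minus_ball cpt_points_def)
next
  case False
  then show ?thesis using assms
    by (auto simp: cpt_of_ball_def topspace_cpt_minus_ball cpt_points_def)
qed

lemma continuous_cpt_to_ball: "continuous_map (cpt_minus_ball r) euclidean (cpt_to_ball :: 'a::euclidean_space cpt \<Rightarrow> 'a)"
proof -
  have "continuous_map cpt_topology euclidean (id \<circ> (cpt_to_ball :: 'a cpt \<Rightarrow> 'a))"
    unfolding cpt_topology_def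
    by (rule continuous_map_pullback) (rule continuous_map_id)
  then have "continuous_map cpt_topology euclidean (cpt_to_ball :: 'a cpt \<Rightarrow> 'a)" by simp
  then show ?thesis unfolding cpt_minus_ball_def by (rule continuous_map_from_subtopology)
qed

lemma continuous_cpt_of_ball:
  assumes "r \<ge> 0" "S \<subseteq> {b. r / (1 + r) < norm b \<and> norm b \<le> 1}"
  shows "continuous_map (top_of_set S) (cpt_minus_ball r) cpt_of_ball"
proof -
  have img: "cpt_of_ball b \<in> cpt_points - Proper ` cball 0 r" if "b \<in> S" for b
  proof -
    have "r / (1 + r) < norm b" "norm b \<le> 1" using that assms(2) by auto
    from cpt_of_ball_in_topspace[OF assms(1) this] show ?thesis by (simp only: topspace_cpt_minus_ball)
  qed
  have inv: "cpt_to_ball (cpt_of_ball b) = b" if "b \<in> S" for b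
    by (rule cpt_to_of_ball) (use that assms(2) in auto)
  have "continuous_map (top_of_set S) cpt_topology cpt_of_ball"
    unfolding cpt_topology_def
  proof (rule continuous_map_pullback')
    have "continuous_map (top_of_set S) euclidean (\<lambda>b. b)"
      unfolding continuous_map_iff_continuous by (rule continuous_on_id)
    then show "continuous_map (top_of_set S) euclidean (cpt_to_ball \<circ> cpt_of_ball)"
      by (rule continuous_map_eq) (simp add: inv)
    show "topspace (top_of_set S) \<subseteq> cpt_of_ball -` cpt_points" using img by auto
  qed
  moreover have "cpt_of_ball ` S \<subseteq> cpt_points - Proper ` cball 0 r"
    using img by (rule image_subsetI)
  ultimately show ?thesis
    unfolding cpt_minus_ball_def continuous_map_in_subtopology by (simp add: image_subset_iff_funcset)
qed

lemma continuous_Proper: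
  assumes "r \<ge> 0"
  shows "continuous_map (top_of_set (- cball 0 r)) (cpt_minus_ball r) (Proper :: 'a::euclidean_space \<Rightarrow> _)"
proof -
  let ?b = "\<lambda>x::'a. (1 / (1 + norm x)) *\<^sub>R x"
  have pos: "1 + norm x \<noteq> 0" for x :: 'a by (smt (verit) norm_ge_zero)
  have "continuous_map (top_of_set (- cball 0 r)) (top_of_set {b. r / (1 + r) < norm b \<and> norm b \<le> 1}) ?b"
  proof (subst continuous_map_in_subtopology, intro conjI)
    have "continuous_on (- cball 0 r) ?b" by (intro continuous_intros) (use pos in auto)
    then show "continuous_map (top_of_set (- cball 0 r)) euclidean ?b"
      by (simp add: continuous_map_iff_continuous)
    show "?b \<in> topspace (top_of_set (- cball 0 r)) \<rightarrow> {b. r / (1 + r) < norm b \<and> norm b \<le> 1}"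
    proof
      fix x :: 'a assume "x \<in> topspace (top_of_set (- cball 0 r))"
      then have "Proper x \<in> topspace (cpt_minus_ball r)"
        by (auto simp: topspace_cpt_minus_ball cpt_points_def)
      from norm_cpt_to_ball_gt[OF assms this] show "?b x \<in> {b. r / (1 + r) < norm b \<and> norm b \<le> 1}"
        by auto
    qed
  qed
  from continuous_map_compose[OF this continuous_cpt_of_ball[OF assms subset_refl]]
  have "continuous_map (top_of_set (- cball 0 r)) (cpt_minus_ball r) (cpt_of_ball \<circ> ?b)" .
  then show ?thesis
  proof (rule continuous_map_eq)
    fix x :: 'a
    show "(cpt_of_ball \<circ> ?b) x = Proper x"
      using cpt_of_to_ball[of "Proper x"] by (simp add: cpt_points_def)
  qed
qed

text \<open>
  A continuous image of a closed annulus in the unit ball.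
\<close>

lemma compactin_cpt_annulus:
  assumes "r \<ge> 0" "r / (1 + r) < s"
  shows "compactin (cpt_minus_ball r)
    {y \<in> topspace (cpt_minus_ball r). s \<le> norm (cpt_to_ball y :: 'a::euclidean_space)}"
    (is "compactin _ ?K")
proof -
  let ?S = "{b::'a. s \<le> norm b \<and> norm b \<le> 1}"
  have "closed ?S" by (intro closed_Collect_conj closed_Collect_le continuous_intros)
  moreover have "bounded ?S" by (intro boundedI[of _ 1]) auto
  ultimately have "compact ?S" by (simp add: compact_eq_bounded_closed)
  then have "compactin (top_of_set ?S) ?S" by (simp add: compactin_subtopology)
  then have "compactin (cpt_minus_ball r) (cpt_of_ball ` ?S)"
    by (rule image_compactin) (rule continuous_cpt_of_ball, use assms in auto)
  moreover have "cpt_of_ball ` ?S = ?K"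
  proof safe
    fix b :: 'a assume b: "s \<le> norm b" "norm b \<le> 1"
    show "cpt_of_ball b \<in> topspace (cpt_minus_ball r)"
      using cpt_of_ball_in_topspace[of r b] b assms by auto
    show "s \<le> norm (cpt_to_ball (cpt_of_ball b))" using b by (simp add: cpt_to_of_ball)
  next
    fix y :: "'a cpt" assume y: "y \<in> topspace (cpt_minus_ball r)" "s \<le> norm (cpt_to_ball y)"
    then have "cpt_of_ball (cpt_to_ball y) = y"
      by (intro cpt_of_to_ball) (auto simp: topspace_cpt_minus_ball)
    then show "y \<in> cpt_of_ball ` ?S"
      using y norm_cpt_to_ball_gt(2)[OF assms(1) y(1)] by (metis (mono_tags, lifting) imageI mem_Collect_eq)
  qed
  ultimately show ?thesis by simp
qed

text \<open>
  On a compact set the continuous function \<open>norm \<circ> cpt_to_ball\<close> attains its minimum, which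
  exceeds the value \<open>r / (1 + r)\<close> taken on the removed sphere. Requiring \<open>s < 1\<close> guarantees that
  \<open>s\<close> corresponds to a finite radius, \<open>s / (1 - s)\<close>.
\<close>

lemma compactin_cpt_bounded_away:
  assumes "r \<ge> 0" "compactin (cpt_minus_ball r) K"
  obtains s where "r / (1 + r) < s" "s < 1" "\<And>y. y \<in> K \<Longrightarrow> s \<le> norm (cpt_to_ball y)"
proof -
  have "continuous_map (cpt_minus_ball r) euclideanreal (\<lambda>y. norm (cpt_to_ball y))"
    by (intro continuous_map_norm continuous_cpt_to_ball)
  from image_compactin[OF assms(2) this]
  have c: "compact ((\<lambda>y. norm (cpt_to_ball y)) ` K)" by simp
  have r1: "r / (1 + r) < 1" using assms by (simp add: field_simps)
  obtain s0 where s0: "r / (1 + r) < s0" "\<And>y. y \<in> K \<Longrightarrow> s0 \<le> norm (cpt_to_ball y)"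
  proof (cases "K = {}")
    case True then show ?thesis using that[of 1] r1 by auto
  next
    case False
    then obtain y where y: "y \<in> K" "\<And>z. z \<in> K \<Longrightarrow> norm (cpt_to_ball y) \<le> norm (cpt_to_ball z)"
      using compact_attains_inf[OF c] by auto
    have "y \<in> topspace (cpt_minus_ball r)" using y(1) assms(2) compactin_subset_topspace by blast
    from norm_cpt_to_ball_gt(1)[OF assms(1) this] y that show ?thesis by blast
  qed
  define s where "s = min s0 ((r / (1 + r) + 1) / 2)"
  have half: "q < (q + 1) / 2 \<and> (q + 1) / 2 < 1" if "q < 1" for q :: real
    using that by auto
  from half[OF r1] have "r / (1 + r) < s" "s < 1" using s0(1) by (auto simp: s_def min_less_iff_disj)
  moreover have "\<And>y. y \<in> K \<Longrightarrow> s \<le> norm (cpt_to_ball y)"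
    using s0(2) unfolding s_def by fastforce
  ultimately show ?thesis using that by blast
qed

text \<open>
  Transported to the closed unit ball and extended by zero, a test function is continuous on a
  compact set, hence uniformly continuous; and \<open>x \<mapsto> x / (1 + |x|)\<close> is Lipschitz. This
  translates vague convergence on the compactified space into a statement about bounded uniformly
  continuous functions on Euclidean space.
\<close>

lemma test_function_uniformly_continuous:
  fixes f :: "'a::euclidean_space cpt \<Rightarrow> real"
  assumes r: "r \<ge> 0" and f: "continuous_map (cpt_minus_ball r) euclideanreal f"
    and K: "compactin (cpt_minus_ball r) K" "\<forall>x \<in> topspace (cpt_minus_ball r) - K. f x = 0"
  defines "g \<equiv> \<lambda>x. indicator (- cball 0 r) x * f (Proper x)"
  obtains \<epsilon> where "\<epsilon> > 0" "\<And>x. norm x \<le> r + 2 * \<epsilon> \<Longrightarrow> g x = 0" "bounded (range g)"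
    "uniformly_continuous_on UNIV g"
proof -
  obtain s where s: "r / (1 + r) < s" "s < 1" "\<And>y. y \<in> K \<Longrightarrow> s \<le> norm (cpt_to_ball y)"
    using compactin_cpt_bounded_away[OF r K(1)] by blast
  define F where "F b = (if r / (1 + r) < norm b then f (cpt_of_ball b) else 0)" for b
  have F0: "F b = 0" if "norm b < s" "norm b \<le> 1" for b
  proof (cases "r / (1 + r) < norm b")
    case True
    have "cpt_of_ball b \<in> topspace (cpt_minus_ball r)"
      using cpt_of_ball_in_topspace[OF r True] that by auto
    moreover have "cpt_of_ball b \<notin> K" using s(3)[of "cpt_of_ball b"] that cpt_to_of_ball[of b] by auto
    ultimately show ?thesis using K(2) by (auto simp: F_def)
  qed (auto simp: F_def)
  have c1: "continuous_on {b \<in> cball 0 1. r / (1 + r) < norm b} F"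
  proof -
    have "continuous_map (top_of_set {b \<in> cball 0 1. r / (1 + r) < norm b}) euclideanreal (f \<circ> cpt_of_ball)"
      by (rule continuous_map_compose[OF continuous_cpt_of_ball f]) (use r in auto)
    then have "continuous_on {b \<in> cball 0 1. r / (1 + r) < norm b} (f \<circ> cpt_of_ball)"
      by (simp add: continuous_map_iff_continuous)
    then show ?thesis by (rule continuous_on_eq) (auto simp: F_def)
  qed
  have c2: "continuous_on {b \<in> cball 0 1. norm b < s} F"
    by (rule continuous_on_eq[OF continuous_on_const[of _ 0]]) (auto simp: F0)
  have o1: "openin (top_of_set (cball 0 1)) {b \<in> cball 0 1. r / (1 + r) < norm (b::'a)}"
    unfolding openin_open
    by (intro exI[of _ "{b. r / (1 + r) < norm b}"] conjI open_Collect_less continuous_intros) auto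
  have o2: "openin (top_of_set (cball 0 1)) {b \<in> cball 0 1. norm (b::'a) < s}"
    unfolding openin_open
    by (intro exI[of _ "{b. norm b < s}"] conjI open_Collect_less continuous_intros) auto
  have "{b \<in> cball 0 1. r / (1 + r) < norm b} \<union> {b \<in> cball 0 1. norm (b::'a) < s} = cball 0 1"
    using s(1) by auto
  with continuous_on_Un_local_open[OF _ _ c1 c2] o1 o2
  have cF: "continuous_on (cball 0 1) F" by simp
  then have uF: "uniformly_continuous_on (cball 0 1) F"
    by (intro compact_uniformly_continuous) auto
  let ?b = "\<lambda>x::'a. (1 / (1 + norm x)) *\<^sub>R x"
  have b1: "?b x \<in> cball 0 1" for x
  proof -
    have "norm x / (1 + norm x) \<le> 1" by (smt (verit) divide_le_eq_1 norm_ge_zero)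
    then show ?thesis using norm_cpt_to_ball_Proper[of x] by simp
  qed
  \<comment> \<open>Split the difference into a change of direction and a change of the denominator.\<close>
  have lip: "norm (?b x - ?b y) \<le> 2 * norm (x - y)" for x y :: 'a
  proof -
    have px: "1 + norm x > 0" and py: "1 + norm y > 0" by (smt (verit) norm_ge_zero)+
    have "?b x - ?b y = (1 / (1 + norm x)) *\<^sub>R (x - y) + ((norm y - norm x) / ((1 + norm x) * (1 + norm y))) *\<^sub>R y"
    proof -
      have e: "(norm y - norm x) / ((1 + norm x) * (1 + norm y)) = 1 / (1 + norm x) - 1 / (1 + norm y)"
        using px py by (simp add: field_simps)
      show ?thesis unfolding e by (simp add: algebra_simps)
    qed
    also have "norm \<dots> \<le> norm ((1 / (1 + norm x)) *\<^sub>R (x - y)) + norm (((norm y - norm x) / ((1 + norm x) * (1 + norm y))) *\<^sub>R y)"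
      by (rule norm_triangle_ineq)
    also have "norm ((1 / (1 + norm x)) *\<^sub>R (x - y)) \<le> norm (x - y)"
    proof -
      have "(1 / (1 + norm x)) * norm (x - y) \<le> 1 * norm (x - y)"
        by (rule mult_right_mono) (use px in auto)
      then show ?thesis using px by simp
    qed
    also have "norm (((norm y - norm x) / ((1 + norm x) * (1 + norm y))) *\<^sub>R y) \<le> norm (x - y)"
    proof -
      have "norm (((norm y - norm x) / ((1 + norm x) * (1 + norm y))) *\<^sub>R y)
          = \<bar>norm y - norm x\<bar> * (norm y / ((1 + norm x) * (1 + norm y)))"
        using px py by (simp add: abs_mult)
      also have "\<dots> \<le> norm (x - y) * 1"
      proof (rule mult_mono)
        show "\<bar>norm y - norm x\<bar> \<le> norm (x - y)" by (metis norm_minus_commute norm_triangle_ineq3)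
        have "norm y \<le> (1 + norm x) * (1 + norm y)" by (simp add: algebra_simps add_nonneg_nonneg)
        then show "norm y / ((1 + norm x) * (1 + norm y)) \<le> 1" using px py by simp
      qed (use px py in auto)
      finally show ?thesis by simp
    qed
    finally show ?thesis by simp
  qed
  have gF: "g x = F (?b x)" for x
  proof (cases "norm x > r")
    case True
    then show ?thesis
      using r frac_less_iff[of r "norm x"] cpt_of_to_ball[of "Proper x"] norm_cpt_to_ball_Proper[of x]
      by (auto simp: g_def F_def cpt_points_def)
  next
    case False
    then show ?thesis
      using r frac_less_iff[of r "norm x"] norm_cpt_to_ball_Proper[of x]
      by (auto simp: g_def F_def)
  qed
  have rs: "r < s / (1 - s)" using s(1,2) r by (simp add: field_simps)
  \<comment> \<open>The radius \<open>s / (1 - s)\<close> belongs to the norm \<open>s\<close> in the ball; a third of the gap leaves \<open>r + 2 * \<epsilon>\<close> below it.\<close>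
  define \<epsilon> where "\<epsilon> = (s / (1 - s) - r) / 3"
  have e0: "\<epsilon> > 0" using rs by (simp add: \<epsilon>_def)
  have g0: "g x = 0" if "norm x \<le> r + 2 * \<epsilon>" for x
  proof -
    have "3 * \<epsilon> = s / (1 - s) - r" by (simp add: \<epsilon>_def)
    then have "norm x < s / (1 - s)" using that e0 by linarith
    then have "norm x * (1 - s) < s" using s(2) by (simp add: field_simps)
    then have "norm x < s * (1 + norm x)" by (simp add: algebra_simps)
    moreover have "1 + norm x > 0" by (smt (verit) norm_ge_zero)
    ultimately have "norm (?b x) < s" using norm_cpt_to_ball_Proper[of x] by (simp add: field_simps)
    with F0[OF this] b1[of x] gF[of x] show ?thesis by auto
  qed
  have bd: "bounded (range g)"
  proof -
    have "compact (F ` cball 0 1)" by (intro compact_continuous_image cF) auto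
    then have "bounded (F ` cball 0 1)" by (rule compact_imp_bounded)
    moreover have "range g \<subseteq> F ` cball 0 1" using gF b1 by (metis image_eqI image_subsetI)
    ultimately show ?thesis by (rule bounded_subset)
  qed
  have uc: "uniformly_continuous_on UNIV g"
    unfolding uniformly_continuous_on_def
  proof (intro allI impI)
    fix e :: real assume "e > 0"
    then obtain d where d: "d > 0" "\<And>x y. x \<in> cball 0 1 \<Longrightarrow> y \<in> cball 0 1 \<Longrightarrow> dist y x < d \<Longrightarrow> dist (F y) (F x) < e"
      using uF unfolding uniformly_continuous_on_def by metis
    show "\<exists>d>0. \<forall>x\<in>UNIV. \<forall>x'\<in>UNIV. dist x' x < d \<longrightarrow> dist (g x') (g x) < e"
    proof (intro exI[of _ "d / 2"] conjI ballI impI)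
      fix x x' :: 'a assume "dist x' x < d / 2"
      then have "dist (?b x') (?b x) < d" using lip[of x' x] by (simp add: dist_norm)
      then show "dist (g x') (g x) < e" unfolding gF by (intro d(2) b1)
    qed (use d in auto)
  qed
  show ?thesis using that[OF e0 g0 bd uc] .
qed

text \<open>
  Conversely, a function of \<open>clip R x\<close> is constant along rays outside the ball of radius \<open>R\<close>
  and so extends continuously to the sphere at infinity.
\<close>

lemma clip_test_function:
  fixes g :: "'a::euclidean_space \<Rightarrow> real"
  assumes R: "R > 0" and g: "continuous_on UNIV g" and e: "e > 0" "\<And>x. norm x \<le> e \<Longrightarrow> g x = 0"
  obtains f where "continuous_map (cpt_minus_ball 0) euclideanreal f"
    "\<exists>K. compactin (cpt_minus_ball 0) K \<and> (\<forall>x \<in> topspace (cpt_minus_ball 0) - K. f x = 0)"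
    "\<And>x. f (Proper x) = g (clip R x)"
proof -
  \<comment> \<open>This is \<open>clip R\<close> in the coordinates of the unit ball; the denominator never vanishes.\<close>
  define t :: "'a \<Rightarrow> 'a" where "t b = (1 / max (1 - norm b) (norm b / R)) *\<^sub>R b" for b
  define f where "f y = g (t (cpt_to_ball y))" for y
  have mpos: "max (1 - norm b) (norm b / R) > 0" for b :: 'a
    using R by (cases "norm b < 1") (auto simp: less_max_iff_disj intro!: divide_pos_pos)
  have ct: "continuous_on UNIV t" unfolding t_def
    by (intro continuous_intros) (use mpos R in \<open>auto simp: less_imp_neq[symmetric]\<close>)
  have "continuous_on UNIV (g \<circ> t)" 
    by (rule continuous_on_compose) (use ct g in \<open>auto intro: continuous_on_subset\<close>)
  then have cgt: "continuous_map euclidean euclideanreal (g \<circ> t)" 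
    by (simp add: continuous_map_iff_continuous2)
  have 1: "continuous_map (cpt_minus_ball 0) euclideanreal f"
    using continuous_map_compose[OF continuous_cpt_to_ball[of 0] cgt] by (simp add: f_def[abs_def] comp_def)
  have 3: "f (Proper x) = g (clip R x)" for x
  proof -
    have px: "1 + norm x > 0" by (smt (verit) norm_ge_zero)
    have "1 - norm x / (1 + norm x) = 1 / (1 + norm x)" using px by (simp add: field_simps)
    then have "max (1 - norm (cpt_to_ball (Proper x))) (norm (cpt_to_ball (Proper x)) / R)
       = max R (norm x) / (R * (1 + norm x))"
      unfolding norm_cpt_to_ball_Proper using px R by (simp add: max_divide_distrib_right mult.commute)
    moreover have "1 / (m / (R * q)) * (1 / q) = R / m" if "q > 0" for m q :: real
      using that R by (simp add: field_simps)
    ultimately have "t (cpt_to_ball (Proper x)) = clip R x"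
      unfolding t_def clip_def using px by simp
    then show ?thesis by (simp add: f_def)
  qed
  define s where "s = e / (1 + e)"
  have s: "s > 0" "s < 1" using e by (auto simp: s_def)
  have small: "norm (t b) \<le> e" if "norm b < s" for b
  proof -
    have "norm (t b) = norm b / max (1 - norm b) (norm b / R)" 
      using mpos[of b] by (simp add: t_def)
    also have "\<dots> \<le> norm b / (1 - norm b)" 
      using that s by (intro divide_left_mono) (auto intro!: mult_pos_pos mpos)
    also have "\<dots> \<le> e"
    proof -
      have "norm b * (1 + e) < e" using that e(1) by (simp add: s_def field_simps)
      then have "norm b \<le> e * (1 - norm b)" by (simp add: algebra_simps)
      then show ?thesis using that s(2) by (simp add: pos_divide_le_eq)
    qed
    finally show ?thesis .
  qed
  have 2: "\<exists>K. compactin (cpt_minus_ball 0) K \<and> (\<forall>x \<in> topspace (cpt_minus_ball 0) - K. f x = 0)"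
  proof (intro exI conjI ballI)
    show "compactin (cpt_minus_ball 0) {y \<in> topspace (cpt_minus_ball 0). s \<le> norm (cpt_to_ball y)}"
      by (rule compactin_cpt_annulus) (use s in auto)
    fix x :: "'a cpt" assume "x \<in> topspace (cpt_minus_ball 0) - {y \<in> topspace (cpt_minus_ball 0). s \<le> norm (cpt_to_ball y)}"
    then show "f x = 0" using small e(2) by (auto simp: f_def)
  qed
  show ?thesis using that[OF 1 2 3] .
qed

lemma sets_borel_of_top_of_set:
  assumes "S \<in> sets borel"
  shows "sets (borel_of_topology (top_of_set S)) = sets (restrict_space borel (S::'a::euclidean_space set))"
proof -
  have *: "{U. openin (top_of_set S) U} = (\<inter>) S ` {U. open U}"
    by (auto simp: openin_open)
  have "sets (borel_of_topology (top_of_set S)) = sigma_sets S ((\<inter>) S ` {U. open U})"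
    unfolding borel_of_topology_def * by (subst sets_measure_of) auto
  also have "\<dots> = (\<inter>) S ` sigma_sets UNIV {U. open U}"
    by (subst sigma_sets_Int) (use assms in \<open>auto simp: borel_def\<close>)
  also have "\<dots> = sets (restrict_space borel S)"
    by (simp add: sets_restrict_space borel_def)
  finally show ?thesis .
qed

section \<open>Tails of regularly varying random variables\<close>

text \<open>
  Regular variation is used by comparing the tail at \<open>t\<close> and at \<open>2 * t\<close>. Estimates whose
  constants reproduce themselves under doubling spread from the first block to all larger \<open>t\<close>,
  which avoids dyadic series.
\<close>

lemma doubling_induct:
  fixes t0 :: real
  assumes "t0 > 0" and base: "\<And>t. t0 \<le> t \<Longrightarrow> t \<le> 2 * t0 \<Longrightarrow> P t"
    and step: "\<And>t. t0 \<le> t \<Longrightarrow> P t \<Longrightarrow> P (2 * t)" and "t0 \<le> t"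
  shows "P t"
proof -
  obtain n :: nat where n: "t / t0 < 2 ^ n" using real_arch_pow[of 2 "t / t0"] by auto
  have "t0 \<le> t \<Longrightarrow> t \<le> 2 ^ n * t0 \<Longrightarrow> P t" for n t
  proof (induction n arbitrary: t)
    case (Suc n)
    show ?case
    proof (cases "t \<le> 2 * t0")
      case False
      then have "P (t / 2)" using Suc by (intro Suc.IH) auto
      with step[of "t / 2"] False show ?thesis by simp
    qed (use base Suc in auto)
  qed (use base assms in auto)
  moreover have "t \<le> 2 ^ n * t0" using n assms(1) by (simp add: field_simps)
  ultimately show ?thesis using assms by blast
qed

definition trunc_moment :: "'w measure \<Rightarrow> ('w \<Rightarrow> real) \<Rightarrow> real \<Rightarrow> real \<Rightarrow> real" where
  "trunc_moment M h s t = (\<integral>\<omega>. h \<omega> powr s * indicator {..t} (h \<omega>) \<partial>M)"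

locale nonneg_rv = prob_space M for M :: "'w measure" +
  fixes h :: "'w \<Rightarrow> real"
  assumes h_meas [measurable]: "h \<in> borel_measurable M" and h_nonneg: "\<And>\<omega>. h \<omega> \<ge> 0"
begin

abbreviation Q :: "real \<Rightarrow> real" where "Q \<equiv> tail M h"

lemma Q_nonneg: "Q t \<ge> 0"
  by (auto simp: tail_def)

lemma Q_antimono: "s \<le> t \<Longrightarrow> Q t \<le> Q s"
  unfolding tail_def by (intro finite_measure_mono) auto

lemma Q_eq_expectation: "Q t = (\<integral>\<omega>. indicator {t<..} (h \<omega>) \<partial>M)"
proof -
  have "(\<integral>\<omega>. indicator {t<..} (h \<omega>) \<partial>M) = (\<integral>\<omega>. indicator {\<omega> \<in> space M. h \<omega> > t} \<omega> \<partial>M)"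
    by (intro Bochner_Integration.integral_cong) (auto simp: indicator_def)
  also have "\<dots> = Q t" by (simp add: tail_def)
  finally show ?thesis by simp
qed

lemma integrable_above: "integrable M (\<lambda>\<omega>. indicat_real {t<..} (h \<omega>))"
  by (intro integrable_const_bound[of _ 1]) (auto simp: indicator_def)

lemma integrable_powr_trunc: "s > 0 \<Longrightarrow> integrable M (\<lambda>\<omega>. h \<omega> powr s * indicator {..t} (h \<omega>))"
proof (rule integrable_const_bound[of _ "\<bar>t\<bar> powr s"])
  assume "s > 0"
  show "AE \<omega> in M. norm (h \<omega> powr s * indicator {..t} (h \<omega>)) \<le> \<bar>t\<bar> powr s"
    using h_nonneg \<open>s > 0\<close> by (intro AE_I2) (auto simp: indicator_def intro!: powr_mono2)
qed auto

lemma trunc_moment_mono: "s > 0 \<Longrightarrow> t \<le> u \<Longrightarrow> trunc_moment M h s t \<le> trunc_moment M h s u"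
  unfolding trunc_moment_def
  by (intro integral_mono integrable_powr_trunc) (auto simp: indicator_def)

lemma trunc_moment_le: "s > 0 \<Longrightarrow> t \<ge> 0 \<Longrightarrow> trunc_moment M h s t \<le> t powr s"
proof -
  assume st: "s > 0" "t \<ge> 0"
  have "trunc_moment M h s t \<le> (\<integral>\<omega>. t powr s \<partial>M)"
    unfolding trunc_moment_def
    by (intro integral_mono integrable_powr_trunc st)
      (use h_nonneg st in \<open>auto simp: indicator_def intro!: powr_mono2\<close>)
  then show ?thesis by (simp add: prob_space)
qed

lemma trunc_moment_double:
  assumes "s > 0" "t > 0"
  shows "trunc_moment M h s (2 * t) \<le> trunc_moment M h s t + (2 * t) powr s * Q t"
proof -
  have i: "integrable M (\<lambda>\<omega>. (2 * t) powr s * indicator {t<..} (h \<omega>))"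
    by (intro integrable_mult_right integrable_const_bound[of _ 1]) (auto simp: indicator_def)
  have "trunc_moment M h s (2 * t) \<le> (\<integral>\<omega>. h \<omega> powr s * indicator {..t} (h \<omega>) + (2 * t) powr s * indicator {t<..} (h \<omega>) \<partial>M)"
    unfolding trunc_moment_def
    by (intro integral_mono Bochner_Integration.integrable_add integrable_powr_trunc i assms)
      (use h_nonneg assms in \<open>auto simp: indicator_def intro!: powr_mono2\<close>)
  also have "\<dots> = trunc_moment M h s t + (2 * t) powr s * Q t"
    unfolding trunc_moment_def Q_eq_expectation
    by (subst Bochner_Integration.integral_add) (auto intro: integrable_powr_trunc integrable_above assms i)
  finally show ?thesis .
qed

end

locale regvar_rv = nonneg_rv +
  fixes \<alpha> :: real
  assumes Q_pos: "\<And>t. Q t > 0"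
    and Q_regvar: "\<And>c. c > 0 \<Longrightarrow> ((\<lambda>t. Q (c * t) / Q t) \<longlongrightarrow> c powr (- \<alpha>)) at_top"
begin

lemma Q_double_lower:
  assumes "\<beta> > \<alpha>" obtains t0 where "t0 > 0" "\<And>t. t \<ge> t0 \<Longrightarrow> 2 powr (- \<beta>) * Q t \<le> Q (2 * t)"
proof -
  have "2 powr (-\<beta>) < (2::real) powr (-\<alpha>)" using assms by (intro powr_less_mono) auto
  from order_tendstoD(1)[OF Q_regvar[of 2] this]
  obtain t1 where t1: "\<And>t. t \<ge> t1 \<Longrightarrow> 2 powr (-\<beta>) < Q (2 * t) / Q t"
    unfolding eventually_at_top_linorder by auto
  show ?thesis
  proof (rule that[of "max 1 t1"])
    fix t assume "max 1 t1 \<le> t"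
    then have "2 powr (-\<beta>) < Q (2 * t) / Q t" using t1 by auto
    then show "2 powr (- \<beta>) * Q t \<le> Q (2 * t)" using Q_pos[of t] by (simp add: pos_less_divide_eq)
  qed auto
qed

lemma Q_double_upper:
  assumes "\<beta> < \<alpha>" obtains t0 where "t0 > 0" "\<And>t. t \<ge> t0 \<Longrightarrow> Q (2 * t) \<le> 2 powr (- \<beta>) * Q t"
proof -
  have "2 powr (-\<beta>) > (2::real) powr (-\<alpha>)" using assms by (intro powr_less_mono) auto
  from order_tendstoD(2)[OF Q_regvar[of 2] this]
  obtain t1 where t1: "\<And>t. t \<ge> t1 \<Longrightarrow> 2 powr (-\<beta>) > Q (2 * t) / Q t"
    unfolding eventually_at_top_linorder by auto
  show ?thesis
  proof (rule that[of "max 1 t1"])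
    fix t assume "max 1 t1 \<le> t"
    then have "2 powr (-\<beta>) > Q (2 * t) / Q t" using t1 by auto
    then show "Q (2 * t) \<le> 2 powr (- \<beta>) * Q t" using Q_pos[of t] by (simp add: pos_divide_less_eq)
  qed auto
qed

text \<open>
  This bound and the next are Potter's bounds relative to a fixed base point.
\<close>

lemma Q_lower:
  assumes "\<beta> > \<alpha>" "\<beta> > 0"
  obtains c t0 where "c > 0" "t0 > 0" "\<And>t. t \<ge> t0 \<Longrightarrow> c * t powr (- \<beta>) \<le> Q t"
proof -
  obtain t0 where t0: "t0 > 0" "\<And>t. t \<ge> t0 \<Longrightarrow> 2 powr (- \<beta>) * Q t \<le> Q (2 * t)"
    using Q_double_lower[OF assms(1)] by blast
  define c where "c = Q (2 * t0) / t0 powr (- \<beta>)"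
  have c: "c > 0" using Q_pos t0 by (auto simp: c_def)
  have "c * t powr (- \<beta>) \<le> Q t" if "t \<ge> t0" for t
  proof (rule doubling_induct[OF t0(1) _ _ that])
    fix t assume t: "t0 \<le> t" "t \<le> 2 * t0"
    have "c * t powr (-\<beta>) \<le> c * t0 powr (-\<beta>)"
      using c t t0 assms by (intro mult_left_mono powr_mono2') auto
    also have "\<dots> = Q (2 * t0)" using t0 by (simp add: c_def)
    also have "\<dots> \<le> Q t" using t by (intro Q_antimono)
    finally show "c * t powr (-\<beta>) \<le> Q t" .
  next
    fix t assume t: "t0 \<le> t" "c * t powr (-\<beta>) \<le> Q t"
    have "c * (2 * t) powr (-\<beta>) = 2 powr (-\<beta>) * (c * t powr (-\<beta>))"
      using t t0 by (simp add: powr_mult)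
    also have "\<dots> \<le> 2 powr (-\<beta>) * Q t" using t by (intro mult_left_mono) auto
    also have "\<dots> \<le> Q (2 * t)" using t0 t by auto
    finally show "c * (2 * t) powr (-\<beta>) \<le> Q (2 * t)" .
  qed
  with that[OF c t0(1)] show ?thesis by blast
qed

lemma Q_upper:
  assumes "\<beta> < \<alpha>" "\<beta> > 0"
  obtains C t0 where "C > 0" "t0 > 0" "\<And>t. t \<ge> t0 \<Longrightarrow> Q t \<le> C * t powr (- \<beta>)"
proof -
  obtain t0 where t0: "t0 > 0" "\<And>t. t \<ge> t0 \<Longrightarrow> Q (2 * t) \<le> 2 powr (- \<beta>) * Q t"
    using Q_double_upper[OF assms(1)] by blast
  define C where "C = Q t0 / (2 * t0) powr (- \<beta>)"
  have C: "C > 0" using Q_pos t0 by (auto simp: C_def)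
  have "Q t \<le> C * t powr (- \<beta>)" if "t \<ge> t0" for t
  proof (rule doubling_induct[OF t0(1) _ _ that])
    fix t assume t: "t0 \<le> t" "t \<le> 2 * t0"
    have "Q t \<le> Q t0" using t by (intro Q_antimono)
    also have "\<dots> = C * (2 * t0) powr (-\<beta>)" using t0 by (simp add: C_def)
    also have "\<dots> \<le> C * t powr (-\<beta>)"
      using C t t0 assms by (intro mult_left_mono powr_mono2') auto
    finally show "Q t \<le> C * t powr (-\<beta>)" .
  next
    fix t assume t: "t0 \<le> t" "Q t \<le> C * t powr (-\<beta>)"
    have "Q (2 * t) \<le> 2 powr (-\<beta>) * Q t" using t0 t by auto
    also have "\<dots> \<le> 2 powr (-\<beta>) * (C * t powr (-\<beta>))" using t by (intro mult_left_mono) auto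
    also have "\<dots> = C * (2 * t) powr (-\<beta>)"
      using t t0 by (simp add: powr_mult)
    finally show "Q (2 * t) \<le> C * (2 * t) powr (-\<beta>)" .
  qed
  with that[OF C t0(1)] show ?thesis by blast
qed

text \<open>
  Karamata's estimate for truncated moments of order above the index. With \<open>\<beta>\<close> strictly between
  \<open>\<alpha>\<close> and \<open>s\<close> the factor \<open>q = 2 powr (\<beta> - s)\<close> is below \<open>1\<close>, and the constant \<open>C\<close> is taken so large
  that \<open>(C + 2 powr s) * q \<le> C\<close>: this is the inequality that doubling requires.
\<close>

lemma trunc_moment_above:
  assumes "s > \<alpha>" "s > 0"
  obtains C t0 where "C > 0" "t0 > 0" "\<And>t. t \<ge> t0 \<Longrightarrow> trunc_moment M h s t \<le> C * t powr s * Q t"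
proof -
  define \<beta> where "\<beta> = (\<alpha> + s) / 2"
  have \<beta>: "\<beta> > \<alpha>" "\<beta> < s" using assms by (auto simp: \<beta>_def)
  obtain t0 where t0: "t0 > 0" "\<And>t. t \<ge> t0 \<Longrightarrow> 2 powr (- \<beta>) * Q t \<le> Q (2 * t)"
    using Q_double_lower[OF \<beta>(1)] by blast
  define q where "q = (2::real) powr (\<beta> - s)"
  have q: "0 < q" "q < 1" using \<beta> powr_less_mono[of "\<beta> - s" 0 2] by (auto simp: q_def)
  define C where "C = max (2 powr \<beta> / (1 - q)) ((2 * t0) powr s / (t0 powr s * Q (2 * t0)))"
  have C: "C > 0" using q by (auto simp: C_def less_max_iff_disj)
  have "trunc_moment M h s t \<le> C * t powr s * Q t" if "t \<ge> t0" for t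
  proof (rule doubling_induct[OF t0(1) _ _ that])
    fix t assume t: "t0 \<le> t" "t \<le> 2 * t0"
    have "trunc_moment M h s t \<le> t powr s" using t t0 assms by (intro trunc_moment_le) auto
    also have "\<dots> \<le> (2 * t0) powr s" using t t0 assms by (intro powr_mono2) auto
    also have "\<dots> \<le> C * (t0 powr s * Q (2 * t0))"
    proof -
      have "(2 * t0) powr s / (t0 powr s * Q (2 * t0)) \<le> C" by (simp add: C_def)
      moreover have "t0 powr s * Q (2 * t0) > 0" using t0 Q_pos by simp
      ultimately show ?thesis by (simp add: pos_divide_le_eq)
    qed
    also have "\<dots> \<le> C * (t powr s * Q t)"
      using C t t0 assms Q_nonneg by (intro mult_left_mono mult_mono powr_mono2 Q_antimono) auto
    finally show "trunc_moment M h s t \<le> C * t powr s * Q t" by (simp add: mult.assoc)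
  next
    fix t assume t: "t0 \<le> t" "trunc_moment M h s t \<le> C * t powr s * Q t"
    have tp: "t > 0" using t t0 by auto
    have "2 powr \<beta> \<le> C * (1 - q)"
    proof -
      have "2 powr \<beta> / (1 - q) \<le> C" by (simp add: C_def)
      then show ?thesis using q by (simp add: pos_divide_le_eq)
    qed
    then have key: "(C + 2 powr s) * q \<le> C"
      unfolding q_def by (simp add: algebra_simps powr_add[symmetric])
    have "trunc_moment M h s (2 * t) \<le> trunc_moment M h s t + (2 * t) powr s * Q t"
      by (intro trunc_moment_double assms tp)
    also have "\<dots> \<le> (C + 2 powr s) * (t powr s * Q t)"
      using t tp by (simp add: algebra_simps powr_mult)
    also have "\<dots> = (C + 2 powr s) * q * ((2 * t) powr s * (2 powr (-\<beta>) * Q t))"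
      using tp by (simp add: q_def powr_mult powr_diff powr_minus field_simps)
    also have "\<dots> \<le> C * ((2 * t) powr s * (2 powr (-\<beta>) * Q t))"
      using Q_nonneg by (intro mult_right_mono key) auto
    also have "\<dots> \<le> C * ((2 * t) powr s * Q (2 * t))"
      using C t t0 by (intro mult_left_mono) auto
    finally show "trunc_moment M h s (2 * t) \<le> C * (2 * t) powr s * Q (2 * t)" by (simp add: mult.assoc)
  qed
  with that[OF C t0(1)] show ?thesis by blast
qed

text \<open>
  Each doubling of \<open>t\<close> adds at most a constant times \<open>t powr (s - \<beta>)\<close>, a geometric series since
  \<open>s < \<beta>\<close>. The induction goes through for \<open>D - E * t powr (s - \<beta>)\<close>, where the subtracted term is the
  part of the series that is still to come.
\<close>

lemma trunc_moment_below:
  assumes "s < \<alpha>" "s > 0"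
  obtains D where "D > 0" "\<And>t. trunc_moment M h s t \<le> D"
proof -
  define \<beta> where "\<beta> = (\<alpha> + s) / 2"
  have \<beta>: "\<beta> < \<alpha>" "\<beta> > s" "\<beta> > 0" using assms by (auto simp: \<beta>_def)
  obtain C t0 where C: "C > 0" "t0 > 0" "\<And>t. t \<ge> t0 \<Longrightarrow> Q t \<le> C * t powr (- \<beta>)"
    using Q_upper[OF \<beta>(1,3)] by blast
  define q where "q = (2::real) powr (s - \<beta>)"
  have q: "0 < q" "q < 1" using \<beta> powr_less_mono[of "s - \<beta>" 0 2] by (auto simp: q_def)
  define E where "E = 2 powr s * C / (1 - q)"
  have E: "E > 0" "E * (1 - q) = 2 powr s * C" using q C by (auto simp: E_def)
  define D where "D = (2 * t0) powr s + E * t0 powr (s - \<beta>)"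
  have D: "D > 0" using E C by (auto simp: D_def intro: add_pos_pos)
  have main: "trunc_moment M h s t \<le> D - E * t powr (s - \<beta>)" if "t \<ge> t0" for t
  proof (rule doubling_induct[OF C(2) _ _ that])
    fix t assume t: "t0 \<le> t" "t \<le> 2 * t0"
    have "trunc_moment M h s t \<le> t powr s" using t C assms by (intro trunc_moment_le) auto
    also have "\<dots> \<le> (2 * t0) powr s" using t C assms by (intro powr_mono2) auto
    also have "E * t powr (s - \<beta>) \<le> E * t0 powr (s - \<beta>)"
      using E t C \<beta> by (intro mult_left_mono powr_mono2') auto
    then have "(2 * t0) powr s \<le> D - E * t powr (s - \<beta>)" by (simp add: D_def)
    finally show "trunc_moment M h s t \<le> D - E * t powr (s - \<beta>)" .
  next
    fix t assume t: "t0 \<le> t" "trunc_moment M h s t \<le> D - E * t powr (s - \<beta>)"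
    have tp: "t > 0" using t C by auto
    have "trunc_moment M h s (2 * t) \<le> trunc_moment M h s t + (2 * t) powr s * Q t"
      by (intro trunc_moment_double assms tp)
    also have "\<dots> \<le> (D - E * t powr (s - \<beta>)) + (2 * t) powr s * (C * t powr (- \<beta>))"
      using t C by (intro add_mono mult_left_mono) auto
    also have "(2 * t) powr s * (C * t powr (- \<beta>)) = (E * (1 - q)) * t powr (s - \<beta>)"
      unfolding E(2) using tp by (simp add: powr_mult powr_diff powr_minus field_simps)
    also have "(D - E * t powr (s - \<beta>)) + (E * (1 - q)) * t powr (s - \<beta>) = D - E * (2 * t) powr (s - \<beta>)"
      using tp by (simp add: powr_mult q_def algebra_simps)
    finally show "trunc_moment M h s (2 * t) \<le> D - E * (2 * t) powr (s - \<beta>)" .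
  qed
  have "trunc_moment M h s t \<le> D" for t
  proof -
    have "trunc_moment M h s t \<le> trunc_moment M h s (max t t0)"
      using assms by (intro trunc_moment_mono) auto
    also have "\<dots> \<le> D - E * (max t t0) powr (s - \<beta>)" by (intro main) auto
    also have "\<dots> \<le> D" using E by simp
    finally show ?thesis .
  qed
  with that[OF D] show ?thesis by blast
qed

text \<open>
  Karamata's estimate for the first moment beyond \<open>t\<close>. The bound over \<open>{t<..2 ^ n * t}\<close> follows by
  induction on \<open>n\<close> with a constant that does not depend on \<open>n\<close>, and integrability allows \<open>n\<close> to tend
  to infinity.
\<close>

lemma expectation_above:
  assumes "\<alpha> > 1" and int: "integrable M h"
  obtains C t0 where "C > 0" "t0 > 0"
    "\<And>t. t \<ge> t0 \<Longrightarrow> (\<integral>\<omega>. h \<omega> * indicator {t<..} (h \<omega>) \<partial>M) \<le> C * t * Q t"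
proof -
  define \<beta> where "\<beta> = (\<alpha> + 1) / 2"
  have \<beta>: "\<beta> < \<alpha>" "\<beta> > 1" using assms by (auto simp: \<beta>_def)
  obtain t0 where t0: "t0 > 0" "\<And>t. t \<ge> t0 \<Longrightarrow> Q (2 * t) \<le> 2 powr (- \<beta>) * Q t"
    using Q_double_upper[OF \<beta>(1)] by blast
  define q where "q = (2::real) powr (1 - \<beta>)"
  have q: "0 < q" "q < 1" using \<beta> powr_less_mono[of "1 - \<beta>" 0 2] by (auto simp: q_def)
  define C where "C = 2 / (1 - q)"
  have C: "C > 0" "C * q + 2 = C" using q by (auto simp: C_def field_simps)
  define e where "e a b = (\<integral>\<omega>. h \<omega> * indicator {a<..b} (h \<omega>) \<partial>M)" for a b
  have ie: "integrable M (\<lambda>\<omega>. h \<omega> * indicator {a<..b} (h \<omega>))" for a b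
    by (rule Bochner_Integration.integrable_bound[OF int]) (auto simp: indicator_def h_nonneg)
  have fin: "e t (2 ^ n * t) \<le> C * t * Q t" if "t \<ge> t0" for n t
    using that
  proof (induction n arbitrary: t)
    case 0
    then show ?case using C t0 Q_nonneg by (simp add: e_def)
  next
    case (Suc n)
    then have tp: "t > 0" using t0 by simp
    have i: "integrable M (\<lambda>\<omega>. (2 * t) * indicator {t<..} (h \<omega>))"
      by (intro integrable_mult_right integrable_const_bound[of _ 1]) (auto simp: indicator_def)
    have "e t (2 ^ Suc n * t) \<le> (\<integral>\<omega>. (2 * t) * indicator {t<..} (h \<omega>) + h \<omega> * indicator {2*t<..2 ^ n * (2 * t)} (h \<omega>) \<partial>M)"
      unfolding e_def
      by (intro integral_mono Bochner_Integration.integrable_add ie i)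
        (use tp h_nonneg in \<open>auto simp: indicator_def mult.commute mult.left_commute\<close>)
    also have "\<dots> = 2 * t * Q t + e (2 * t) (2 ^ n * (2 * t))"
      unfolding e_def Q_eq_expectation by (subst Bochner_Integration.integral_add) (auto intro: ie i integrable_above)
    also have "\<dots> \<le> 2 * t * Q t + C * (2 * t) * Q (2 * t)"
      using Suc.prems t0 by (intro add_left_mono Suc.IH) auto
    also have "\<dots> \<le> 2 * t * Q t + C * (2 * t) * (2 powr (-\<beta>) * Q t)"
      using Suc.prems t0 C by (intro add_left_mono mult_left_mono) auto
    also have "\<dots> = (C * q + 2) * t * Q t"
      by (simp add: q_def powr_diff powr_minus field_simps)
    finally show ?case unfolding C(2) .
  qed
  have "(\<integral>\<omega>. h \<omega> * indicator {t<..} (h \<omega>) \<partial>M) \<le> C * t * Q t" if t: "t \<ge> t0" for t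
  proof (rule LIMSEQ_le_const2)
    have tp: "t > 0" using t t0 by simp
    show "(\<lambda>n. e t (2 ^ n * t)) \<longlonglongrightarrow> (\<integral>\<omega>. h \<omega> * indicator {t<..} (h \<omega>) \<partial>M)"
      unfolding e_def
    proof (rule integral_dominated_convergence[where w = h])
      show "AE \<omega> in M. (\<lambda>n. h \<omega> * indicator {t<..2 ^ n * t} (h \<omega>)) \<longlonglongrightarrow> h \<omega> * indicator {t<..} (h \<omega>)"
      proof (intro AE_I2 tendsto_eventually)
        fix \<omega>
        obtain n0 :: nat where n0: "h \<omega> / t < 2 ^ n0" using real_arch_pow[of 2 "h \<omega> / t"] by auto
        have "h \<omega> \<le> 2 ^ n * t" if "n \<ge> n0" for n
        proof -
          have "h \<omega> \<le> 2 ^ n0 * t" using n0 tp by (simp add: field_simps)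
          also have "\<dots> \<le> 2 ^ n * t" using that tp by (intro mult_right_mono power_increasing) auto
          finally show ?thesis .
        qed
        then show "\<forall>\<^sub>F n in sequentially. h \<omega> * indicator {t<..2 ^ n * t} (h \<omega>) = h \<omega> * indicator {t<..} (h \<omega>)"
          unfolding eventually_sequentially by (intro exI[of _ n0]) (auto simp: indicator_def)
      qed
    qed (use int h_nonneg in \<open>auto simp: indicator_def\<close>)
  qed (use fin t in auto)
  with that[OF C(1) t0(1)] show ?thesis by blast
qed

end

section \<open>Measures induced on the compactified space\<close>

lemma space_borel_of_topology: "space (borel_of_topology X) = topspace X"
  unfolding borel_of_topology_def by (rule space_measure_of) (auto dest: openin_subset)

lemma continuous_map_measurable:
  assumes "continuous_map X Y f"
  shows "f \<in> measurable (borel_of_topology X) (borel_of_topology Y)"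
  unfolding borel_of_topology_def[of Y]
proof (rule measurable_measure_of)
  have sp: "space (borel_of_topology X) = topspace X"
    by (rule space_borel_of_topology)
  show "f \<in> space (borel_of_topology X) \<rightarrow> topspace Y"
    using assms by (auto simp: sp continuous_map_def)
  fix U assume "U \<in> {U. openin Y U}"
  then have "openin X {x \<in> topspace X. f x \<in> U}"
    using assms by (auto simp: continuous_map_def)
  moreover have "{x \<in> topspace X. f x \<in> U} = f -` U \<inter> space (borel_of_topology X)"
    by (auto simp: sp)
  moreover have "sets (borel_of_topology X) = sigma_sets (topspace X) {U. openin X U}"
    unfolding borel_of_topology_def by (rule sets_measure_of) (auto dest: openin_subset)
  ultimately show "f -` U \<inter> space (borel_of_topology X) \<in> sets (borel_of_topology X)"
    by auto
qed (auto dest: openin_subset)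

lemma borel_of_topology_euclidean: "borel_of_topology euclidean = borel"
  by (simp add: borel_of_topology_def borel_def)

lemma sets_restrict_restrict_borel:
  assumes "sets N = sets (restrict_space borel A)" "B \<subseteq> A" "A \<in> sets borel" "B \<in> sets (borel::'a::euclidean_space measure)"
  shows "sets (restrict_space N B) = sets (borel_of_topology (top_of_set B))"
proof -
  have "sets (restrict_space N B) = sets (restrict_space (restrict_space borel A) B)"
    by (simp only: sets_restrict_space assms(1))
  also have "\<dots> = sets (restrict_space borel B)"
  proof -
    have "(\<inter>) B ` (\<inter>) A ` sets borel = (\<inter>) B ` sets borel"
      using assms(2) by (auto simp: image_image Int_assoc[symmetric] Int_absorb2)
    then show ?thesis by (simp add: sets_restrict_space)
  qed
  finally show ?thesis using sets_borel_of_top_of_set[OF assms(4)] by simp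
qed

lemma Proper_measurable:
  assumes "r \<ge> 0" "sets N = sets (restrict_space borel A)" "- cball 0 r \<subseteq> A" "A \<in> sets (borel::'a::euclidean_space measure)"
  shows "Proper \<in> measurable (restrict_space N (- cball 0 r)) (borel_of_topology (cpt_minus_ball r))"
proof -
  have "sets (restrict_space N (- cball 0 r)) = sets (borel_of_topology (top_of_set (- cball 0 r)))"
    by (rule sets_restrict_restrict_borel[OF assms(2-4)]) (simp add: borel_open open_Compl)
  with continuous_map_measurable[OF continuous_Proper[OF assms(1)]] show ?thesis
    by (simp cong: measurable_cong_sets)
qed

lemma Compl_cball_in_sets:
  assumes "sets N = sets (restrict_space borel A)" "- cball 0 r \<subseteq> A" "A \<in> sets (borel::'a::euclidean_space measure)"
  shows "- cball 0 r \<inter> space N \<in> sets N"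
proof -
  have "space N = A" using sets_eq_imp_space_eq[OF assms(1)] by (simp add: space_restrict_space)
  moreover have "- cball 0 r \<in> sets (borel::'a measure)" by (simp add: borel_open open_Compl)
  ultimately show ?thesis using assms by (auto simp: sets_restrict_space Int_commute)
qed

lemma integral_cpt_extend:
  fixes f :: "'a::euclidean_space cpt \<Rightarrow> real"
  assumes r: "r \<ge> 0" and N: "sets N = sets (restrict_space borel A)" "- cball 0 r \<subseteq> A" "A \<in> sets borel"
    and f: "continuous_map (cpt_minus_ball r) euclideanreal f"
  shows "integral\<^sup>L (cpt_extend r N) f = (\<integral>x. indicator (- cball 0 r) x * f (Proper x) \<partial>N)"
proof -
  have "integral\<^sup>L (cpt_extend r N) f = integral\<^sup>L (restrict_space N (- cball 0 r)) (\<lambda>x. f (Proper x))"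
    unfolding cpt_extend_def
    by (rule integral_distr[OF Proper_measurable[OF r N]])
      (use continuous_map_measurable[OF f] in \<open>simp add: borel_of_topology_euclidean\<close>)
  also have "\<dots> = (\<integral>x. indicator (- cball 0 r) x *\<^sub>R f (Proper x) \<partial>N)"
    by (rule integral_restrict_space[OF Compl_cball_in_sets[OF N]])
  finally show ?thesis by simp
qed

lemma annulus_in_sets:
  "{y \<in> topspace (cpt_minus_ball r). s \<le> norm (cpt_to_ball y :: 'a::euclidean_space)}
     \<in> sets (borel_of_topology (cpt_minus_ball r))"
proof -
  let ?X = "cpt_minus_ball r :: 'a cpt topology"
  have c: "(\<lambda>y. norm (cpt_to_ball y)) \<in> borel_measurable (borel_of_topology ?X)"
    using continuous_map_measurable[OF continuous_map_norm[OF continuous_cpt_to_ball[of r]]]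
    by (simp add: borel_of_topology_euclidean)
  have sp: "space (borel_of_topology ?X) = topspace ?X"
    by (rule space_borel_of_topology)
  show ?thesis using borel_measurable_le[OF borel_measurable_const[of s] c] by (simp add: sp)
qed

lemma emeasure_cpt_extend_annulus:
  assumes r: "r \<ge> 0" and N: "sets N = sets (restrict_space borel A)" "- cball 0 r \<subseteq> A" "A \<in> sets borel"
    and s: "r / (1 + r) < s" "s < 1"
  shows "emeasure (cpt_extend r N) {y \<in> topspace (cpt_minus_ball r). s \<le> norm (cpt_to_ball y :: 'a::euclidean_space)}
     = emeasure N {x. s / (1 - s) \<le> norm x}"
proof -
  let ?K = "{y \<in> topspace (cpt_minus_ball r). s \<le> norm (cpt_to_ball y :: 'a)}"
  let ?B = "- cball (0::'a) r"
  have sN: "space N = A" using sets_eq_imp_space_eq[OF N(1)] by (simp add: space_restrict_space)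
  have spr: "space (restrict_space N ?B) = ?B" using N(2) by (auto simp: space_restrict_space sN)
  have "emeasure (cpt_extend r N) ?K = emeasure (restrict_space N ?B) (Proper -` ?K \<inter> ?B)"
    unfolding cpt_extend_def
    by (subst emeasure_distr[OF Proper_measurable[OF r N] annulus_in_sets]) (simp add: spr)
  also have "Proper -` ?K \<inter> ?B = {x. s / (1 - s) \<le> norm x}"
  proof -
    have pos: "1 + norm x > 0" for x :: 'a by (smt (verit) norm_ge_zero)
    have "s \<le> norm (cpt_to_ball (Proper x)) \<longleftrightarrow> s / (1 - s) \<le> norm x" for x :: 'a
      unfolding norm_cpt_to_ball_Proper using pos[of x] s(2)
      by (simp add: pos_le_divide_eq pos_divide_le_eq) (simp add: algebra_simps)
    moreover have "r < s / (1 - s)" using s r by (simp add: field_simps)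
    ultimately show ?thesis by (auto simp: topspace_cpt_minus_ball cpt_points_def simp del: cpt_to_ball.simps)
  qed
  also have "emeasure (restrict_space N ?B) {x. s / (1 - s) \<le> norm x} = emeasure N {x. s / (1 - s) \<le> norm x}"
  proof (rule emeasure_restrict_space[OF Compl_cball_in_sets[OF N]])
    have "r < s / (1 - s)" using s r by (simp add: field_simps)
    then show "{x. s / (1 - s) \<le> norm x} \<subseteq> ?B" by auto
  qed
  finally show ?thesis .
qed

text \<open>
  Compact sets lie in an annulus that is bounded away from the removed ball, so it is enough to
  know that complements of larger balls have finite measure. The next lemma is the converse.
\<close>

lemma radon_cpt_extend:
  fixes N :: "'a::euclidean_space measure"
  assumes r: "r \<ge> 0" and N: "sets N = sets (restrict_space borel A)" "- cball 0 r \<subseteq> A" "A \<in> sets borel"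
    and fin: "\<And>t. t > r \<Longrightarrow> emeasure N {x. t \<le> norm x} < \<infinity>"
  shows "radon_on (cpt_minus_ball r) (cpt_extend r N)"
  unfolding radon_on_def
proof (intro conjI allI impI)
  show "sets (cpt_extend r N) = sets (borel_of_topology (cpt_minus_ball r))" by (simp add: cpt_extend_def)
  fix K :: "'a cpt set" assume K: "compactin (cpt_minus_ball r) K"
  obtain s where s: "r / (1 + r) < s" "s < 1" "\<And>y. y \<in> K \<Longrightarrow> s \<le> norm (cpt_to_ball y)"
    using compactin_cpt_bounded_away[OF r K] by blast
  have "emeasure (cpt_extend r N) K \<le> emeasure (cpt_extend r N) {y \<in> topspace (cpt_minus_ball r). s \<le> norm (cpt_to_ball y)}"
    using s(3) compactin_subset_topspace[OF K] annulus_in_sets[of r s]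
    by (intro emeasure_mono) (auto simp: cpt_extend_def)
  also have "\<dots> = emeasure N {x. s / (1 - s) \<le> norm x}"
    by (rule emeasure_cpt_extend_annulus[OF r N s(1,2)])
  also have "\<dots> < \<infinity>" by (rule fin) (use s r in \<open>simp add: field_simps\<close>)
  finally show "emeasure (cpt_extend r N) K < \<infinity>" .
qed

lemma radon_cpt_extend_finite:
  fixes N :: "'a::euclidean_space measure"
  assumes r: "r \<ge> 0" and N: "sets N = sets (restrict_space borel A)" "- cball 0 r \<subseteq> A" "A \<in> sets borel"
    and rad: "radon_on (cpt_minus_ball r) (cpt_extend r N)" and t: "t > r"
  shows "emeasure N {x. t \<le> norm x} < \<infinity>"
proof -
  define s where "s = t / (1 + t)"
  have s: "r / (1 + r) < s" "s < 1" "s / (1 - s) = t" using t r by (auto simp: s_def field_simps)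
  have "compactin (cpt_minus_ball r) {y \<in> topspace (cpt_minus_ball r). s \<le> norm (cpt_to_ball y :: 'a)}"
    by (rule compactin_cpt_annulus[OF r s(1)])
  then have "emeasure (cpt_extend r N) {y \<in> topspace (cpt_minus_ball r). s \<le> norm (cpt_to_ball y)} < \<infinity>"
    using rad by (simp add: radon_on_def)
  then show ?thesis unfolding emeasure_cpt_extend_annulus[OF r N s(1,2)] s(3) .
qed

lemma integral_scale_measure:
  fixes f :: "'b \<Rightarrow> real"
  assumes "c \<ge> 0" and f: "f \<in> borel_measurable N"
  shows "integral\<^sup>L (scale_measure (ennreal c) N) f = c * integral\<^sup>L N f"
proof -
  have "scale_measure (ennreal c) N = density N (\<lambda>_. ennreal c)"
    by (rule measure_eqI) (auto simp: emeasure_density nn_integral_cmult_indicator)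
  then show ?thesis using integral_density[of f N "\<lambda>_. c"] assms by simp
qed

lemma sets_restrict_UNIV: "sets borel = sets (restrict_space borel UNIV)"
  by (auto simp: sets_restrict_space)

text \<open>
  The form in which regular variation of \<open>X\<close> is used: tested on functions that factor through \<open>clip\<close>.
\<close>

lemma clip_convergence:
  fixes X :: "'w \<Rightarrow> 'a::euclidean_space" and g :: "'a \<Rightarrow> real"
  assumes X [measurable]: "X \<in> borel_measurable \<Omega>"
    and mu: "sets \<mu> = sets (restrict_space borel (- {0}))"
    and conv: "vague_conv (cpt_minus_ball 0)
         (\<lambda>n. cpt_extend 0 (scale_measure (of_nat n) (distr \<Omega> borel (\<lambda>\<omega>. (1 / a n) *\<^sub>R X \<omega>))))
         (cpt_extend 0 \<mu>)"
    and g: "continuous_on UNIV g" and e: "e > 0" "\<And>x. norm x \<le> e \<Longrightarrow> g x = 0" and R: "R > 0"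
  shows "(\<lambda>n. real n * (\<integral>\<omega>. g (clip R ((1 / a n) *\<^sub>R X \<omega>)) \<partial>\<Omega>)) \<longlonglongrightarrow> (\<integral>x. g (clip R x) \<partial>\<mu>)"
proof -
  obtain f where f: "continuous_map (cpt_minus_ball 0) euclideanreal f"
    "\<exists>K. compactin (cpt_minus_ball 0) K \<and> (\<forall>x \<in> topspace (cpt_minus_ball 0) - K. f x = 0)"
    "\<And>x. f (Proper x) = g (clip R x)"
    using clip_test_function[OF R g e] by blast
  have z: "indicator (- cball 0 0) x * f (Proper x) = g (clip R x)" for x :: 'a
    using e(2)[of 0] e(1) R clip_eq[of R "0::'a"] by (auto simp: f(3) indicator_def)
  have [measurable]: "g \<in> borel_measurable borel" by (rule borel_measurable_continuous_onI[OF g])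
  have [measurable]: "clip R \<in> measurable borel (borel::'a measure)" by (rule clip_measurable[OF R])
  have 1: "integral\<^sup>L (cpt_extend 0 \<mu>) f = (\<integral>x. g (clip R x) \<partial>\<mu>)"
    by (subst integral_cpt_extend[OF _ mu _ _ f(1)]) (auto simp: z[symmetric])
  have 2: "integral\<^sup>L (cpt_extend 0 (scale_measure (of_nat n) (distr \<Omega> borel (\<lambda>\<omega>. (1 / a n) *\<^sub>R X \<omega>)))) f
     = real n * (\<integral>\<omega>. g (clip R ((1 / a n) *\<^sub>R X \<omega>)) \<partial>\<Omega>)" for n
  proof -
    have "integral\<^sup>L (cpt_extend 0 (scale_measure (of_nat n) (distr \<Omega> borel (\<lambda>\<omega>. (1 / a n) *\<^sub>R X \<omega>)))) f
      = (\<integral>x. g (clip R x) \<partial>(scale_measure (of_nat n) (distr \<Omega> borel (\<lambda>\<omega>. (1 / a n) *\<^sub>R X \<omega>))))"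
      by (subst integral_cpt_extend[OF _ _ _ _ f(1), where A=UNIV]) (use z in \<open>auto simp: sets_restrict_UNIV[symmetric]\<close>)
    also have "\<dots> = real n * (\<integral>x. g (clip R x) \<partial>(distr \<Omega> borel (\<lambda>\<omega>. (1 / a n) *\<^sub>R X \<omega>)))"
    proof -
      have "(of_nat n :: ennreal) = ennreal (real n)" by (simp add: ennreal_of_nat_eq_real_of_nat)
      then show ?thesis by (simp add: integral_scale_measure)
    qed
    also have "\<dots> = real n * (\<integral>\<omega>. g (clip R ((1 / a n) *\<^sub>R X \<omega>)) \<partial>\<Omega>)"
      by (subst integral_distr) auto
    finally show ?thesis .
  qed
  have "(\<lambda>n. integral\<^sup>L (cpt_extend 0 (scale_measure (of_nat n) (distr \<Omega> borel (\<lambda>\<omega>. (1 / a n) *\<^sub>R X \<omega>)))) f)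
     \<longlonglongrightarrow> integral\<^sup>L (cpt_extend 0 \<mu>) f"
    using conv f(1,2) unfolding vague_conv_def by blast
  then show ?thesis unfolding 1 2 .
qed

text \<open>
  The set function in the definition of \<open>\<sigma>\<close> is that of an image measure, hence countably additive,
  which is what gives \<open>measure_of\<close> the intended values.
\<close>

lemma sigma_meas_eq:
  fixes \<mu> :: "'a::euclidean_space measure"
  assumes mu [measurable_cong]: "sets \<mu> = sets (restrict_space borel (- {0}))"
  shows "sigma_meas \<mu> = scale_measure (inverse (emeasure \<mu> (- cball 0 1)))
     (distr (restrict_space \<mu> {x. 1 \<le> norm x}) (restrict_space borel (sphere 0 1)) (\<lambda>x. (1 / norm x) *\<^sub>R x))"
    (is "_ = ?N")
proof -
  let ?E = "{x::'a. 1 \<le> norm x}" and ?u = "\<lambda>x::'a. (1 / norm x) *\<^sub>R x"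
  have smu: "space \<mu> = - {0}" using sets_eq_imp_space_eq[OF mu] by (simp add: space_restrict_space)
  have E: "?E \<inter> space \<mu> \<in> sets \<mu>"
    unfolding mu smu by (auto simp: sets_restrict_space intro!: image_eqI[of _ _ ?E])
  have m0: "?u \<in> measurable \<mu> borel"
  proof -
    have "?u \<in> measurable (restrict_space borel (- {0})) borel"
      by (rule measurable_restrict_space1) measurable
    then show ?thesis by (simp cong: measurable_cong_sets add: mu)
  qed
  have m: "?u \<in> measurable (restrict_space \<mu> ?E) (restrict_space borel (sphere 0 1))"
    by (rule measurable_restrict_space2)
      (use m0 in \<open>auto simp: space_restrict_space smu intro!: measurable_restrict_space1\<close>)
  have spN: "space ?N = sphere 0 1" by (simp add: space_scale_measure space_restrict_space)
  have setsN: "sets ?N = sets (restrict_space borel (sphere 0 1))" by simp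
  have "sigma_meas \<mu> = measure_of (space ?N) (sets ?N) (emeasure ?N)"
    unfolding sigma_meas_def spN setsN
  proof (rule measure_of_eq)
    show "sets (restrict_space borel (sphere 0 1)) \<subseteq> Pow (sphere (0::'a) 1)"
      by (auto simp: sets_restrict_space)
    fix A assume "A \<in> sigma_sets (sphere 0 1) (sets (restrict_space borel (sphere (0::'a) 1)))"
    then have A: "A \<in> sets (restrict_space borel (sphere 0 1))"
      using sets.sigma_sets_eq[of "restrict_space borel (sphere (0::'a) 1)"] by (simp add: space_restrict_space)
    have "emeasure (distr (restrict_space \<mu> ?E) (restrict_space borel (sphere 0 1)) ?u) A
       = emeasure (restrict_space \<mu> ?E) (?u -` A \<inter> (?E \<inter> - {0}))"
      by (subst emeasure_distr[OF m A]) (simp add: space_restrict_space smu)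
    also have "\<dots> = emeasure \<mu> (?u -` A \<inter> (?E \<inter> - {0}))"
      by (rule emeasure_restrict_space[OF E]) auto
    also have "?u -` A \<inter> (?E \<inter> - {0}) = {x. norm x \<ge> 1 \<and> ?u x \<in> A}" by auto
    finally show "emeasure \<mu> {x. norm x \<ge> 1 \<and> ?u x \<in> A} / emeasure \<mu> (- cball 0 1) = emeasure ?N A"
      using A by (simp add: divide_ennreal_def mult.commute)
  qed
  then show ?thesis by (simp only: measure_of_of_measure)
qed

lemma clip_measurable_punctured:
  assumes "sets \<mu> = sets (restrict_space borel (- {0::'a::euclidean_space}))" "R > 0"
  shows "clip R \<in> measurable \<mu> (restrict_space borel (- {0::'a}))"
proof (rule measurable_restrict_space2)
  have sp: "space \<mu> = - {0}" using sets_eq_imp_space_eq[OF assms(1)] by (simp add: space_restrict_space)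
  have "max R (norm x) > 0" for x :: 'a using assms(2) by (simp add: less_max_iff_disj)
  then show "clip R \<in> space \<mu> \<rightarrow> - {0::'a}"
    using assms(2) by (auto simp: sp clip_def less_imp_neq[symmetric])
  have "clip R \<in> measurable (restrict_space borel (- {0})) (borel::'a measure)"
    by (rule measurable_restrict_space1) (rule clip_measurable[OF assms(2)])
  then show "clip R \<in> borel_measurable \<mu>" by (simp cong: measurable_cong_sets add: assms(1))
qed

text \<open>
  Points of the closed unit ball stay where they are, and points outside are moved radially to the
  sphere, where they form \<open>\<sigma>\<close>. The sphere itself occurs in both parts of the definition, so it must be
  a null set.
\<close>

lemma nu_meas_eq:
  fixes \<mu> :: "'a::euclidean_space measure"
  assumes mu: "sets \<mu> = sets (restrict_space borel (- {0}))" and null: "emeasure \<mu> (sphere 0 1) = 0"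
  shows "nu_meas \<mu> = scale_measure (inverse (emeasure \<mu> (- cball 0 1)))
     (distr \<mu> (restrict_space borel (- {0})) (clip 1))" (is "_ = ?N")
proof -
  let ?P = "- {0::'a}" and ?m = "emeasure \<mu> (- cball 0 1)"
  let ?E = "{x::'a. 1 \<le> norm x}" and ?u = "\<lambda>x::'a. (1 / norm x) *\<^sub>R x"
  have smu: "space \<mu> = - {0}" using sets_eq_imp_space_eq[OF mu] by (simp add: space_restrict_space)
  have sb: "B \<in> sets \<mu>" if "B \<in> sets borel" "0 \<notin> B" for B
    unfolding mu using that by (auto simp: sets_restrict_space intro!: image_eqI[of _ _ B])
  have spN: "space ?N = - {0}" by (simp add: space_scale_measure space_restrict_space)
  have setsN: "sets ?N = sets (restrict_space borel (- {0}))" by simp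
  have "nu_meas \<mu> = measure_of (space ?N) (sets ?N) (emeasure ?N)"
    unfolding nu_meas_def spN setsN
  proof (rule measure_of_eq)
    show "sets (restrict_space borel ?P) \<subseteq> Pow ?P"
      by (auto simp: sets_restrict_space)
    fix A assume "A \<in> sigma_sets ?P (sets (restrict_space borel ?P))"
    then have A: "A \<in> sets (restrict_space borel ?P)"
      using sets.sigma_sets_eq[of "restrict_space borel ?P"] by (simp add: space_restrict_space)
    then have A': "A \<in> sets borel" "0 \<notin> A"
      by (auto simp: sets_restrict_space borel_open)
    have AS: "A \<inter> sphere 0 1 \<in> sets (restrict_space borel (sphere 0 1))"
      using A' by (auto simp: sets_restrict_space)
    let ?S = "{x. norm x \<ge> 1 \<and> ?u x \<in> A \<inter> sphere 0 1}"
    have S_eq: "?S = {x. norm x \<ge> 1 \<and> ?u x \<in> A}" by auto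
    have "{x. norm x \<ge> 1 \<and> ?u x \<in> A} \<in> sets borel"
      using A'(1) by measurable
    then have S: "?S \<in> sets \<mu>" unfolding S_eq by (intro sb) auto
    have sig: "emeasure (sigma_meas \<mu>) (A \<inter> sphere 0 1) = emeasure \<mu> ?S / ?m"
    proof -
      have mE: "?E \<inter> space \<mu> \<in> sets \<mu>" unfolding smu by (rule sb) auto
      have m0: "?u \<in> measurable \<mu> borel"
      proof -
        have "?u \<in> measurable (restrict_space borel (- {0})) borel"
          by (rule measurable_restrict_space1) measurable
        then show ?thesis by (simp cong: measurable_cong_sets add: mu)
      qed
      have m: "?u \<in> measurable (restrict_space \<mu> ?E) (restrict_space borel (sphere 0 1))"
        by (rule measurable_restrict_space2)
          (use m0 in \<open>auto simp: space_restrict_space smu intro!: measurable_restrict_space1\<close>)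
      have "emeasure (sigma_meas \<mu>) (A \<inter> sphere 0 1) = inverse ?m * emeasure (restrict_space \<mu> ?E) (?u -` (A \<inter> sphere 0 1) \<inter> (?E \<inter> - {0}))"
        unfolding sigma_meas_eq[OF mu] emeasure_scale_measure
        by (subst emeasure_distr[OF m AS]) (simp add: space_restrict_space smu)
      also have "emeasure (restrict_space \<mu> ?E) (?u -` (A \<inter> sphere 0 1) \<inter> (?E \<inter> - {0})) = emeasure \<mu> (?u -` (A \<inter> sphere 0 1) \<inter> (?E \<inter> - {0}))"
        by (rule emeasure_restrict_space[OF mE]) auto
      also have "?u -` (A \<inter> sphere 0 1) \<inter> (?E \<inter> - {0}) = ?S" by auto
      finally show ?thesis by (simp add: divide_ennreal_def mult.commute)
    qed
    let ?S1 = "{x. norm x > 1 \<and> ?u x \<in> A}"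
    have "{x. norm x > 1 \<and> ?u x \<in> A} \<in> sets borel" using A'(1) by measurable
    then have S1: "?S1 \<in> sets \<mu>" by (intro sb) auto
    have S0: "sphere 0 1 \<in> sets \<mu>" by (intro sb) auto
    have eS: "emeasure \<mu> ?S = emeasure \<mu> ?S1"
    proof (rule emeasure_eq_AE[OF _ S S1])
      have "AE x in \<mu>. x \<notin> sphere 0 1" using S0 null by (intro AE_not_in) (auto simp: null_sets_def)
      then show "AE x in \<mu>. (x \<in> ?S) = (x \<in> ?S1)" by eventually_elim auto
    qed
    have "emeasure ?N A = inverse ?m * emeasure \<mu> (clip 1 -` A \<inter> - {0})"
      unfolding emeasure_scale_measure
      by (subst emeasure_distr[OF clip_measurable_punctured[OF mu] A]) (simp_all add: smu)
    also have "clip 1 -` A \<inter> - {0} = (A \<inter> cball 0 1) \<union> ?S1"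
    proof (intro set_eqI)
      fix x :: 'a
      have "clip 1 x = (if norm x \<le> 1 then x else ?u x)" by (simp add: clip_def max_def)
      then show "x \<in> clip 1 -` A \<inter> - {0} \<longleftrightarrow> x \<in> (A \<inter> cball 0 1) \<union> ?S1"
        using A' by auto
    qed
    also have "emeasure \<mu> \<dots> = emeasure \<mu> (A \<inter> cball 0 1) + emeasure \<mu> ?S1"
      by (subst plus_emeasure[symmetric]) (use S1 A' in \<open>auto intro!: sb\<close>)
    finally show "emeasure \<mu> (A \<inter> cball 0 1) / ?m + emeasure (sigma_meas \<mu>) (A \<inter> sphere 0 1) = emeasure ?N A"
      unfolding sig eS by (simp add: divide_ennreal_def ring_distribs mult.commute)
  qed
  then show ?thesis by (simp only: measure_of_of_measure)
qed

section \<open>Regular variation with a continuous parameter\<close>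

lemma norm_clip_scaleR_diff:
  fixes y :: "'a::euclidean_space"
  assumes "c \<ge> 1"
  shows "norm (clip 1 (c *\<^sub>R y) - clip 1 y) \<le> c - 1"
proof (cases "norm y \<ge> 1")
  case True
  then have "1 \<le> c * norm y" using assms by (metis mult_mono' mult_1 zero_le_one)
  then have "clip 1 (c *\<^sub>R y) = clip 1 y" using True assms by (auto simp: clip_def max_def)
  then show ?thesis using assms by simp
next
  case y: False
  then have cy: "clip 1 y = y" by (simp add: clip_eq)
  show ?thesis
  proof (cases "c * norm y \<le> 1")
    case True
    then have "clip 1 (c *\<^sub>R y) = c *\<^sub>R y" using assms by (intro clip_eq) auto
    then have "clip 1 (c *\<^sub>R y) - clip 1 y = (c - 1) *\<^sub>R y" by (simp add: cy algebra_simps)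
    then have "norm (clip 1 (c *\<^sub>R y) - clip 1 y) = (c - 1) * norm y" using assms by simp
    also have "\<dots> \<le> (c - 1) * 1" using y assms by (intro mult_left_mono) auto
    finally show ?thesis by simp
  next
    case False
    then have y0: "norm y > 0" using assms by (auto simp: zero_less_mult_iff)
    have "clip 1 (c *\<^sub>R y) = (1 / norm y) *\<^sub>R y" using False assms y0 by (simp add: clip_def max_def)
    then have "clip 1 (c *\<^sub>R y) - clip 1 y = (1 / norm y - 1) *\<^sub>R y" by (simp add: cy algebra_simps)
    then have "norm (clip 1 (c *\<^sub>R y) - clip 1 y) = (1 / norm y - 1) * norm y" using y y0 by simp
    also have "\<dots> = 1 - norm y" using y0 by (simp add: algebra_simps)
    also have "\<dots> \<le> c * norm y - norm y" using False by simp
    also have "\<dots> = (c - 1) * norm y" by (simp add: algebra_simps)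
    also have "\<dots> \<le> (c - 1) * 1" using y assms by (intro mult_left_mono) auto
    finally show ?thesis by simp
  qed
qed

lemma bounded_on_cball:
  fixes g :: "'a::euclidean_space \<Rightarrow> real"
  assumes "continuous_on UNIV g"
  shows "\<exists>B. \<forall>x. norm x \<le> R \<longrightarrow> norm (g x) \<le> B"
proof -
  have "compact (g ` cball 0 R)"
    by (intro compact_continuous_image continuous_on_subset[OF assms]) auto
  from compact_imp_bounded[OF this] obtain B where "\<forall>x\<in>cball 0 R. norm (g x) \<le> B"
    unfolding bounded_iff by blast
  then show ?thesis by (intro exI[of _ B]) simp
qed

text \<open>
  A regularly varying vector, given as in the hypotheses by the scaling constants \<open>a\<close>. What is
  wanted is convergence along an arbitrary scale \<open>x \<rightarrow> \<infinity>\<close>, since it is applied to \<open>M n\<close>.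
\<close>

locale regvar_vector = prob_space \<Omega> for \<Omega> :: "'w measure" +
  fixes X :: "'w \<Rightarrow> 'a::euclidean_space" and \<mu> :: "'a measure" and a :: "nat \<Rightarrow> real" and \<alpha> :: real
  assumes X_meas [measurable]: "X \<in> borel_measurable \<Omega>"
    and mu_sets: "sets \<mu> = sets (restrict_space borel (- {0}))"
    and mu_nonnull: "emeasure \<mu> (space \<mu>) \<noteq> 0"
    and mu_finite: "\<And>t. t > 0 \<Longrightarrow> emeasure \<mu> {x. t \<le> norm x} < \<infinity>"
    and mu_scaling: "\<And>c A. c > 0 \<Longrightarrow> A \<in> sets \<mu> \<Longrightarrow>
         emeasure \<mu> ((\<lambda>x. c *\<^sub>R x) ` A) = ennreal (c powr (- \<alpha>)) * emeasure \<mu> A"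
    and alpha_pos: "\<alpha> > 0"
    and a_lim: "filterlim a at_top sequentially"
    and conv: "vague_conv (cpt_minus_ball 0)
         (\<lambda>n. cpt_extend 0 (scale_measure (of_nat n) (distr \<Omega> borel (\<lambda>\<omega>. (1 / a n) *\<^sub>R X \<omega>))))
         (cpt_extend 0 \<mu>)"
begin

sublocale nonneg_rv \<Omega> "\<lambda>\<omega>. norm (X \<omega>)"
  by unfold_locales auto

text \<open>
  The mass \<open>\<mu>(B\<^sub>1\<^sup>c)\<close> by which \<open>\<sigma>\<close> and \<open>\<nu>\<close> are normalised.
\<close>

definition m :: real where "m = measure \<mu> {x. norm x > 1}"

lemma space_mu: "space \<mu> = - {0}"
  using sets_eq_imp_space_eq[OF mu_sets] by (simp add: space_restrict_space)

lemma in_sets_mu: "B \<in> sets borel \<Longrightarrow> 0 \<notin> B \<Longrightarrow> B \<in> sets \<mu>"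
  unfolding mu_sets by (auto simp: sets_restrict_space intro!: image_eqI[of _ _ B])

lemma outer_in_sets: "t \<ge> 0 \<Longrightarrow> {x. norm x > t} \<in> sets \<mu>" "t > 0 \<Longrightarrow> {x. norm x \<ge> t} \<in> sets \<mu>"
  by (rule in_sets_mu; auto)+

lemma finite_outer: "t > 0 \<Longrightarrow> emeasure \<mu> {x. norm x > t} < \<infinity>"
proof -
  assume t: "t > 0"
  have "emeasure \<mu> {x. norm x > t} \<le> emeasure \<mu> {x. norm x \<ge> t}"
    using t by (intro emeasure_mono outer_in_sets) auto
  with mu_finite[OF t] show ?thesis by (rule le_less_trans[rotated])
qed

lemma emeasure_outer: "c > 0 \<Longrightarrow> emeasure \<mu> {x. norm x > c} = ennreal (c powr (-\<alpha>)) * emeasure \<mu> {x. norm x > 1}"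
proof -
  assume c: "c > 0"
  have "(\<lambda>x. c *\<^sub>R x) ` {x::'a. norm x > 1} = {x. norm x > c}"
  proof safe
    fix x :: 'a assume "norm x > 1" then show "norm (c *\<^sub>R x) > c" using c by simp
  next
    fix x :: 'a assume "norm x > c"
    then show "x \<in> (\<lambda>x. c *\<^sub>R x) ` {x::'a. norm x > 1}"
      using c by (intro image_eqI[of _ _ "(1/c) *\<^sub>R x"]) (auto simp: field_simps)
  qed
  with mu_scaling[OF c outer_in_sets(1)[of 1]] show ?thesis by simp
qed

lemma emeasure_outer_1: "emeasure \<mu> {x. norm x > 1} = ennreal m"
  unfolding m_def using finite_outer[of 1] by (intro emeasure_eq_ennreal_measure) auto

lemma measure_outer: "c > 0 \<Longrightarrow> measure \<mu> {x. norm x > c} = c powr (-\<alpha>) * m"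
  using emeasure_outer[of c] unfolding emeasure_outer_1
  by (simp add: measure_def ennreal_mult''[symmetric] m_def)

text \<open>
  If the complement of the unit ball were a null set then, by scaling, so would be the complement of
  every ball, and hence the whole space.
\<close>

lemma m_pos: "m > 0"
proof (rule ccontr)
  assume "\<not> m > 0"
  then have "m = 0" unfolding m_def by (smt (verit) measure_nonneg)
  then have z: "emeasure \<mu> {x. norm x > c} = 0" if "c > 0" for c
    using emeasure_outer[OF that] by (simp add: emeasure_outer_1)
  have "emeasure \<mu> (\<Union>n::nat. {x. norm x > 1 / Suc n}) = 0"
    by (intro emeasure_UN_eq_0 z) (auto intro: outer_in_sets)
  moreover have "(\<Union>n::nat. {x::'a. norm x > 1 / Suc n}) = space \<mu>"
  proof safe
    fix x :: 'a assume "x \<in> space \<mu>"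
    then have "norm x > 0" by (simp add: space_mu)
    then obtain n where "1 / Suc n < norm x" using nat_approx_posE by blast
    then show "x \<in> (\<Union>n::nat. {x::'a. norm x > 1 / Suc n})" by auto
  next
    fix x :: 'a and n assume "1 / real (Suc n) < norm x"
    moreover have "1 / real (Suc n) > 0" by simp
    ultimately have "norm x > 0" by linarith
    then show "x \<in> space \<mu>" by (auto simp: space_mu)
  qed
  ultimately show False using mu_nonnull by simp
qed

text \<open>
  The set \<open>{x. norm x > c}\<close> has measure \<open>c powr (- \<alpha>) * m\<close>, and letting \<open>c\<close> increase to \<open>1\<close> leaves no
  mass for the sphere.
\<close>

lemma sphere_null: "emeasure \<mu> (sphere 0 1) = 0"
proof -
  have fin: "emeasure \<mu> {x. norm x > 1} \<noteq> \<infinity>" by (simp add: emeasure_outer_1)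
  have "emeasure \<mu> (sphere 0 1) \<le> emeasure \<mu> {x. 1 \<le> norm x}"
    by (intro emeasure_mono outer_in_sets) auto
  with mu_finite[of 1] have fin_sphere: "emeasure \<mu> (sphere 0 1) \<noteq> \<infinity>" by auto
  have "measure \<mu> {x. norm x \<ge> 1} \<le> m"
  proof (rule tendsto_lowerbound)
    show "((\<lambda>c. c powr (-\<alpha>) * m) \<longlongrightarrow> m) (at_left 1)"
      by (rule tendsto_eq_intros refl | simp)+
    show "\<forall>\<^sub>F c in at_left 1. measure \<mu> {x. norm x \<ge> 1} \<le> c powr (-\<alpha>) * m"
      using eventually_at_left_real[OF zero_less_one]
    proof eventually_elim
      case (elim c)
      have "measure \<mu> {x. norm x \<ge> 1} \<le> measure \<mu> {x. norm x > c}"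
        using elim finite_outer[of c] by (intro measure_mono_fmeasurable) (auto simp: fmeasurable_def intro: outer_in_sets)
      then show ?case using measure_outer elim by simp
    qed
  qed simp
  moreover have "measure \<mu> {x. norm x \<ge> 1} = measure \<mu> {x. norm x > 1} + measure \<mu> (sphere 0 1)"
  proof -
    have "{x::'a. norm x \<ge> 1} = {x. norm x > 1} \<union> sphere 0 1" by auto
    moreover have "measure \<mu> ({x. norm x > 1} \<union> sphere 0 1) = measure \<mu> {x. norm x > 1} + measure \<mu> (sphere 0 1)"
    proof (rule measure_Union)
      show "emeasure \<mu> (sphere 0 1) \<noteq> \<infinity>"
        by (rule fin_sphere)
      show "sphere 0 1 \<in> sets \<mu>" by (rule in_sets_mu) auto
    qed (use fin in \<open>auto intro: outer_in_sets\<close>)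
    ultimately show ?thesis by simp
  qed
  ultimately have "measure \<mu> (sphere 0 1) = 0" by (smt (verit) m_def measure_nonneg)
  then show ?thesis using fin_sphere by (simp add: emeasure_eq_ennreal_measure)
qed

lemma integrable_clip:
  fixes g :: "'a \<Rightarrow> real"
  assumes g: "continuous_on UNIV g" and e: "e > 0" "\<And>x. norm x \<le> e \<Longrightarrow> g x = 0" and R: "R > 0"
  shows "integrable \<mu> (\<lambda>x. g (clip R x))"
proof -
  obtain B where B: "\<And>x. norm x \<le> R \<Longrightarrow> norm (g x) \<le> B"
    using bounded_on_cball[OF g] by blast
  have gm: "g \<in> borel_measurable borel" by (rule borel_measurable_continuous_onI[OF g])
  have cl: "clip R \<in> measurable \<mu> borel"
    using clip_measurable_punctured[OF mu_sets R] by (rule measurable_restrict_space2_iff[THEN iffD1, THEN conjunct1])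
  have i: "integrable \<mu> (\<lambda>x. B * indicator {x. norm x \<ge> e} x)"
    using mu_finite[OF e(1)] outer_in_sets(2)[OF e(1)] by (intro integrable_mult_right) auto
  show ?thesis
  proof (rule Bochner_Integration.integrable_bound[OF i])
    show "(\<lambda>x. g (clip R x)) \<in> borel_measurable \<mu>" by (rule measurable_compose[OF cl gm])
    show "AE x in \<mu>. norm (g (clip R x)) \<le> norm (B * indicator {x. norm x \<ge> e} x)"
    proof (rule AE_I2)
      fix x
      have "norm (g (clip R x)) \<le> B" by (rule B) (simp add: norm_clip R)
      moreover have "B \<ge> 0" 
      proof -
        have "0 \<le> norm (g 0)" by (rule norm_ge_zero)
        also have "\<dots> \<le> B" using R by (intro B) simp
        finally show ?thesis .
      qed
      moreover have "g (clip R x) = 0" if "norm x < e" using that by (intro e) (auto simp: norm_clip R)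
      ultimately show "norm (g (clip R x)) \<le> norm (B * indicator {x. norm x \<ge> e} x)"
        by (auto simp: indicator_def)
    qed
  qed
qed

lemma clip_conv:
  fixes g :: "'a \<Rightarrow> real"
  assumes "continuous_on UNIV g" "e > 0" "\<And>x. norm x \<le> e \<Longrightarrow> g x = 0" "R > 0"
  shows "(\<lambda>n. real n * (\<integral>\<omega>. g (clip R ((1 / a n) *\<^sub>R X \<omega>)) \<partial>\<Omega>)) \<longlonglongrightarrow> (\<integral>x. g (clip R x) \<partial>\<mu>)"
  by (rule clip_convergence[OF X_meas mu_sets conv assms])

lemma Q_eq: "Q t = (\<integral>\<omega>. indicator {x. norm x > t} (X \<omega>) \<partial>\<Omega>)"
  unfolding Q_eq_expectation by (intro Bochner_Integration.integral_cong) (auto simp: indicator_def)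

definition ramp :: "real \<Rightarrow> real \<Rightarrow> 'a \<Rightarrow> real" where
  "ramp b c x = min 1 (max 0 ((norm x - b) / (c - b)))"

text \<open>
  The ramp that rises from \<open>0\<close> to \<open>1\<close> between the radii \<open>b\<close> and \<open>c\<close> lies between the indicators of
  the complements of the two balls, and it is continuous and factors through \<open>clip c\<close>.
\<close>

lemma ramp_sandwich:
  assumes bc: "0 < b" "b < c"
  obtains J u where "m * c powr (-\<alpha>) \<le> J" "J \<le> m * b powr (-\<alpha>)" "u \<longlonglongrightarrow> J"
    "\<forall>\<^sub>F n in sequentially. real n * Q (c * a n) \<le> u n \<and> u n \<le> real n * Q (b * a n)"
proof (rule that)
  let ?g = "\<lambda>x. ramp b c (clip c x)"
  have c0: "c > 0" using bc by simp
  have r1: "indicator {x. norm x > c} x \<le> ?g x" for x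
    using bc by (auto simp: ramp_def norm_clip indicator_def)
  have r2: "?g x \<le> indicator {x. norm x > b} x" for x
    using bc by (auto simp: ramp_def norm_clip indicator_def divide_le_0_iff)
  have g: "continuous_on UNIV (ramp b c)" unfolding ramp_def using bc by (intro continuous_intros) auto
  have g0: "ramp b c x = 0" if "norm x \<le> b" for x
    using that bc by (auto simp: ramp_def divide_le_0_iff)
  have ig: "integrable \<mu> ?g" by (rule integrable_clip[OF g bc(1) g0 c0])
  have gm [measurable]: "ramp b c \<in> borel_measurable borel" by (rule borel_measurable_continuous_onI[OF g])
  have [measurable]: "clip c \<in> measurable borel (borel::'a measure)" by (rule clip_measurable[OF c0])
  have ii: "integrable \<mu> (indicat_real {x. norm x > t})" if "t > 0" for t
    using that finite_outer[OF that] outer_in_sets(1)[of t] by auto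
  show "m * c powr (-\<alpha>) \<le> (\<integral>x. ?g x \<partial>\<mu>)"
  proof -
    have "m * c powr (-\<alpha>) = (\<integral>x. indicator {x. norm x > c} x \<partial>\<mu>)"
      using measure_outer[OF c0] outer_in_sets(1)[of c] c0 by (simp add: space_mu)
        (subst Int_absorb2, auto)
    also have "\<dots> \<le> (\<integral>x. ?g x \<partial>\<mu>)" by (intro integral_mono ii ig r1 c0)
    finally show ?thesis .
  qed
  show "(\<integral>x. ?g x \<partial>\<mu>) \<le> m * b powr (-\<alpha>)"
  proof -
    have "(\<integral>x. ?g x \<partial>\<mu>) \<le> (\<integral>x. indicator {x. norm x > b} x \<partial>\<mu>)" by (intro integral_mono ii ig r2 bc)
    also have "\<dots> = m * b powr (-\<alpha>)"
      using measure_outer[OF bc(1)] outer_in_sets(1)[of b] bc by (simp add: space_mu)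
        (subst Int_absorb2, auto)
    finally show ?thesis .
  qed
  show "(\<lambda>n. real n * (\<integral>\<omega>. ?g ((1 / a n) *\<^sub>R X \<omega>) \<partial>\<Omega>)) \<longlonglongrightarrow> (\<integral>x. ?g x \<partial>\<mu>)"
    by (rule clip_conv[OF g bc(1) g0 c0])
  have int: "integrable \<Omega> (\<lambda>\<omega>. ?g (t *\<^sub>R X \<omega>))" for t
    by (rule integrable_const_bound[of _ 1]) (auto simp: ramp_def)
  have int2: "integrable \<Omega> (\<lambda>\<omega>. indicat_real {x. norm x > t} (X \<omega>))" for t
    by (rule integrable_const_bound[of _ 1]) (auto simp: indicator_def)
  have "\<forall>\<^sub>F n in sequentially. a n > 0" using a_lim by (simp add: filterlim_at_top_dense)
  then show "\<forall>\<^sub>F n in sequentially. real n * Q (c * a n) \<le> real n * (\<integral>\<omega>. ?g ((1 / a n) *\<^sub>R X \<omega>) \<partial>\<Omega>)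
     \<and> real n * (\<integral>\<omega>. ?g ((1 / a n) *\<^sub>R X \<omega>) \<partial>\<Omega>) \<le> real n * Q (b * a n)"
  proof eventually_elim
    case (elim n)
    have eq: "indicator {x. norm x > t * a n} (X \<omega>) = (indicator {x. norm x > t} ((1 / a n) *\<^sub>R X \<omega>) :: real)" for t \<omega>
      using elim by (auto simp: indicator_def field_simps)
    have "Q (c * a n) \<le> (\<integral>\<omega>. ?g ((1 / a n) *\<^sub>R X \<omega>) \<partial>\<Omega>)"
      unfolding Q_eq by (intro integral_mono int int2) (simp only: eq r1)
    moreover have "(\<integral>\<omega>. ?g ((1 / a n) *\<^sub>R X \<omega>) \<partial>\<Omega>) \<le> Q (b * a n)"
      unfolding Q_eq by (intro integral_mono int int2) (simp only: eq r2)
    ultimately show ?case by (auto intro: mult_left_mono)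
  qed
qed

lemma tail_along_a:
  assumes c: "c > 0"
  shows "(\<lambda>n. real n * Q (c * a n)) \<longlonglongrightarrow> m * c powr (-\<alpha>)"
proof (rule order_tendstoI)
  fix y assume y: "m * c powr (-\<alpha>) < y"
  have "((\<lambda>b. m * b powr (-\<alpha>)) \<longlongrightarrow> m * c powr (-\<alpha>)) (at_left c)"
    using c by (intro tendsto_intros) auto
  from order_tendstoD(2)[OF this y] have "\<forall>\<^sub>F b in at_left c. m * b powr (-\<alpha>) < y \<and> 0 < b \<and> b < c"
    using eventually_at_left_real[OF c] by eventually_elim auto
  then obtain b where b: "m * b powr (-\<alpha>) < y" "0 < b" "b < c"
    using eventually_happens[of _ "at_left c"] by auto
  obtain J u where J: "J \<le> m * b powr (-\<alpha>)" "u \<longlonglongrightarrow> J"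
    and "\<forall>\<^sub>F n in sequentially. real n * Q (c * a n) \<le> u n \<and> u n \<le> real n * Q (b * a n)"
    by (rule ramp_sandwich[OF b(2,3)])
  then have J3: "\<forall>\<^sub>F n in sequentially. real n * Q (c * a n) \<le> u n"
    by (simp add: eventually_conj_iff)
  have "\<forall>\<^sub>F n in sequentially. u n < y" using order_tendstoD(2)[OF J(2)] J(1) b(1) by auto
  with J3 show "\<forall>\<^sub>F n in sequentially. real n * Q (c * a n) < y" by eventually_elim auto
next
  fix y assume y: "y < m * c powr (-\<alpha>)"
  have "((\<lambda>b. m * b powr (-\<alpha>)) \<longlongrightarrow> m * c powr (-\<alpha>)) (at_right c)"
    using c by (intro tendsto_intros) auto
  from order_tendstoD(1)[OF this y] have "\<forall>\<^sub>F b in at_right c. m * b powr (-\<alpha>) > y \<and> c < b"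
    using eventually_at_right_less[of c] by eventually_elim auto
  then obtain b where b: "m * b powr (-\<alpha>) > y" "c < b"
    using eventually_happens[of _ "at_right c"] by auto
  obtain J u where J: "J \<ge> m * b powr (-\<alpha>)" "u \<longlonglongrightarrow> J"
    and "\<forall>\<^sub>F n in sequentially. real n * Q (b * a n) \<le> u n \<and> u n \<le> real n * Q (c * a n)"
    by (rule ramp_sandwich[OF c b(2)])
  then have J3: "\<forall>\<^sub>F n in sequentially. real n * Q (c * a n) \<ge> u n"
    by (simp add: eventually_conj_iff)
  have "\<forall>\<^sub>F n in sequentially. u n > y" using order_tendstoD(1)[OF J(2)] J(1) b(1) by auto
  with J3 show "\<forall>\<^sub>F n in sequentially. real n * Q (c * a n) > y" by eventually_elim auto
qed

text \<open>
  The first index at which \<open>a\<close> exceeds \<open>x\<close>. As \<open>a\<close> may fail to be monotone, this is not an inverse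
  function, but \<open>a (N x - 1) \<le> x < a (N x)\<close> holds as soon as \<open>N x \<ge> 1\<close>.
\<close>

definition N :: "real \<Rightarrow> nat" where "N x = (LEAST n. a n > x)"

lemma a_N: "a (N x) > x"
proof -
  have "\<exists>n. a n > x" using a_lim by (metis (mono_tags, lifting) eventually_sequentially filterlim_at_top_dense order_refl)
  then show ?thesis unfolding N_def by (metis LeastI)
qed

lemma a_N_pred: "N x \<ge> 1 \<Longrightarrow> a (N x - 1) \<le> x"
  using not_less_Least[of "N x - 1" "\<lambda>n. a n > x"] unfolding N_def by (simp add: not_less)

lemma N_at_top: "filterlim N at_top at_top"
  unfolding filterlim_at_top
proof
  fix n0 :: nat
  obtain B where B: "\<And>n. n < n0 \<Longrightarrow> a n \<le> B"
    using finite_imageI[of "{..<n0}" a, THEN finite_imp_bounded] bounded_real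
    by (metis abs_le_D1 finite_lessThan imageI lessThan_iff)
  have "N x \<ge> n0" if "x \<ge> B" for x
    using a_N[of x] B[of "N x"] that by (meson leI le_less_trans not_less)
  then show "\<forall>\<^sub>F x in at_top. n0 \<le> N x" unfolding eventually_at_top_linorder by blast
qed

text \<open>
  By monotonicity the tail at \<open>c * x\<close> lies between the tails at \<open>c * a (N x)\<close> and at
  \<open>c * a (N x - 1)\<close>, and both of these, multiplied by \<open>N x\<close>, have the same limit.
\<close>

lemma N_tail:
  assumes c: "c > 0"
  shows "((\<lambda>x. real (N x) * Q (c * x)) \<longlongrightarrow> m * c powr (-\<alpha>)) at_top"
proof (rule tendsto_sandwich)
  let ?v = "\<lambda>n. real n * Q (c * a (n - 1))"
  have l: "(\<lambda>n. real n * Q (c * a n)) \<longlonglongrightarrow> m * c powr (-\<alpha>)" by (rule tail_along_a[OF c])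
  have "(\<lambda>n. (real n * Q (c * a n)) * (1 / real n)) \<longlonglongrightarrow> m * c powr (-\<alpha>) * 0"
    by (intro tendsto_mult l lim_1_over_n)
  then have "(\<lambda>n. (real n * Q (c * a n)) * (1 / real n)) \<longlonglongrightarrow> 0" by simp
  then have "(\<lambda>n. Q (c * a n)) \<longlonglongrightarrow> 0"
    by (rule Lim_transform_eventually)
      (rule eventually_mono[OF eventually_gt_at_top[of "0::nat"]], simp)
  from tendsto_add[OF l this] have "(\<lambda>n. ?v (Suc n)) \<longlonglongrightarrow> m * c powr (-\<alpha>)" by (simp add: algebra_simps)
  then have v: "?v \<longlonglongrightarrow> m * c powr (-\<alpha>)" by (rule LIMSEQ_imp_Suc)
  show "((\<lambda>x. real (N x) * Q (c * a (N x))) \<longlongrightarrow> m * c powr (-\<alpha>)) at_top"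
    by (rule filterlim_compose[OF l N_at_top])
  show "((\<lambda>x. ?v (N x)) \<longlongrightarrow> m * c powr (-\<alpha>)) at_top"
    by (rule filterlim_compose[OF v N_at_top])
  show "\<forall>\<^sub>F x in at_top. real (N x) * Q (c * a (N x)) \<le> real (N x) * Q (c * x)"
    using a_N c by (intro always_eventually allI mult_left_mono Q_antimono) (auto intro: less_imp_le)
  have "\<forall>\<^sub>F x in at_top. N x \<ge> 1" using N_at_top by (simp add: filterlim_at_top)
  then show "\<forall>\<^sub>F x in at_top. real (N x) * Q (c * x) \<le> ?v (N x)"
    by eventually_elim (use a_N_pred c in \<open>auto intro!: mult_left_mono Q_antimono\<close>)
qed

lemma tail_pos: "Q t > 0"
proof -
  have "\<forall>\<^sub>F n in sequentially. real n * Q (1 * a n) > 0"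
    using order_tendstoD(1)[OF tail_along_a[of 1], of 0] m_pos by simp
  moreover have "\<forall>\<^sub>F n in sequentially. a n \<ge> t" using a_lim by (simp add: filterlim_at_top)
  ultimately have "\<forall>\<^sub>F n in sequentially. Q t > 0"
  proof eventually_elim
    case (elim n)
    then have "Q (a n) > 0" by (simp add: zero_less_mult_iff)
    moreover have "Q (a n) \<le> Q t" by (rule Q_antimono[OF elim(2)])
    ultimately show ?case by linarith
  qed
  then show ?thesis by simp
qed

lemma N_pos_ev: "\<forall>\<^sub>F x in at_top. real (N x) > 0"
proof -
  have "\<forall>\<^sub>F x in at_top. N x \<ge> 1" using N_at_top unfolding filterlim_at_top by blast
  then show ?thesis by eventually_elim simp
qed

sublocale regvar_rv \<Omega> "\<lambda>\<omega>. norm (X \<omega>)" \<alpha>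
proof
  show "0 < Q t" for t by (rule tail_pos)
  fix c :: real assume c: "c > 0"
  have "((\<lambda>x. (real (N x) * Q (c * x)) / (real (N x) * Q (1 * x))) \<longlongrightarrow> (m * c powr (-\<alpha>)) / (m * 1 powr (-\<alpha>))) at_top"
    by (intro tendsto_divide N_tail c) (use m_pos in auto)
  then have "((\<lambda>x. (real (N x) * Q (c * x)) / (real (N x) * Q x)) \<longlongrightarrow> c powr (-\<alpha>)) at_top"
    using m_pos by simp
  then show "((\<lambda>x. Q (c * x) / Q x) \<longlongrightarrow> c powr (-\<alpha>)) at_top"
    by (rule Lim_transform_eventually) (use N_pos_ev in \<open>auto elim!: eventually_mono\<close>)
qed

text \<open>
  Multiplied by \<open>N x\<close>, the tail at \<open>a (N x)\<close> tends to \<open>m\<close>, but the tail at \<open>(1 + d) * x\<close> tends to the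
  smaller limit \<open>(1 + d) powr (- \<alpha>) * m\<close>; so \<open>a (N x)\<close> cannot stay beyond \<open>(1 + d) * x\<close>.
\<close>

lemma a_N_ratio:
  assumes d: "d > 0"
  shows "\<forall>\<^sub>F x in at_top. a (N x) \<le> (1 + d) * x"
proof -
  have "m * (1 + d) powr (-\<alpha>) < m * 1 powr (-\<alpha>)"
    using d alpha_pos m_pos by (intro mult_strict_left_mono powr_less_mono2_neg) auto
  then obtain y where y: "m * (1 + d) powr (-\<alpha>) < y" "y < m * 1 powr (-\<alpha>)" using dense by blast
  have 1: "\<forall>\<^sub>F x in at_top. real (N x) * Q ((1 + d) * x) < y"
    using order_tendstoD(2)[OF N_tail[of "1 + d"] y(1)] d by simp
  have 2: "\<forall>\<^sub>F x in at_top. real (N x) * Q (1 * a (N x)) > y"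
    using order_tendstoD(1)[OF filterlim_compose[OF tail_along_a[of 1] N_at_top] y(2)] by simp
  from 1 2 show ?thesis
  proof eventually_elim
    case (elim x)
    show ?case
    proof (rule ccontr)
      assume "\<not> a (N x) \<le> (1 + d) * x"
      then have "real (N x) * Q (1 * a (N x)) \<le> real (N x) * Q ((1 + d) * x)"
        by (intro mult_left_mono Q_antimono) auto
      with elim show False by linarith
    qed
  qed
qed

text \<open>
  Since \<open>a (N x) / x\<close> tends to \<open>1\<close>, the scale \<open>a (N x)\<close> may be replaced by \<open>x\<close>: this moves clipped
  points by little, uniformly, and the integrands can differ only if the norm of \<open>X\<close> exceeds \<open>e * x\<close>,
  an event of probability \<open>O(1 / N x)\<close>.
\<close>

lemma clip_limit:
  fixes g :: "'a \<Rightarrow> real"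
  assumes g: "continuous_on UNIV g" and e: "e > 0" "\<And>x. norm x \<le> e \<Longrightarrow> g x = 0"
  shows "((\<lambda>x. (\<integral>\<omega>. g (clip 1 ((1 / x) *\<^sub>R X \<omega>)) \<partial>\<Omega>) / Q x) \<longlongrightarrow> (\<integral>x. g (clip 1 x) \<partial>\<mu>) / m) at_top"
proof -
  let ?G = "\<lambda>x. \<integral>\<omega>. g (clip 1 ((1 / x) *\<^sub>R X \<omega>)) \<partial>\<Omega>"
  let ?I = "\<integral>x. g (clip 1 x) \<partial>\<mu>"
  have [measurable]: "g \<in> borel_measurable borel" by (rule borel_measurable_continuous_onI[OF g])
  have [measurable]: "clip 1 \<in> measurable borel (borel::'a measure)" by (rule clip_measurable) simp
  obtain B where B: "\<And>x. norm x \<le> 1 \<Longrightarrow> norm (g x) \<le> B"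
    using bounded_on_cball[OF g] by blast
  have int: "integrable \<Omega> (\<lambda>\<omega>. g (clip 1 ((1 / x) *\<^sub>R X \<omega>)))" for x
    by (rule integrable_const_bound[of _ B]) (use B in \<open>auto simp: norm_clip\<close>)
  have int2: "integrable \<Omega> (\<lambda>\<omega>. indicat_real {x. norm x > t} (X \<omega>))" for t
    by (rule integrable_const_bound[of _ 1]) (auto simp: indicator_def)
  have 1: "((\<lambda>x. real (N x) * ?G (a (N x))) \<longlongrightarrow> ?I) at_top"
    by (rule filterlim_compose[OF clip_conv[OF g e zero_less_one] N_at_top])
  have "((\<lambda>x. real (N x) * ?G x - real (N x) * ?G (a (N x))) \<longlongrightarrow> 0) at_top"
  proof (rule tendstoI)
    fix \<eta>' :: real assume \<eta>': "\<eta>' > 0"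
    \<comment> \<open>In the limit, \<open>N x\<close> times the probability that the two integrands can differ is \<open>m * e powr (- \<alpha>)\<close>.\<close>
    define \<eta> where "\<eta> = \<eta>' / (m * e powr (-\<alpha>) + 1)"
    have mp: "m * e powr (-\<alpha>) \<ge> 0" using m_pos by simp
    then have \<eta>: "\<eta> > 0" "\<eta> * (m * e powr (-\<alpha>) + 1) = \<eta>'" using \<eta>' by (auto simp: \<eta>_def)
    have "uniformly_continuous_on (cball 0 1) g"
      by (intro compact_uniformly_continuous continuous_on_subset[OF g]) auto
    then obtain d where d: "d > 0" "\<And>x y. norm x \<le> 1 \<Longrightarrow> norm y \<le> 1 \<Longrightarrow> norm (x - y) < d \<Longrightarrow> \<bar>g x - g y\<bar> < \<eta>"
      using \<eta>(1) unfolding uniformly_continuous_on_def by (auto simp: dist_norm)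
    have "\<forall>\<^sub>F x in at_top. real (N x) * Q (e * x) < m * e powr (-\<alpha>) + 1"
      using order_tendstoD(2)[OF N_tail[OF e(1)], of "m * e powr (-\<alpha>) + 1"] by simp
    moreover have "\<forall>\<^sub>F x in at_top. a (N x) \<le> (1 + d / 2) * x" using d by (intro a_N_ratio) auto
    moreover note eventually_gt_at_top[of "0::real"]
    ultimately show "\<forall>\<^sub>F x in at_top. dist (real (N x) * ?G x - real (N x) * ?G (a (N x))) 0 < \<eta>'"
    proof eventually_elim
      case (elim x)
      have aN: "a (N x) > x" by (rule a_N)
      have pt: "\<bar>g (clip 1 ((1 / x) *\<^sub>R X \<omega>)) - g (clip 1 ((1 / a (N x)) *\<^sub>R X \<omega>))\<bar> \<le> \<eta> * indicat_real {y. norm y > e * x} (X \<omega>)" for \<omega>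
      proof (cases "norm (X \<omega>) > e * x")
        case True
        have eqv: "(a (N x) / x) *\<^sub>R ((1 / a (N x)) *\<^sub>R X \<omega>) = (1 / x) *\<^sub>R X \<omega>" using aN elim by simp
        have "norm (clip 1 ((a (N x) / x) *\<^sub>R ((1 / a (N x)) *\<^sub>R X \<omega>)) - clip 1 ((1 / a (N x)) *\<^sub>R X \<omega>)) \<le> a (N x) / x - 1"
          by (rule norm_clip_scaleR_diff) (use aN elim in simp)
        then have "norm (clip 1 ((1 / x) *\<^sub>R X \<omega>) - clip 1 ((1 / a (N x)) *\<^sub>R X \<omega>)) \<le> a (N x) / x - 1"
          unfolding eqv .
        also have "a (N x) / x - 1 \<le> d / 2" using elim by (simp add: field_simps)
        also have "d / 2 < d" using d by simp
        finally have "norm (clip 1 ((1 / x) *\<^sub>R X \<omega>) - clip 1 ((1 / a (N x)) *\<^sub>R X \<omega>)) < d" .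
        then have "\<bar>g (clip 1 ((1 / x) *\<^sub>R X \<omega>)) - g (clip 1 ((1 / a (N x)) *\<^sub>R X \<omega>))\<bar> < \<eta>"
          by (intro d) (auto simp: norm_clip)
        then show ?thesis using True by simp
      next
        case False
        then have "norm (X \<omega>) / x \<le> e" using elim by (simp add: field_simps)
        moreover have "norm (X \<omega>) / a (N x) \<le> norm (X \<omega>) / x" using aN elim by (intro divide_left_mono) auto
        ultimately have "g (clip 1 ((1 / x) *\<^sub>R X \<omega>)) = 0" "g (clip 1 ((1 / a (N x)) *\<^sub>R X \<omega>)) = 0"
          using aN elim by (auto intro!: e(2) simp: norm_clip)
        then show ?thesis using \<eta> by (simp add: indicator_def)
      qed
      have "\<bar>?G x - ?G (a (N x))\<bar> = \<bar>\<integral>\<omega>. g (clip 1 ((1 / x) *\<^sub>R X \<omega>)) - g (clip 1 ((1 / a (N x)) *\<^sub>R X \<omega>)) \<partial>\<Omega>\<bar>"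
        by (subst Bochner_Integration.integral_diff) (auto intro: int)
      also have "\<dots> \<le> (\<integral>\<omega>. \<eta> * indicat_real {y. norm y > e * x} (X \<omega>) \<partial>\<Omega>)"
        by (rule order_trans[OF integral_abs_bound]) (intro integral_mono pt integrable_abs Bochner_Integration.integrable_diff int integrable_mult_right int2)
      also have "\<dots> = \<eta> * Q (e * x)" by (simp add: Q_eq)
      finally have "\<bar>real (N x) * ?G x - real (N x) * ?G (a (N x))\<bar> \<le> real (N x) * (\<eta> * Q (e * x))"
        by (simp add: right_diff_distrib[symmetric] abs_mult mult_left_mono)
      also have "\<dots> = \<eta> * (real (N x) * Q (e * x))" by simp
      also have "\<dots> < \<eta> * (m * e powr (-\<alpha>) + 1)" using elim \<eta> by (intro mult_strict_left_mono) auto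
      finally show ?case by (simp add: \<eta>(2))
    qed
  qed
  from tendsto_add[OF this 1] have 2: "((\<lambda>x. real (N x) * ?G x) \<longlongrightarrow> ?I) at_top" by simp
  have "((\<lambda>x. (real (N x) * ?G x) / (real (N x) * Q (1 * x))) \<longlongrightarrow> ?I / (m * 1 powr (-\<alpha>))) at_top"
    by (intro tendsto_divide 2 N_tail) (use m_pos in auto)
  then have "((\<lambda>x. (real (N x) * ?G x) / (real (N x) * Q x)) \<longlongrightarrow> ?I / m) at_top" by simp
  then show ?thesis
    by (rule Lim_transform_eventually) (use N_pos_ev in \<open>auto elim!: eventually_mono\<close>)
qed

end

section \<open>Weighted convolution powers\<close>

text \<open>
  The weight \<open>\<phi>\<close> serves to remove a neighbourhood of the origin, where \<open>\<nu>\<close> has infinite mass.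
\<close>

definition weighted_conv :: "'a measure \<Rightarrow> ('a \<Rightarrow> real) \<Rightarrow> ('a::euclidean_space \<Rightarrow> real) \<Rightarrow> 'a \<Rightarrow> real" where
  "weighted_conv P \<phi> F z = (\<integral>x. F (z + x) * \<phi> x \<partial>P)"

lemma uniformly_continuous_on_UNIV_norm:
  fixes F :: "'a::euclidean_space \<Rightarrow> real"
  shows "uniformly_continuous_on UNIV F \<longleftrightarrow> (\<forall>e>0. \<exists>d>0. \<forall>x y. norm (x - y) < d \<longrightarrow> \<bar>F x - F y\<bar> < e)"
  unfolding uniformly_continuous_on_def by (simp add: dist_norm) metis

locale weighted_kernel = sigma_finite_measure P for P :: "'a::euclidean_space measure" +
  fixes \<phi> :: "'a \<Rightarrow> real"
  assumes id_meas [measurable]: "(\<lambda>x. x) \<in> measurable P borel"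
    and \<phi>_meas [measurable]: "\<phi> \<in> borel_measurable borel"
    and \<phi>_nonneg: "\<And>x. 0 \<le> \<phi> x"
    and \<phi>_int: "integrable P \<phi>"
begin

lemma borel_comp: "F \<in> borel_measurable borel \<Longrightarrow> (\<lambda>x. F (z + x)) \<in> borel_measurable P"
  by (rule measurable_compose[OF id_meas]) (rule measurable_compose[of "\<lambda>x. z + x" borel borel], simp_all)

lemma integrable_weighted:
  fixes F :: "'a \<Rightarrow> real"
  assumes F: "F \<in> borel_measurable borel" and B: "\<And>x. \<bar>F x\<bar> \<le> B"
  shows "integrable P (\<lambda>x. F (z + x) * \<phi> x)"
proof (rule Bochner_Integration.integrable_bound)
  show "integrable P (\<lambda>x. B * \<phi> x)" by (intro integrable_mult_right \<phi>_int)
  show "(\<lambda>x. F (z + x) * \<phi> x) \<in> borel_measurable P"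
    by (intro borel_measurable_times borel_comp F borel_measurable_integrable[OF \<phi>_int])
  show "AE x in P. norm (F (z + x) * \<phi> x) \<le> norm (B * \<phi> x)"
  proof (rule AE_I2)
    fix x
    have "B \<ge> 0" using B[of 0] by linarith
    then show "norm (F (z + x) * \<phi> x) \<le> norm (B * \<phi> x)"
      using B \<phi>_nonneg by (simp add: abs_mult mult_right_mono)
  qed
qed

lemma weighted_conv_diff:
  fixes F :: "'a \<Rightarrow> real"
  assumes F: "F \<in> borel_measurable borel" "\<And>x. \<bar>F x\<bar> \<le> B"
    and e: "\<And>x. \<bar>F (z + x) - F (w + x)\<bar> \<le> e"
  shows "\<bar>weighted_conv P \<phi> F z - weighted_conv P \<phi> F w\<bar> \<le> e * integral\<^sup>L P \<phi>"
proof -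
  have "weighted_conv P \<phi> F z - weighted_conv P \<phi> F w = (\<integral>x. F (z + x) * \<phi> x - F (w + x) * \<phi> x \<partial>P)"
    unfolding weighted_conv_def
    by (rule Bochner_Integration.integral_diff[symmetric]) (rule integrable_weighted[OF F])+
  also have "\<bar>\<dots>\<bar> \<le> (\<integral>x. e * \<phi> x \<partial>P)"
  proof (rule order_trans[OF integral_abs_bound], rule integral_mono)
    fix x
    show "\<bar>F (z + x) * \<phi> x - F (w + x) * \<phi> x\<bar> \<le> e * \<phi> x"
      using e[of x] \<phi>_nonneg[of x] by (simp add: left_diff_distrib[symmetric] abs_mult mult_right_mono)
  qed (intro integrable_abs Bochner_Integration.integrable_diff integrable_weighted[OF F] integrable_mult_right \<phi>_int)+
  finally show ?thesis by simp
qed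

lemma weighted_conv_bound:
  fixes F :: "'a \<Rightarrow> real"
  assumes F: "F \<in> borel_measurable borel" "\<And>x. \<bar>F x\<bar> \<le> B"
  shows "\<bar>weighted_conv P \<phi> F z\<bar> \<le> B * integral\<^sup>L P \<phi>"
proof -
  have "\<bar>weighted_conv P \<phi> F z\<bar> \<le> (\<integral>x. B * \<phi> x \<partial>P)"
    unfolding weighted_conv_def
  proof (rule order_trans[OF integral_abs_bound], rule integral_mono)
    fix x
    show "\<bar>F (z + x) * \<phi> x\<bar> \<le> B * \<phi> x"
      using F(2)[of "z + x"] \<phi>_nonneg[of x] by (simp add: abs_mult mult_right_mono)
  qed (intro integrable_abs integrable_weighted[OF F] integrable_mult_right \<phi>_int)+
  then show ?thesis by simp
qed

lemma mass_nonneg: "0 \<le> integral\<^sup>L P \<phi>"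
  using \<phi>_nonneg by (intro Bochner_Integration.integral_nonneg) auto

lemma weighted_conv_uniformly_continuous:
  assumes uc: "uniformly_continuous_on UNIV F" and B: "\<And>x. \<bar>F x\<bar> \<le> B"
  shows "uniformly_continuous_on UNIV (weighted_conv P \<phi> F)"
  unfolding uniformly_continuous_on_UNIV_norm
proof (intro allI impI)
  fix e :: real assume e: "e > 0"
  let ?K = "integral\<^sup>L P \<phi>"
  have K: "?K + 1 > 0" using mass_nonneg by simp
  then obtain d where d: "d > 0" "\<And>x y. norm (x - y) < d \<Longrightarrow> \<bar>F x - F y\<bar> < e / (?K + 1)"
    using uc e unfolding uniformly_continuous_on_UNIV_norm by (metis divide_pos_pos)
  have F: "F \<in> borel_measurable borel"
    by (intro borel_measurable_continuous_onI uniformly_continuous_imp_continuous uc)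
  show "\<exists>d>0. \<forall>x y. norm (x - y) < d \<longrightarrow> \<bar>weighted_conv P \<phi> F x - weighted_conv P \<phi> F y\<bar> < e"
  proof (intro exI[of _ d] conjI allI impI d(1))
    fix x y :: 'a assume xy: "norm (x - y) < d"
    have "\<bar>weighted_conv P \<phi> F x - weighted_conv P \<phi> F y\<bar> \<le> e / (?K + 1) * ?K"
    proof (rule weighted_conv_diff[OF F B])
      fix z show "\<bar>F (x + z) - F (y + z)\<bar> \<le> e / (?K + 1)" using d(2)[of "x + z" "y + z"] xy by simp
    qed
    also have "\<dots> < e" using K e by (simp add: field_simps)
    finally show "\<bar>weighted_conv P \<phi> F x - weighted_conv P \<phi> F y\<bar> < e" .
  qed
qed

lemma weighted_conv_iterate:
  assumes uc: "uniformly_continuous_on UNIV F" and B: "\<And>x. \<bar>F x\<bar> \<le> B"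
  shows "uniformly_continuous_on UNIV ((weighted_conv P \<phi> ^^ k) F)
     \<and> (\<forall>z. \<bar>(weighted_conv P \<phi> ^^ k) F z\<bar> \<le> B * integral\<^sup>L P \<phi> ^ k)"
proof (induction k)
  case (Suc k)
  let ?G = "(weighted_conv P \<phi> ^^ k) F"
  have G: "?G \<in> borel_measurable borel"
    by (intro borel_measurable_continuous_onI uniformly_continuous_imp_continuous) (use Suc in auto)
  have "uniformly_continuous_on UNIV (weighted_conv P \<phi> ?G)"
    by (rule weighted_conv_uniformly_continuous) (use Suc in auto)
  moreover have "\<bar>weighted_conv P \<phi> ?G z\<bar> \<le> (B * integral\<^sup>L P \<phi> ^ k) * integral\<^sup>L P \<phi>" for z
    by (rule weighted_conv_bound[OF G]) (use Suc in auto)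
  ultimately show ?case by (simp add: mult.commute mult.left_commute)
qed (use assms in auto)

text \<open>
  Integrating out one coordinate after the other. The right-hand side depends on \<open>I\<close> only through
  its cardinality, so that no coordinates have to be renamed when \<open>I\<close> varies.
\<close>

lemma product_integral_iterate:
  assumes "finite I"
    and "uniformly_continuous_on UNIV F" and "\<And>x. \<bar>F x\<bar> \<le> B"
  shows "integrable (Pi\<^sub>M I (\<lambda>_. P)) (\<lambda>x. F (z + (\<Sum>j\<in>I. x j)) * (\<Prod>j\<in>I. \<phi> (x j))) \<and>
    (\<integral>x. F (z + (\<Sum>j\<in>I. x j)) * (\<Prod>j\<in>I. \<phi> (x j)) \<partial>Pi\<^sub>M I (\<lambda>_. P)) = (weighted_conv P \<phi> ^^ card I) F z"
  using assms
proof (induction I arbitrary: F B rule: finite_induct)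
  case empty
  interpret product_sigma_finite "\<lambda>_. P" by unfold_locales
  show ?case by (simp add: PiM_empty lebesgue_integral_count_space_finite integrable_count_space)
next
  case (insert i I)
  interpret product_sigma_finite "\<lambda>_. P" by unfold_locales
  have F: "F \<in> borel_measurable borel"
    by (intro borel_measurable_continuous_onI uniformly_continuous_imp_continuous insert.prems)
  have B0: "B \<ge> 0" using insert.prems(2)[of 0] by linarith
  let ?f = "\<lambda>x. F (z + (\<Sum>j\<in>insert i I. x j)) * (\<Prod>j\<in>insert i I. \<phi> (x j))"
  have cm: "(\<lambda>x. x j) \<in> measurable (Pi\<^sub>M (insert i I) (\<lambda>_. P)) borel" if "j \<in> insert i I" for j
    by (rule measurable_compose[OF measurable_component_singleton[OF that] id_meas])
  have int: "integrable (Pi\<^sub>M (insert i I) (\<lambda>_. P)) ?f"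
  proof (rule Bochner_Integration.integrable_bound)
    show "integrable (Pi\<^sub>M (insert i I) (\<lambda>_. P)) (\<lambda>x. B * (\<Prod>j\<in>insert i I. \<phi> (x j)))"
      using insert by (intro integrable_mult_right product_integrable_prod \<phi>_int) auto
    show "?f \<in> borel_measurable (Pi\<^sub>M (insert i I) (\<lambda>_. P))"
      by (intro borel_measurable_times measurable_compose[OF _ F] borel_measurable_add borel_measurable_const
          borel_measurable_sum borel_measurable_prod cm measurable_compose[OF cm \<phi>_meas])
    show "AE x in Pi\<^sub>M (insert i I) (\<lambda>_. P). norm (?f x) \<le> norm (B * (\<Prod>j\<in>insert i I. \<phi> (x j)))"
    proof (rule AE_I2)
      fix x
      have "0 \<le> (\<Prod>j\<in>insert i I. \<phi> (x j))" by (intro prod_nonneg) (auto simp: \<phi>_nonneg)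
      moreover have "\<bar>F (z + (\<Sum>j\<in>insert i I. x j))\<bar> \<le> B" by (rule insert.prems)
      ultimately show "norm (?f x) \<le> norm (B * (\<Prod>j\<in>insert i I. \<phi> (x j)))"
        using B0 by (simp del: sum.insert prod.insert add: insert.hyps abs_mult mult_right_mono)
    qed
  qed
  have "integral\<^sup>L (Pi\<^sub>M (insert i I) (\<lambda>_. P)) ?f = (\<integral>x. (\<integral>y. ?f (x(i := y)) \<partial>P) \<partial>Pi\<^sub>M I (\<lambda>_. P))"
    by (rule product_integral_insert[OF insert.hyps int])
  also have "\<dots> = (\<integral>x. weighted_conv P \<phi> F (z + (\<Sum>j\<in>I. x j)) * (\<Prod>j\<in>I. \<phi> (x j)) \<partial>Pi\<^sub>M I (\<lambda>_. P))"
  proof (rule Bochner_Integration.integral_cong[OF refl])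
    fix x
    have "(\<Sum>j\<in>I. (x(i := y)) j) = (\<Sum>j\<in>I. x j)" "(\<Prod>j\<in>I. \<phi> ((x(i := y)) j)) = (\<Prod>j\<in>I. \<phi> (x j))" for y
      using insert.hyps by (auto intro!: sum.cong prod.cong)
    then have "(\<integral>y. ?f (x(i := y)) \<partial>P) = (\<integral>y. (F ((z + (\<Sum>j\<in>I. x j)) + y) * \<phi> y) * (\<Prod>j\<in>I. \<phi> (x j)) \<partial>P)"
      using insert.hyps by (simp add: add_ac mult_ac)
    also have "\<dots> = weighted_conv P \<phi> F (z + (\<Sum>j\<in>I. x j)) * (\<Prod>j\<in>I. \<phi> (x j))"
      unfolding weighted_conv_def by simp
    finally show "(\<integral>y. ?f (x(i := y)) \<partial>P) = weighted_conv P \<phi> F (z + (\<Sum>j\<in>I. x j)) * (\<Prod>j\<in>I. \<phi> (x j))" .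
  qed
  also have "\<dots> = (weighted_conv P \<phi> ^^ card I) (weighted_conv P \<phi> F) z"
    by (rule insert.IH[THEN conjunct2, OF weighted_conv_uniformly_continuous[OF insert.prems]
          weighted_conv_bound[OF F insert.prems(2)]])
  also have "\<dots> = (weighted_conv P \<phi> ^^ card (insert i I)) F z"
    using insert.hyps by (simp add: funpow_swap1)
  finally show ?case using int by blast
qed

end

text \<open>
  Weak convergence is preserved by convolution powers. In the induction step the measure and the
  integrand both vary with \<open>n\<close>. The integrands \<open>T n k\<close> are equicontinuous in \<open>n\<close>, because the masses
  are bounded by \<open>K\<close>, so that their pointwise convergence is uniform on the compact ball
  \<open>cball z 1\<close>, on which the measures, translated by \<open>z\<close>, are concentrated.
\<close>

lemma weighted_conv_limit:
  fixes Pn :: "nat \<Rightarrow> 'a::euclidean_space measure"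
  assumes kn: "\<And>n. weighted_kernel (Pn n) \<phi>" and kP: "weighted_kernel P \<phi>"
    and sup: "\<And>n. AE x in Pn n. norm x \<le> 1"
    and c: "\<And>n. c n \<ge> 0"
    and lim: "\<And>g B. uniformly_continuous_on UNIV g \<Longrightarrow> (\<And>x. \<bar>g x\<bar> \<le> B) \<Longrightarrow>
       (\<lambda>n. c n * (\<integral>x. g x * \<phi> x \<partial>Pn n)) \<longlonglongrightarrow> (\<integral>x. g x * \<phi> x \<partial>P)"
    and F: "uniformly_continuous_on UNIV F" "\<And>x. \<bar>F x\<bar> \<le> B"
  shows "(\<lambda>n. c n ^ k * (weighted_conv (Pn n) \<phi> ^^ k) F z) \<longlonglongrightarrow> (weighted_conv P \<phi> ^^ k) F z"
proof -
  interpret P: weighted_kernel P \<phi> by (rule kP)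
  have "(\<lambda>n. c n * (\<integral>x. 1 * \<phi> x \<partial>Pn n)) \<longlonglongrightarrow> (\<integral>x. 1 * \<phi> x \<partial>P)"
    by (rule lim[of _ 1]) (simp_all add: uniformly_continuous_on_const)
  then have mass: "(\<lambda>n. c n * integral\<^sup>L (Pn n) \<phi>) \<longlonglongrightarrow> integral\<^sup>L P \<phi>" by simp
  obtain K where K0: "K > 0" "\<forall>n. norm (c n * integral\<^sup>L (Pn n) \<phi>) \<le> K"
    by (rule BseqE[OF convergent_imp_Bseq[OF convergentI[OF mass]]])
  then have K: "K > 0" "\<And>n. norm (c n * integral\<^sup>L (Pn n) \<phi>) \<le> K" by auto
  define T where "T n k = (\<lambda>z. c n ^ k * (weighted_conv (Pn n) \<phi> ^^ k) F z)" for n k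
  have Tn_Suc: "T n (Suc k) z = c n * (\<integral>x. T n k (z + x) * \<phi> x \<partial>Pn n)" for n k z
  proof -
    have "(\<integral>x. T n k (z + x) * \<phi> x \<partial>Pn n) = (\<integral>x. c n ^ k * ((weighted_conv (Pn n) \<phi> ^^ k) F (z + x) * \<phi> x) \<partial>Pn n)"
      by (simp add: T_def mult.assoc)
    also have "\<dots> = c n ^ k * weighted_conv (Pn n) \<phi> ((weighted_conv (Pn n) \<phi> ^^ k) F) z"
      unfolding weighted_conv_def[of _ _ "(weighted_conv (Pn n) \<phi> ^^ k) F"] by (rule integral_mult_right_zero)
    finally show ?thesis by (simp add: T_def)
  qed
  have bnd: "uniformly_continuous_on UNIV (T n k)" "\<And>z. \<bar>T n k z\<bar> \<le> c n ^ k * (B * integral\<^sup>L (Pn n) \<phi> ^ k)" for n k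
  proof -
    interpret weighted_kernel "Pn n" \<phi> by (rule kn)
    show "uniformly_continuous_on UNIV (T n k)"
      unfolding T_def by (intro uniformly_continuous_on_cmul_left weighted_conv_iterate[OF F, THEN conjunct1])
    show "\<bar>T n k z\<bar> \<le> c n ^ k * (B * integral\<^sup>L (Pn n) \<phi> ^ k)" for z
      unfolding T_def using c weighted_conv_iterate[OF F, THEN conjunct2] by (simp add: abs_mult mult_left_mono)
  qed
  have meas: "T n k \<in> borel_measurable borel" for n k
    by (intro borel_measurable_continuous_onI uniformly_continuous_imp_continuous bnd)
  have equi: "\<exists>d>0. \<forall>n x y. norm (x - y) < d \<longrightarrow> \<bar>T n k x - T n k y\<bar> \<le> e" if "e > 0" for k e
    using that
  proof (induction k arbitrary: e)
    case 0
    then show ?case using F(1) unfolding uniformly_continuous_on_UNIV_norm T_def by (auto intro: less_imp_le) (metis less_imp_le)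
  next
    case (Suc k)
    then obtain d where d: "d > 0" "\<And>n x y. norm (x - y) < d \<Longrightarrow> \<bar>T n k x - T n k y\<bar> \<le> e / K"
      using K(1) by (metis divide_pos_pos)
    have "\<bar>T n (Suc k) x - T n (Suc k) y\<bar> \<le> e" if "norm (x - y) < d" for n x y
    proof -
      interpret weighted_kernel "Pn n" \<phi> by (rule kn)
      have "T n (Suc k) x - T n (Suc k) y = c n * (weighted_conv (Pn n) \<phi> (T n k) x - weighted_conv (Pn n) \<phi> (T n k) y)"
        unfolding Tn_Suc weighted_conv_def by (simp add: right_diff_distrib)
      also have "\<bar>\<dots>\<bar> \<le> c n * (e / K * integral\<^sup>L (Pn n) \<phi>)"
        unfolding abs_mult using c[of n]
      proof (simp only: abs_of_nonneg, intro mult_left_mono weighted_conv_diff[OF meas bnd(2)])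
        fix u show "\<bar>T n k (x + u) - T n k (y + u)\<bar> \<le> e / K" using d(2)[of "x + u" "y + u"] that by simp
      qed
      also have "\<dots> = e / K * (c n * integral\<^sup>L (Pn n) \<phi>)" by simp
      also have "\<dots> \<le> e / K * K" using K(2)[of n] K(1) Suc.prems by (intro mult_left_mono) auto
      finally show ?thesis using K(1) by simp
    qed
    with d(1) show ?case by blast
  qed
  have "(\<lambda>n. T n k z) \<longlonglongrightarrow> (weighted_conv P \<phi> ^^ k) F z" for k z
  proof (induction k arbitrary: z)
    case 0
    then show ?case by (simp add: T_def)
  next
    case (Suc k)
    let ?G = "(weighted_conv P \<phi> ^^ k) F"
    have Guc: "uniformly_continuous_on UNIV ?G" and Gb: "\<And>z. \<bar>?G z\<bar> \<le> B * integral\<^sup>L P \<phi> ^ k"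
      using P.weighted_conv_iterate[OF F, of k] by auto
    have Gm: "?G \<in> borel_measurable borel"
      by (intro borel_measurable_continuous_onI uniformly_continuous_imp_continuous Guc)
    have Gz: "uniformly_continuous_on UNIV (\<lambda>x. ?G (z + x))"
      using Guc unfolding uniformly_continuous_on_UNIV_norm by (metis add_diff_cancel_left)
    have l1: "(\<lambda>n. c n * (\<integral>x. ?G (z + x) * \<phi> x \<partial>Pn n)) \<longlonglongrightarrow> (weighted_conv P \<phi> ^^ Suc k) F z"
      using lim[OF Gz Gb] by (simp add: weighted_conv_def[of P \<phi> ?G])
    have l2: "(\<lambda>n. T n (Suc k) z - c n * (\<integral>x. ?G (z + x) * \<phi> x \<partial>Pn n)) \<longlonglongrightarrow> 0"
    proof (rule tendstoI)
      fix e' :: real assume e': "e' > 0"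
      \<comment> \<open>Going through a centre \<open>y\<close> of the finite cover costs \<open>3 * e\<close>, and the mass is at most \<open>K\<close>.\<close>
      define e where "e = e' / (6 * K)"
      have e: "e > 0" "3 * e * K = e' / 2" using e' K by (auto simp: e_def)
      obtain d1 where d1: "d1 > 0" "\<And>n x y. norm (x - y) < d1 \<Longrightarrow> \<bar>T n k x - T n k y\<bar> \<le> e"
        using equi[OF e(1)] by blast
      obtain d2 where d2: "d2 > 0" "\<And>x y. norm (x - y) < d2 \<Longrightarrow> \<bar>?G x - ?G y\<bar> < e"
        using Guc e(1) unfolding uniformly_continuous_on_UNIV_norm by blast
      define d where "d = min d1 d2"
      have "compact (cball z 1)" by simp
      moreover have "cball z 1 \<subseteq> (\<Union>y\<in>cball z 1. ball y d)" using d1 d2 by (auto simp: d_def)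
      ultimately obtain Y where Y: "Y \<subseteq> cball z 1" "finite Y" "cball z 1 \<subseteq> (\<Union>y\<in>Y. ball y d)"
        using compactE_image[of "cball z 1" "cball z 1" "\<lambda>y. ball y d"] by blast
      have "\<forall>\<^sub>F n in sequentially. \<forall>y\<in>Y. dist (T n k y) (?G y) < e"
        using Y(2) e(1) by (simp add: eventually_ball_finite_distrib tendstoD[OF Suc.IH])
      then show "\<forall>\<^sub>F n in sequentially. dist (T n (Suc k) z - c n * (\<integral>x. ?G (z + x) * \<phi> x \<partial>Pn n)) 0 < e'"
      proof eventually_elim
        case (elim n)
        interpret weighted_kernel "Pn n" \<phi> by (rule kn)
        have near: "\<bar>T n k (z + x) - ?G (z + x)\<bar> \<le> 3 * e" if "norm x \<le> 1" for x
        proof -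
          have "z + x \<in> cball z 1" using that by (simp add: dist_norm)
          then obtain y where y: "y \<in> Y" "dist y (z + x) < d" using Y(3) by auto
          have "\<bar>T n k (z + x) - T n k y\<bar> \<le> e" by (rule d1) (use y in \<open>auto simp: d_def dist_norm norm_minus_commute\<close>)
          moreover have "\<bar>?G (z + x) - ?G y\<bar> < e" by (rule d2) (use y in \<open>auto simp: d_def dist_norm norm_minus_commute\<close>)
          moreover have "\<bar>T n k y - ?G y\<bar> < e" using elim y(1) by (auto simp: dist_real_def)
          ultimately show ?thesis by linarith
        qed
        have "(\<integral>x. T n k (z + x) * \<phi> x \<partial>Pn n) - (\<integral>x. ?G (z + x) * \<phi> x \<partial>Pn n)
           = (\<integral>x. T n k (z + x) * \<phi> x - ?G (z + x) * \<phi> x \<partial>Pn n)"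
          by (rule Bochner_Integration.integral_diff[symmetric])
            (intro integrable_weighted[OF meas bnd(2)] integrable_weighted[OF Gm Gb])+
        also have "\<bar>\<dots>\<bar> \<le> (\<integral>x. 3 * e * \<phi> x \<partial>Pn n)"
        proof (rule order_trans[OF integral_abs_bound], rule integral_mono_AE)
          show "AE x in Pn n. \<bar>T n k (z + x) * \<phi> x - ?G (z + x) * \<phi> x\<bar> \<le> 3 * e * \<phi> x"
            using sup[of n]
          proof eventually_elim
            case (elim x)
            then show ?case using near[of x] \<phi>_nonneg[of x]
              by (simp add: left_diff_distrib[symmetric] abs_mult mult_right_mono)
          qed
        qed (intro integrable_abs Bochner_Integration.integrable_diff integrable_weighted[OF meas bnd(2)]
              integrable_weighted[OF Gm Gb] integrable_mult_right \<phi>_int)+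
        finally have "\<bar>(\<integral>x. T n k (z + x) * \<phi> x \<partial>Pn n) - (\<integral>x. ?G (z + x) * \<phi> x \<partial>Pn n)\<bar> \<le> 3 * e * integral\<^sup>L (Pn n) \<phi>"
          by simp
        then have "\<bar>T n (Suc k) z - c n * (\<integral>x. ?G (z + x) * \<phi> x \<partial>Pn n)\<bar> \<le> c n * (3 * e * integral\<^sup>L (Pn n) \<phi>)"
          unfolding Tn_Suc using c[of n] by (simp add: right_diff_distrib[symmetric] abs_mult mult_left_mono)
        also have "\<dots> = 3 * e * (c n * integral\<^sup>L (Pn n) \<phi>)" by simp
        also have "\<dots> \<le> 3 * e * K" using K(2)[of n] e by (intro mult_left_mono) auto
        also have "\<dots> < e'" using e' by (simp add: e(2))
        finally show ?case by simp
      qed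
    qed
    from tendsto_add[OF l2 l1] show ?case by simp
  qed
  then show ?thesis by (simp add: T_def)
qed

section \<open>An exponential bound for truncated sums\<close>

lemma exp_le_quadratic: 
  assumes "\<bar>y\<bar> \<le> 1" shows "exp y \<le> 1 + y + (y::real)\<^sup>2"
proof (cases "y \<ge> 0")
  case True
  then show ?thesis using exp_bound[of y] assms by auto
next
  case False
  define t where "t = - y"
  have t: "t > 0" using False by (simp add: t_def)
  have q: "1 + t + t\<^sup>2 / 2 > 0" using t by (simp add: add_pos_nonneg)
  have "exp y = 1 / exp t" by (simp add: t_def exp_minus field_simps)
  also have "\<dots> \<le> 1 / (1 + t + t\<^sup>2 / 2)"
    using q t by (intro divide_left_mono exp_lower_Taylor_quadratic) auto
  also have "\<dots> \<le> 1 - t + t\<^sup>2"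
  proof -
    have "(1 - t + t\<^sup>2) * (1 + t + t\<^sup>2 / 2) = 1 + t^2/2 + t^3/2 + t^4/2"
      by (simp add: field_simps power2_eq_square power3_eq_cube power4_eq_xxxx)
    also have "\<dots> \<ge> 1" using t by simp
    finally show ?thesis using q by (simp add: pos_divide_le_eq)
  qed
  finally show ?thesis by (simp add: t_def)
qed

text \<open>
  This lemma and the next bound the remainder of the exponential function by powers whose exponent
  \<open>s\<close> can be matched to the moments available; beyond order \<open>2\<close>, the quadratic term has to be kept.
\<close>

lemma exp_remainder_le_2:
  fixes y s :: real
  assumes "1 \<le> s" "s \<le> 2"
  shows "exp y \<le> 1 + y + \<bar>y\<bar> powr s * exp \<bar>y\<bar>"
proof (cases "\<bar>y\<bar> \<le> 1")
  case True
  have "exp y \<le> 1 + y + y\<^sup>2" by (rule exp_le_quadratic[OF True])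
  moreover have "y\<^sup>2 \<le> \<bar>y\<bar> powr s"
  proof (cases "y = 0")
    case False
    have "\<bar>y\<bar> powr 2 \<le> \<bar>y\<bar> powr s" using True assms False by (intro powr_mono') auto
    then show ?thesis using False by (simp add: powr_numeral)
  qed auto
  moreover have "\<bar>y\<bar> powr s * 1 \<le> \<bar>y\<bar> powr s * exp \<bar>y\<bar>" by (intro mult_left_mono) auto
  ultimately show ?thesis by linarith
next
  case False
  have a: "\<bar>y\<bar> \<le> \<bar>y\<bar> powr s" using False assms powr_mono[of 1 s "\<bar>y\<bar>"] by simp
  then have b: "\<bar>y\<bar> * exp \<bar>y\<bar> \<le> \<bar>y\<bar> powr s * exp \<bar>y\<bar>" by (intro mult_right_mono) auto
  show ?thesis
  proof (cases "y \<ge> 0")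
    case True
    then have "exp y \<le> \<bar>y\<bar> * exp \<bar>y\<bar>" using False by simp
    with b True show ?thesis by linarith
  next
    case neg: False
    have "exp y \<le> 1" using neg by simp
    moreover have "\<bar>y\<bar> * 1 \<le> \<bar>y\<bar> * exp \<bar>y\<bar>" by (intro mult_left_mono) auto
    ultimately show ?thesis using b neg by linarith
  qed
qed

lemma exp_remainder_ge_2:
  fixes y s :: real
  assumes "2 \<le> s"
  shows "exp y \<le> 1 + y + (y\<^sup>2 + \<bar>y\<bar> powr s * exp \<bar>y\<bar>)"
proof (cases "\<bar>y\<bar> \<le> 1")
  case True
  have "exp y \<le> 1 + y + y\<^sup>2" by (rule exp_le_quadratic[OF True])
  moreover have "0 \<le> \<bar>y\<bar> powr s * exp \<bar>y\<bar>" by simp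
  ultimately show ?thesis by linarith
next
  case False
  have "exp y \<le> 1 + y + \<bar>y\<bar> powr 1 * exp \<bar>y\<bar>" by (rule exp_remainder_le_2) auto
  also have "\<bar>y\<bar> powr 1 * exp \<bar>y\<bar> \<le> \<bar>y\<bar> powr s * exp \<bar>y\<bar>"
    using False assms by (intro mult_right_mono powr_mono) auto
  finally show ?thesis by (smt (verit) zero_le_power2)
qed

definition cut_inner :: "'a::euclidean_space \<Rightarrow> real \<Rightarrow> 'a \<Rightarrow> real" where
  "cut_inner b t x = (if norm x \<le> t then b \<bullet> x else 0)"

lemma cut_inner_measurable [measurable]: "cut_inner b t \<in> borel_measurable borel"
  unfolding cut_inner_def by measurable

lemma abs_cut_inner: "norm b \<le> 1 \<Longrightarrow> \<bar>cut_inner b t x\<bar> \<le> norm x * indicator {..t} (norm x)"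
proof -
  assume "norm b \<le> 1"
  then have "norm b * norm x \<le> 1 * norm x" by (intro mult_right_mono) auto
  with Cauchy_Schwarz_ineq2[of b x] show ?thesis by (auto simp: cut_inner_def indicator_def)
qed

lemma abs_cut_inner_le: "norm b \<le> 1 \<Longrightarrow> t \<ge> 0 \<Longrightarrow> \<bar>cut_inner b t x\<bar> \<le> t"
  using abs_cut_inner[of b t x] by (cases "norm x \<le> t") (auto simp: cut_inner_def)

text \<open>
  The rows of independent copies of \<open>H 0\<close>, with truncation levels in the soft regime; the excess
  variables are added only at the end.
\<close>

locale regvar_row_sums = regvar_vector \<Omega> "H 0" \<mu> a \<alpha>
  for \<Omega> :: "'w measure" and H :: "nat \<Rightarrow> 'w \<Rightarrow> 'a::euclidean_space" and \<mu> a \<alpha> +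
  fixes M :: "nat \<Rightarrow> real"
  assumes H_meas [measurable]: "\<And>j. H j \<in> borel_measurable \<Omega>"
    and H_indep: "indep_vars (\<lambda>_. borel) H {1..}"
    and H_ident: "\<And>j. distr \<Omega> borel (H j) = distr \<Omega> borel (H 0)"
    and H_symmetric: "\<alpha> = 1 \<Longrightarrow> distr \<Omega> borel (H 0) = distr \<Omega> borel (\<lambda>\<omega>. - H 0 \<omega>)"
    and H_centered: "\<alpha> > 1 \<Longrightarrow> has_bochner_integral \<Omega> (H 0) 0"
    and M_pos: "\<And>n. n \<ge> 1 \<Longrightarrow> M n > 0"
    and M_lim: "filterlim M at_top sequentially"
    and soft: "(\<lambda>n. real n * tail \<Omega> (\<lambda>\<omega>. norm (H 0 \<omega>)) (M n)) \<longlonglongrightarrow> 0"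
    and M_growth_eq_2: "\<alpha> = 2 \<Longrightarrow>
         \<exists>\<gamma>>0. filterlim (\<lambda>n. M n / sqrt (real n powr (1 + \<gamma>))) at_top sequentially"
    and M_growth_gt_2: "\<alpha> > 2 \<Longrightarrow>
         filterlim (\<lambda>n. M n / sqrt (real n * ln (M n))) at_top sequentially"
begin

text \<open>
  The expected number of truncated variables, and the scale \<open>ell n = ln (1 / p n)\<close> in which the
  exponents of the Chernoff bounds are measured.
\<close>

definition p :: "nat \<Rightarrow> real" where "p n = real n * Q (M n)"
definition ell :: "nat \<Rightarrow> real" where "ell n = - ln (p n)"

lemma p_lim: "p \<longlonglongrightarrow> 0" using soft by (simp add: p_def[abs_def])

lemma p_pos: "n \<ge> 1 \<Longrightarrow> p n > 0" using Q_pos by (simp add: p_def)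

lemma p_at_right: "filterlim p (at_right 0) sequentially"
  unfolding filterlim_at using p_lim
  by (auto intro!: eventually_sequentiallyI[of 1] dest: p_pos)

lemma ell_at_top: "filterlim ell at_top sequentially"
proof -
  have "filterlim (\<lambda>x::real. - ln x) at_top (at_right 0)" by real_asymp
  from filterlim_compose[OF this p_at_right] show ?thesis by (simp add: ell_def[abs_def])
qed

lemma exp_ell: "n \<ge> 1 \<Longrightarrow> exp (- ell n) = p n" using p_pos[of n] by (simp add: ell_def)

lemma expectation_H:
  fixes f :: "'a \<Rightarrow> 'b::{banach, second_countable_topology}"
  shows "f \<in> borel_measurable borel \<Longrightarrow> (\<integral>\<omega>. f (H j \<omega>) \<partial>\<Omega>) = (\<integral>\<omega>. f (H 0 \<omega>) \<partial>\<Omega>)"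
  using integral_distr[of "H j" \<Omega> borel f] integral_distr[of "H 0" \<Omega> borel f] H_ident[of j] by simp

lemma chernoff:
  assumes b: "norm b \<le> 1" and t: "t \<ge> 0" and l: "\<theta> > 0"
    and B: "(\<integral>\<omega>. exp (\<theta> * cut_inner b t (H 0 \<omega>)) \<partial>\<Omega>) \<le> exp B"
  shows "prob {\<omega> \<in> space \<Omega>. (\<Sum>j=1..n. cut_inner b t (H j \<omega>)) \<ge> x} \<le> exp (real n * B - \<theta> * x)"
proof -
  let ?e = "\<lambda>j \<omega>. exp (\<theta> * cut_inner b t (H j \<omega>))"
  have em [measurable]: "(\<lambda>y. exp (\<theta> * cut_inner b t y)) \<in> borel_measurable borel" by measurable
  have ii: "integrable \<Omega> (?e j)" for j
    using abs_cut_inner_le[OF b t] l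
    by (intro integrable_const_bound[of _ "exp (\<theta> * t)"]) (auto simp: abs_le_iff)
  have ind: "indep_vars (\<lambda>_. borel) ?e {1..n}"
    by (rule indep_vars_compose2[OF indep_vars_subset[OF H_indep]]) auto
  have E: "expectation (\<lambda>\<omega>. \<Prod>j=1..n. ?e j \<omega>) = (\<Prod>j=1..n. expectation (?e j))"
    and I: "integrable \<Omega> (\<lambda>\<omega>. \<Prod>j=1..n. ?e j \<omega>)"
    by (rule indep_vars_lebesgue_integral[OF _ ind] indep_vars_integrable[OF _ ind]; simp add: ii)+
  have "{\<omega> \<in> space \<Omega>. (\<Sum>j=1..n. cut_inner b t (H j \<omega>)) \<ge> x} = {\<omega> \<in> space \<Omega>. (\<Prod>j=1..n. ?e j \<omega>) \<ge> exp (\<theta> * x)}"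
    using l by (auto simp: exp_sum[symmetric] sum_distrib_left[symmetric])
  also have "prob \<dots> \<le> expectation (\<lambda>\<omega>. \<Prod>j=1..n. ?e j \<omega>) / exp (\<theta> * x)"
    by (rule integral_Markov_inequality_measure[OF I, of "{}"]) (auto intro!: AE_I2 prod_nonneg)
  also have "\<dots> \<le> (\<Prod>j=1..n. exp B) / exp (\<theta> * x)"
    unfolding E
  proof (intro divide_right_mono prod_mono conjI)
    fix j
    show "expectation (?e j) \<le> exp B" using B unfolding expectation_H[OF em, of j] .
    show "0 \<le> expectation (?e j)" by (intro Bochner_Integration.integral_nonneg) simp
  qed simp
  also have "\<dots> = exp (real n * B - \<theta> * x)"
    by (simp add: exp_diff exp_of_nat_mult)
  finally show ?thesis .
qed

text \<open>
  The parameter \<open>\<kappa>\<close> switches the quadratic term on and off, so that the two estimates of the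
  exponential remainder are treated at once.
\<close>

lemma exp_moment:
  assumes b: "norm b \<le> 1" and t: "t \<ge> 0" and l: "\<theta> > 0"
    and ks: "\<kappa> = 0 \<and> 1 \<le> s \<and> s \<le> 2 \<or> \<kappa> = (1::real) \<and> 2 \<le> s"
  shows "(\<integral>\<omega>. exp (\<theta> * cut_inner b t (H 0 \<omega>)) \<partial>\<Omega>)
    \<le> exp (\<theta> * \<bar>\<integral>\<omega>. cut_inner b t (H 0 \<omega>) \<partial>\<Omega>\<bar> + (\<kappa> * \<theta>\<^sup>2 * trunc_moment \<Omega> (\<lambda>\<omega>. norm (H 0 \<omega>)) 2 t
        + \<theta> powr s * exp (\<theta> * t) * trunc_moment \<Omega> (\<lambda>\<omega>. norm (H 0 \<omega>)) s t))"
    (is "?L \<le> exp (_ + ?w)")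
proof -
  let ?c = "\<lambda>\<omega>. cut_inner b t (H 0 \<omega>)" and ?h = "\<lambda>s \<omega>. norm (H 0 \<omega>) powr s * indicator {..t} (norm (H 0 \<omega>))"
  have s0: "s > 0" using ks by auto
  have k0: "\<kappa> \<ge> 0" using ks by auto
  have em [measurable]: "(\<lambda>y. exp (\<theta> * cut_inner b t y)) \<in> borel_measurable borel" by measurable
  have i1: "integrable \<Omega> (\<lambda>\<omega>. exp (\<theta> * ?c \<omega>))"
    using abs_cut_inner_le[OF b t] l
    by (intro integrable_const_bound[of _ "exp (\<theta> * t)"]) (auto simp: abs_le_iff)
  have i2: "integrable \<Omega> ?c"
    using abs_cut_inner_le[OF b t] by (intro integrable_const_bound[of _ t]) auto
  have i3: "integrable \<Omega> (?h s)" if "s > 0" for s by (rule integrable_powr_trunc[OF that])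
  have pt: "exp (\<theta> * ?c \<omega>) \<le> 1 + \<theta> * ?c \<omega> + (\<kappa> * \<theta>\<^sup>2 * ?h 2 \<omega> + \<theta> powr s * exp (\<theta> * t) * ?h s \<omega>)" for \<omega>
  proof -
    let ?y = "\<theta> * ?c \<omega>"
    have c: "\<bar>?c \<omega>\<bar> \<le> norm (H 0 \<omega>) * indicator {..t} (norm (H 0 \<omega>))" by (rule abs_cut_inner[OF b])
    have cs: "\<bar>?c \<omega>\<bar> powr s \<le> ?h s \<omega>" if "s > 0" for s
    proof -
      have "\<bar>?c \<omega>\<bar> powr s \<le> (norm (H 0 \<omega>) * indicator {..t} (norm (H 0 \<omega>))) powr s"
        using c that by (intro powr_mono2) auto
      then show ?thesis by (auto simp: indicator_def split: if_splits)
    qed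
    have 1: "exp ?y \<le> 1 + ?y + (\<kappa> * ?y\<^sup>2 + \<bar>?y\<bar> powr s * exp \<bar>?y\<bar>)"
      using ks exp_remainder_le_2[of s ?y] exp_remainder_ge_2[of s ?y] by auto
    have 2: "?y\<^sup>2 \<le> \<theta>\<^sup>2 * ?h 2 \<omega>"
    proof -
      have "(?c \<omega>)\<^sup>2 = \<bar>?c \<omega>\<bar> powr 2" by (cases "?c \<omega> = 0") (auto simp: powr_numeral)
      moreover have "\<bar>?c \<omega>\<bar> powr 2 \<le> ?h 2 \<omega>" by (rule cs) simp
      ultimately have "(?c \<omega>)\<^sup>2 \<le> ?h 2 \<omega>" by (simp only:)
      then show ?thesis by (simp add: power_mult_distrib mult_left_mono)
    qed
    have 3: "\<bar>?y\<bar> powr s * exp \<bar>?y\<bar> \<le> (\<theta> powr s * ?h s \<omega>) * exp (\<theta> * t)"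
    proof (rule mult_mono)
      show "\<bar>?y\<bar> powr s \<le> \<theta> powr s * ?h s \<omega>"
        using cs[OF s0] l by (simp add: abs_mult powr_mult mult_left_mono)
      show "exp \<bar>?y\<bar> \<le> exp (\<theta> * t)"
        using abs_cut_inner_le[OF b t, of "H 0 \<omega>"] l by (simp add: abs_mult)
    qed (auto intro!: mult_nonneg_nonneg)
    have "\<kappa> * ?y\<^sup>2 \<le> \<kappa> * (\<theta>\<^sup>2 * ?h 2 \<omega>)" using 2 k0 by (rule mult_left_mono)
    with 1 3 show ?thesis by (simp add: mult_ac)
  qed
  have "?L \<le> (\<integral>\<omega>. 1 + \<theta> * ?c \<omega> + (\<kappa> * \<theta>\<^sup>2 * ?h 2 \<omega> + \<theta> powr s * exp (\<theta> * t) * ?h s \<omega>) \<partial>\<Omega>)"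
    by (intro integral_mono i1 pt Bochner_Integration.integrable_add integrable_mult_right i2 i3 s0) auto
  also have "\<dots> = 1 + \<theta> * (\<integral>\<omega>. ?c \<omega> \<partial>\<Omega>) + ?w"
    using i2 i3[of 2] i3[OF s0] by (simp add: trunc_moment_def prob_space)
  also have "\<dots> \<le> 1 + (\<theta> * \<bar>\<integral>\<omega>. ?c \<omega> \<partial>\<Omega>\<bar> + ?w)"
    using l by (simp add: mult_left_mono)
  also have "\<dots> \<le> exp (\<theta> * \<bar>\<integral>\<omega>. ?c \<omega> \<partial>\<Omega>\<bar> + ?w)"
    by (rule exp_ge_add_one_self)
  finally show ?thesis .
qed

lemma Q_M_compose: "c > 0 \<Longrightarrow> (\<lambda>n. Q (c * M n) / Q (M n)) \<longlonglongrightarrow> c powr (-\<alpha>)"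
  by (rule filterlim_compose[OF Q_regvar M_lim])

text \<open>
  Below index \<open>1\<close>, the truncated first moment at level \<open>M n\<close> is at most of order \<open>M n * Q (M n)\<close>. At index \<open>1\<close>
  the mean vanishes by symmetry. Above it, centering turns the truncated mean into minus the mean over
  the complementary event, for which the same bound holds.
\<close>

lemma drift_negligible:
  assumes b: "norm b \<le> 1" and d: "0 < \<delta>" "\<delta> \<le> 1"
  shows "(\<lambda>n. real n * \<bar>\<integral>\<omega>. cut_inner b (\<delta> * M n) (H 0 \<omega>) \<partial>\<Omega>\<bar> / M n) \<longlonglongrightarrow> 0"
proof -
  let ?h = "\<lambda>\<omega>. norm (H 0 \<omega>)"
  let ?E = "\<lambda>n. \<bar>\<integral>\<omega>. cut_inner b (\<delta> * M n) (H 0 \<omega>) \<partial>\<Omega>\<bar>"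
  have ic: "integrable \<Omega> (\<lambda>\<omega>. cut_inner b t (H 0 \<omega>))" if "t \<ge> 0" for t
    using abs_cut_inner_le[OF b that] by (intro integrable_const_bound[of _ t]) auto
  consider "\<alpha> < 1" | "\<alpha> = 1" | "\<alpha> > 1" by linarith
  then show ?thesis
  proof cases
    case 1
    obtain C t0 where C: "C > 0" "t0 > 0" "\<And>t. t \<ge> t0 \<Longrightarrow> trunc_moment \<Omega> ?h 1 t \<le> C * t powr 1 * Q t"
      using trunc_moment_above[of 1] 1 by auto
    show ?thesis
    proof (rule tendsto_sandwich[OF _ _ tendsto_const])
      show "(\<lambda>n. C * p n) \<longlonglongrightarrow> 0" using tendsto_mult_right_zero[OF p_lim] .
      show "\<forall>\<^sub>F n in sequentially. 0 \<le> real n * ?E n / M n"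
        using eventually_ge_at_top[of 1] by eventually_elim (use M_pos in \<open>auto intro!: divide_nonneg_pos\<close>)
      have "\<forall>\<^sub>F n in sequentially. M n \<ge> t0" using M_lim by (simp add: filterlim_at_top)
      then show "\<forall>\<^sub>F n in sequentially. real n * ?E n / M n \<le> C * p n"
        using eventually_ge_at_top[of 1]
      proof eventually_elim
        case (elim n)
        have Mp: "M n > 0" using elim M_pos by auto
        have "?E n \<le> (\<integral>\<omega>. ?h \<omega> powr 1 * indicator {..\<delta> * M n} (?h \<omega>) \<partial>\<Omega>)"
        proof (rule order_trans[OF integral_abs_bound], rule integral_mono)
          show "\<bar>cut_inner b (\<delta> * M n) (H 0 \<omega>)\<bar> \<le> ?h \<omega> powr 1 * indicator {..\<delta> * M n} (?h \<omega>)" for \<omega>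
            using abs_cut_inner[OF b] by simp
          show "integrable \<Omega> (\<lambda>\<omega>. \<bar>cut_inner b (\<delta> * M n) (H 0 \<omega>)\<bar>)"
            using d Mp by (intro integrable_abs ic) simp
          show "integrable \<Omega> (\<lambda>\<omega>. ?h \<omega> powr 1 * indicator {..\<delta> * M n} (?h \<omega>))"
            by (rule integrable_powr_trunc) simp
        qed
        also have "\<dots> \<le> trunc_moment \<Omega> ?h 1 (M n)"
          using trunc_moment_mono[of 1 "\<delta> * M n" "M n"] d Mp by (simp add: trunc_moment_def mult_le_cancel_right1)
        also have "\<dots> \<le> C * M n * Q (M n)" using C(3)[OF elim(1)] Mp by simp
        finally have "real n * ?E n \<le> real n * (C * M n * Q (M n))" by (rule mult_left_mono) simp
        then show ?case using Mp by (simp add: p_def divide_le_eq mult_ac)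
      qed
    qed
  next
    case 2
    have "(\<integral>\<omega>. cut_inner b t (H 0 \<omega>) \<partial>\<Omega>) = 0" for t
    proof -
      have "(\<integral>\<omega>. cut_inner b t (H 0 \<omega>) \<partial>\<Omega>) = (\<integral>x. cut_inner b t x \<partial>distr \<Omega> borel (H 0))"
        by (subst integral_distr) auto
      also have "\<dots> = (\<integral>x. cut_inner b t x \<partial>distr \<Omega> borel (\<lambda>\<omega>. - H 0 \<omega>))" using H_symmetric[OF 2] by simp
      also have "\<dots> = (\<integral>\<omega>. cut_inner b t (- H 0 \<omega>) \<partial>\<Omega>)" by (subst integral_distr) auto
      also have "\<dots> = (\<integral>\<omega>. - cut_inner b t (H 0 \<omega>) \<partial>\<Omega>)"
        by (intro Bochner_Integration.integral_cong) (auto simp: cut_inner_def)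
      also have "\<dots> = - (\<integral>\<omega>. cut_inner b t (H 0 \<omega>) \<partial>\<Omega>)" by simp
      finally show ?thesis by simp
    qed
    then show ?thesis by simp
  next
    case 3
    have iH: "integrable \<Omega> (H 0)" and EH: "(\<integral>\<omega>. H 0 \<omega> \<partial>\<Omega>) = 0"
      using H_centered[OF 3] by (auto simp: has_bochner_integral_iff)
    have ih: "integrable \<Omega> ?h" using iH by simp
    obtain C t0 where C: "C > 0" "t0 > 0" "\<And>t. t \<ge> t0 \<Longrightarrow> (\<integral>\<omega>. ?h \<omega> * indicator {t<..} (?h \<omega>) \<partial>\<Omega>) \<le> C * t * Q t"
      using expectation_above[OF 3 ih] by blast
    have ii: "integrable \<Omega> (\<lambda>\<omega>. ?h \<omega> * indicator {t<..} (?h \<omega>))" for t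
      by (rule Bochner_Integration.integrable_bound[OF ih]) (auto simp: indicator_def)
    show ?thesis
    proof (rule tendsto_sandwich[OF _ _ tendsto_const])
      have "(\<lambda>n. C * \<delta> * (p n * (Q (\<delta> * M n) / Q (M n)))) \<longlonglongrightarrow> C * \<delta> * (0 * \<delta> powr (-\<alpha>))"
        by (intro tendsto_intros p_lim Q_M_compose d)
      then show "(\<lambda>n. C * \<delta> * (p n * (Q (\<delta> * M n) / Q (M n)))) \<longlonglongrightarrow> 0" by simp
      show "\<forall>\<^sub>F n in sequentially. 0 \<le> real n * ?E n / M n"
        using eventually_ge_at_top[of 1] by eventually_elim (use M_pos in \<open>auto intro!: divide_nonneg_pos\<close>)
      have "\<forall>\<^sub>F n in sequentially. M n \<ge> t0 / \<delta>" using M_lim by (simp add: filterlim_at_top)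
      then show "\<forall>\<^sub>F n in sequentially. real n * ?E n / M n \<le> C * \<delta> * (p n * (Q (\<delta> * M n) / Q (M n)))"
        using eventually_ge_at_top[of 1]
      proof eventually_elim
        case (elim n)
        have Mp: "M n > 0" using elim M_pos by auto
        have t: "\<delta> * M n \<ge> t0" using elim(1) d by (simp add: field_simps)
        have "(\<integral>\<omega>. cut_inner b (\<delta> * M n) (H 0 \<omega>) \<partial>\<Omega>)
          = (\<integral>\<omega>. b \<bullet> H 0 \<omega> - (b \<bullet> H 0 \<omega>) * indicator {\<delta> * M n<..} (?h \<omega>) \<partial>\<Omega>)"
          by (intro Bochner_Integration.integral_cong) (auto simp: cut_inner_def indicator_def)
        also have "\<dots> = (\<integral>\<omega>. b \<bullet> H 0 \<omega> \<partial>\<Omega>) - (\<integral>\<omega>. (b \<bullet> H 0 \<omega>) * indicator {\<delta> * M n<..} (?h \<omega>) \<partial>\<Omega>)"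
        proof (rule Bochner_Integration.integral_diff)
          show ib: "integrable \<Omega> (\<lambda>\<omega>. b \<bullet> H 0 \<omega>)" using iH by simp
          show "integrable \<Omega> (\<lambda>\<omega>. (b \<bullet> H 0 \<omega>) * indicator {\<delta> * M n<..} (?h \<omega>))"
            by (rule Bochner_Integration.integrable_bound[OF ib]) (auto simp: indicator_def)
        qed
        also have "(\<integral>\<omega>. b \<bullet> H 0 \<omega> \<partial>\<Omega>) = 0" using iH EH by (simp add: integral_inner_right)
        finally have "?E n = \<bar>\<integral>\<omega>. (b \<bullet> H 0 \<omega>) * indicator {\<delta> * M n<..} (?h \<omega>) \<partial>\<Omega>\<bar>" by simp
        also have "\<dots> \<le> (\<integral>\<omega>. ?h \<omega> * indicator {\<delta> * M n<..} (?h \<omega>) \<partial>\<Omega>)"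
        proof (rule order_trans[OF integral_abs_bound], rule integral_mono)
          show "integrable \<Omega> (\<lambda>\<omega>. \<bar>(b \<bullet> H 0 \<omega>) * indicator {\<delta> * M n<..} (?h \<omega>)\<bar>)"
          proof (rule integrable_abs, rule Bochner_Integration.integrable_bound)
            show "integrable \<Omega> (\<lambda>\<omega>. b \<bullet> H 0 \<omega>)" using iH by simp
          qed (auto simp: indicator_def)
          fix \<omega>
          have "\<bar>b \<bullet> H 0 \<omega>\<bar> \<le> norm b * ?h \<omega>" by (rule Cauchy_Schwarz_ineq2)
          also have "\<dots> \<le> 1 * ?h \<omega>" using b by (intro mult_right_mono) auto
          finally show "\<bar>(b \<bullet> H 0 \<omega>) * indicator {\<delta> * M n<..} (?h \<omega>)\<bar> \<le> ?h \<omega> * indicator {\<delta> * M n<..} (?h \<omega>)"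
            by (auto simp: indicator_def)
        qed (rule ii)
        also have "\<dots> \<le> C * (\<delta> * M n) * Q (\<delta> * M n)" by (rule C(3)[OF t])
        finally have "real n * ?E n \<le> real n * (C * (\<delta> * M n) * Q (\<delta> * M n))" by (rule mult_left_mono) simp
        then show ?case using Mp Q_pos[of "M n"] by (simp add: p_def divide_le_eq mult_ac)
      qed
    qed
  qed
qed

abbreviation tm :: "real \<Rightarrow> real \<Rightarrow> real" where "tm \<equiv> trunc_moment \<Omega> (\<lambda>\<omega>. norm (H 0 \<omega>))"

lemma tm_nonneg: "tm s t \<ge> 0"
  unfolding trunc_moment_def by (intro Bochner_Integration.integral_nonneg) auto

section \<open>Small jumps\<close>

text \<open>
  The tail decays no faster than a power of \<open>M n\<close>. Consequently a factor \<open>exp (c * ell n)\<close> costs at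
  most a power of \<open>M n\<close>, with an exponent proportional to \<open>c\<close>.
\<close>

lemma ell_le_ln: "\<forall>\<^sub>F n in sequentially. ell n \<le> (\<alpha> + 2) * ln (M n)"
proof -
  obtain c t0 where c: "c > 0" "t0 > 0" "\<And>t. t \<ge> t0 \<Longrightarrow> c * t powr (- (\<alpha> + 1)) \<le> Q t"
    using Q_lower[of "\<alpha> + 1"] alpha_pos by auto
  have "filterlim (\<lambda>n. ln (M n)) at_top sequentially" by (rule filterlim_compose[OF ln_at_top M_lim])
  then have "\<forall>\<^sub>F n in sequentially. ln (M n) \<ge> - ln c" by (simp add: filterlim_at_top)
  moreover have "\<forall>\<^sub>F n in sequentially. M n \<ge> t0" using M_lim by (simp add: filterlim_at_top)
  ultimately show ?thesis using eventually_ge_at_top[of 1]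
  proof eventually_elim
    case (elim n)
    have Mp: "M n > 0" using elim M_pos by auto
    have "c * M n powr (- (\<alpha> + 1)) \<le> 1 * Q (M n)" using c(3)[OF elim(2)] by simp
    also have "\<dots> \<le> p n" unfolding p_def using elim Q_nonneg by (intro mult_right_mono) auto
    finally have "ln (c * M n powr (- (\<alpha> + 1))) \<le> ln (p n)"
      using c(1) Mp p_pos[OF elim(3)] by (subst ln_le_cancel_iff) auto
    then have "ell n \<le> - ln c + (\<alpha> + 1) * ln (M n)"
      using c(1) Mp by (simp add: ell_def ln_mult ln_powr algebra_simps)
    also have "\<dots> \<le> ln (M n) + (\<alpha> + 1) * ln (M n)" using elim(1) by simp
    finally show ?case by (simp add: algebra_simps)
  qed
qed

text \<open>
  With \<open>n\<close> of order at most \<open>M n powr r\<close> and bounded moments of order \<open>s > r\<close>, there is a power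
  \<open>M n powr (s - r)\<close> to spare. The exponential takes at most half of it if \<open>\<delta>\<close> is small, and the rest
  outweighs the logarithms.
\<close>

lemma high_moment_negligible:
  assumes rs: "r < s" "s > 0" and D: "\<And>t. tm s t \<le> D"
    and growth: "\<forall>\<^sub>F n in sequentially. real n \<le> M n powr r"
    and A: "A > 0" and d: "\<delta> > 0" "\<delta> * (A * (\<alpha> + 2)) \<le> (s - r) / 2"
  shows "(\<lambda>n. real n * ((A * ell n / M n) powr s * exp (A * ell n / M n * (\<delta> * M n)) * tm s (\<delta> * M n))) \<longlonglongrightarrow> 0"
proof (rule tendsto_sandwich[OF _ _ tendsto_const])
  let ?B = "\<alpha> + 2" and ?q = "(s - r) / 2"
  have B: "?B > 0" using alpha_pos by simp
  have D0: "D \<ge> 0" using D[of 0] tm_nonneg[of s 0] by linarith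
  have q: "?q > 0" using rs by simp
  have "((\<lambda>x. ln x powr s * x powr (- ?q)) \<longlongrightarrow> 0) at_top" using rs(2) q
    by real_asymp
  from filterlim_compose[OF this M_lim]
  have "(\<lambda>n. ln (M n) powr s * M n powr (- ?q)) \<longlonglongrightarrow> 0" .
  from tendsto_mult_right_zero[OF this, of "(A * ?B) powr s * D"]
  show "(\<lambda>n. (A * ?B) powr s * D * (ln (M n) powr s * M n powr (- ?q))) \<longlonglongrightarrow> 0" .
  show "\<forall>\<^sub>F n in sequentially. 0 \<le> real n * ((A * ell n / M n) powr s * exp (A * ell n / M n * (\<delta> * M n)) * tm s (\<delta> * M n))"
    by (intro always_eventually allI mult_nonneg_nonneg tm_nonneg) auto
  have "\<forall>\<^sub>F n in sequentially. M n \<ge> 1" using M_lim by (simp add: filterlim_at_top)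
  moreover have "\<forall>\<^sub>F n in sequentially. ell n > 0" using ell_at_top by (simp add: filterlim_at_top_dense)
  moreover note ell_le_ln growth
  ultimately show "\<forall>\<^sub>F n in sequentially. real n * ((A * ell n / M n) powr s * exp (A * ell n / M n * (\<delta> * M n)) * tm s (\<delta> * M n))
     \<le> (A * ?B) powr s * D * (ln (M n) powr s * M n powr (- ?q))"
  proof eventually_elim
    case (elim n)
    have M: "M n > 0" using elim by simp
    have l: "ln (M n) \<ge> 0" using elim by simp
    have "(A * ell n / M n) powr s \<le> (A * (?B * ln (M n)) / M n) powr s"
      using elim A M rs by (intro powr_mono2 divide_right_mono mult_left_mono) auto
    also have "\<dots> = (A * ?B) powr s * ln (M n) powr s * M n powr (-s)"
    proof -
      have "(c * l / x) powr s = c powr s * l powr s * x powr (-s)" if "c \<ge> 0" "l \<ge> 0" "x > 0" for c l x :: real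
        using that by (simp add: powr_divide powr_mult powr_minus_divide)
      from this[of "A * ?B" "ln (M n)" "M n"] show ?thesis using A B M l by (simp only: mult.assoc) simp
    qed
    finally have 1: "(A * ell n / M n) powr s \<le> (A * ?B) powr s * ln (M n) powr s * M n powr (-s)" .
    have "A * ell n / M n * (\<delta> * M n) = (\<delta> * A) * ell n" using M by simp
    also have "\<dots> \<le> (\<delta> * A) * (?B * ln (M n))" using elim A d by (intro mult_left_mono) auto
    also have "\<dots> = (\<delta> * (A * ?B)) * ln (M n)" by simp
    also have "\<dots> \<le> ?q * ln (M n)" using d l by (intro mult_right_mono) auto
    finally have 2: "exp (A * ell n / M n * (\<delta> * M n)) \<le> M n powr ?q" using M by (simp add: powr_def)
    have "(A * ell n / M n) powr s * exp (A * ell n / M n * (\<delta> * M n)) * tm s (\<delta> * M n)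
       \<le> ((A * ?B) powr s * ln (M n) powr s * M n powr (-s)) * M n powr ?q * D"
      by (intro mult_mono 1 2 D) (auto simp: tm_nonneg intro!: mult_nonneg_nonneg)
    then have "real n * ((A * ell n / M n) powr s * exp (A * ell n / M n * (\<delta> * M n)) * tm s (\<delta> * M n))
       \<le> M n powr r * (((A * ?B) powr s * ln (M n) powr s * M n powr (-s)) * M n powr ?q * D)"
      by (intro mult_mono[OF elim(4)]) (auto simp: tm_nonneg intro!: mult_nonneg_nonneg)
    also have "\<dots> = (A * ?B) powr s * D * (ln (M n) powr s * (M n powr r * M n powr (-s) * M n powr ?q))" by simp
    also have "M n powr r * M n powr (-s) * M n powr ?q = M n powr (- ?q)"
    proof -
      have "r + (- s) + ?q = - ?q" by (simp add: field_simps)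
      then show ?thesis by (simp only: powr_add[symmetric])
    qed
    finally show ?case .
  qed
qed

lemma eventually_le_mult_ell:
  assumes "f \<longlonglongrightarrow> 0" "c > 0" shows "\<forall>\<^sub>F n in sequentially. f n \<le> c * ell n"
proof -
  have "\<forall>\<^sub>F n in sequentially. f n < 1" using order_tendstoD(2)[OF assms(1), of 1] by simp
  moreover have "\<forall>\<^sub>F n in sequentially. ell n \<ge> 1 / c" using ell_at_top by (simp add: filterlim_at_top)
  ultimately show ?thesis by eventually_elim (use assms(2) in \<open>simp add: field_simps\<close>)
qed

text \<open>
  The heart of the matter: the exponential moments cost only a fraction of \<open>ell n\<close>, if the small
  jumps are cut at a small multiple of \<open>M n\<close>. For \<open>\<alpha> < 2\<close> the truncated second moment is at most of order
  \<open>(M n)\<^sup>2 * Q (M n)\<close>, which yields a factor \<open>p n\<close> that absorbs everything else. For \<open>\<alpha> = 2\<close> the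
  second moment may be infinite; the surplus \<open>\<gamma>\<close> in the growth of \<open>M n\<close> leaves room for an order
  \<open>s < 2\<close>. For \<open>\<alpha> > 2\<close> there is a finite moment of some order \<open>s > 2\<close>, and \<open>n\<close> is at most of order
  \<open>(M n)\<^sup>2\<close>; what remains is the quadratic term, of size \<open>ell n\<close> times \<open>n * ell n / (M n)\<^sup>2\<close>, and this
  is where \<open>M n\<close> has to dominate \<open>sqrt (n * ln (M n))\<close>.
\<close>

lemma exponent_small:
  assumes A: "A > 0"
  obtains \<delta>0 \<kappa> s where "\<delta>0 > 0" "\<kappa> = 0 \<and> 1 \<le> s \<and> s \<le> 2 \<or> \<kappa> = (1::real) \<and> 2 \<le> s"
    "\<And>\<delta>. 0 < \<delta> \<Longrightarrow> \<delta> \<le> \<delta>0 \<Longrightarrow> \<forall>\<^sub>F n in sequentially.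
       real n * (\<kappa> * (A * ell n / M n)\<^sup>2 * tm 2 (\<delta> * M n)
          + (A * ell n / M n) powr s * exp (A * ell n / M n * (\<delta> * M n)) * tm s (\<delta> * M n)) \<le> ell n / 2"
proof -
  have B: "\<alpha> + 2 > 0" using alpha_pos by simp
  have half: "\<delta> * c \<le> x / 2" if "\<delta> \<le> x / (2 * c)" "c > 0" for \<delta> c x :: real
    using that by (simp add: field_simps)
  have ev1: "\<forall>\<^sub>F n in sequentially. ell n > 0" using ell_at_top by (simp add: filterlim_at_top_dense)
  have ev2: "\<forall>\<^sub>F n in sequentially. M n \<ge> exp 1" using M_lim by (simp add: filterlim_at_top)
  consider "\<alpha> < 2" | "\<alpha> = 2" | "\<alpha> > 2" by linarith
  then show ?thesis
  proof cases
    case 1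
    obtain C t0 where C: "C > 0" "t0 > 0" "\<And>t. t \<ge> t0 \<Longrightarrow> tm 2 t \<le> C * t powr 2 * Q t"
      using trunc_moment_above[of 2] 1 by auto
    show ?thesis
    proof (rule that[of "min 1 (1 / (2 * A))" 0 2])
      fix \<delta> assume d: "0 < \<delta>" "\<delta> \<le> min 1 (1 / (2 * A))"
      have dA: "\<delta> * A \<le> 1 / 2" using d A by (simp add: field_simps)
      have "((\<lambda>x::real. (- ln x)\<^sup>2 * x powr (1/2)) \<longlongrightarrow> 0) (at_right 0)" by real_asymp
      from filterlim_compose[OF this p_at_right]
      have "(\<lambda>n. (ell n)\<^sup>2 * p n powr (1/2)) \<longlonglongrightarrow> 0" by (simp add: ell_def)
      from eventually_le_mult_ell[OF tendsto_mult_right_zero[OF this, of "A\<^sup>2 * C"], of "1/2"]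
      have "\<forall>\<^sub>F n in sequentially. A\<^sup>2 * C * ((ell n)\<^sup>2 * p n powr (1/2)) \<le> 1/2 * ell n" by simp
      moreover have "\<forall>\<^sub>F n in sequentially. M n \<ge> t0" using M_lim by (simp add: filterlim_at_top)
      ultimately show "\<forall>\<^sub>F n in sequentially. real n * (0 * (A * ell n / M n)\<^sup>2 * tm 2 (\<delta> * M n)
          + (A * ell n / M n) powr 2 * exp (A * ell n / M n * (\<delta> * M n)) * tm 2 (\<delta> * M n)) \<le> ell n / 2"
        using ev1 eventually_ge_at_top[of 1]
      proof eventually_elim
        case (elim n)
        have Mp: "M n > 0" using elim M_pos by auto
        have pp: "p n > 0" using p_pos elim by simp
        have a: "(A * ell n / M n) powr 2 = A\<^sup>2 * (ell n)\<^sup>2 / (M n)\<^sup>2"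
          using A elim Mp by (simp add: powr_numeral power_mult_distrib power_divide)
        have "A * ell n / M n * (\<delta> * M n) = (\<delta> * A) * ell n" using Mp by simp
        also have "\<dots> \<le> 1/2 * ell n" using dA elim by (intro mult_right_mono) auto
        finally have b: "exp (A * ell n / M n * (\<delta> * M n)) \<le> p n powr (-1/2)"
          using pp by (simp add: powr_def ell_def)
        have "tm 2 (\<delta> * M n) \<le> tm 2 (M n)" using d Mp by (intro trunc_moment_mono) (auto simp: mult_le_cancel_right1)
        also have "\<dots> \<le> C * (M n)\<^sup>2 * Q (M n)" using C(3)[OF elim(2)] Mp by (simp add: powr_numeral)
        finally have c: "tm 2 (\<delta> * M n) \<le> C * (M n)\<^sup>2 * Q (M n)" .
        have "real n * ((A * ell n / M n) powr 2 * exp (A * ell n / M n * (\<delta> * M n)) * tm 2 (\<delta> * M n))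
          \<le> real n * ((A\<^sup>2 * (ell n)\<^sup>2 / (M n)\<^sup>2) * p n powr (-1/2) * (C * (M n)\<^sup>2 * Q (M n)))"
          unfolding a by (intro mult_left_mono mult_mono b c) (auto simp: tm_nonneg)
        also have "\<dots> = A\<^sup>2 * C * ((ell n)\<^sup>2 * (p n powr (-1/2) * p n))" using Mp by (simp add: p_def)
        also have "p n powr (-1/2) * p n = p n powr (1/2)"
          using pp powr_add[of "p n" "-1/2" 1] by simp
        finally show ?case using elim by simp
      qed
    qed (use A in auto)
  next
    case 2
    obtain \<gamma> where g: "\<gamma> > 0" "filterlim (\<lambda>n. M n / sqrt (real n powr (1 + \<gamma>))) at_top sequentially"
      using M_growth_eq_2[OF 2] by blast
    \<comment> \<open>The growth condition says that \<open>n \<le> M n powr r\<close> in the end.\<close>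
    define r where "r = 2 / (1 + \<gamma>)"
    have r: "0 < r" "r < 2" using g by (auto simp: r_def field_simps)
    define s where "s = max 1 ((r + 2) / 2)"
    have s: "1 \<le> s" "s < 2" "r < s" using r by (auto simp: s_def)
    obtain D where D: "\<And>t. tm s t \<le> D" using trunc_moment_below[of s] s 2 by auto
    have "\<forall>\<^sub>F n in sequentially. M n / sqrt (real n powr (1 + \<gamma>)) \<ge> 1" using g by (simp add: filterlim_at_top)
    then have gr: "\<forall>\<^sub>F n in sequentially. real n \<le> M n powr r" using eventually_ge_at_top[of 1]
    proof eventually_elim
      case (elim n)
      have "sqrt (real n powr (1 + \<gamma>)) > 0" using elim by simp
      then have "sqrt (real n powr (1 + \<gamma>)) \<le> M n" using elim(1) by (simp add: le_divide_eq)
      then have "real n powr ((1 + \<gamma>) / 2) \<le> M n" by (simp add: powr_half_sqrt[symmetric] powr_powr)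
      then have "(real n powr ((1 + \<gamma>) / 2)) powr r \<le> M n powr r" using r by (intro powr_mono2) auto
      moreover have "(1 + \<gamma>) / 2 * r = 1" using g by (simp add: r_def)
      ultimately show ?case using elim by (simp add: powr_powr)
    qed
    show ?thesis
    proof (rule that[of "(s - r) / (2 * (A * (\<alpha> + 2)))" 0 s])
      fix \<delta> assume d: "0 < \<delta>" "\<delta> \<le> (s - r) / (2 * (A * (\<alpha> + 2)))"
      have d2: "\<delta> * (A * (\<alpha> + 2)) \<le> (s - r) / 2" by (rule half[OF d(2)]) (use A B in simp)
      show "\<forall>\<^sub>F n in sequentially. real n * (0 * (A * ell n / M n)\<^sup>2 * tm 2 (\<delta> * M n)
          + (A * ell n / M n) powr s * exp (A * ell n / M n * (\<delta> * M n)) * tm s (\<delta> * M n)) \<le> ell n / 2"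
        using eventually_le_mult_ell[OF high_moment_negligible[OF s(3) _ D gr A d(1) d2], of "1/2"] s by simp
    qed (use s A B in auto)
  next
    case 3
    define s where "s = (2 + \<alpha>) / 2"
    have s: "2 < s" "s < \<alpha>" using 3 by (auto simp: s_def)
    obtain D where D: "\<And>t. tm s t \<le> D" using trunc_moment_below[of s] s by auto
    obtain D2 where D2: "D2 > 0" "\<And>t. tm 2 t \<le> D2" using trunc_moment_below[of 2] 3 by auto
    \<comment> \<open>With this \<open>K\<close>, the condition \<open>M n \<ge> K * sqrt (n * ln (M n))\<close> bounds the quadratic term by \<open>ell n / 4\<close>.\<close>
    define K where "K = max 1 (sqrt (4 * (A\<^sup>2 * (D2 * (\<alpha> + 2)))))"
    have K: "K \<ge> 1" "4 * (A\<^sup>2 * (D2 * (\<alpha> + 2))) \<le> K\<^sup>2"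
    proof -
      have "sqrt (4 * (A\<^sup>2 * (D2 * (\<alpha> + 2)))) \<le> K" by (simp add: K_def)
      then have "(sqrt (4 * (A\<^sup>2 * (D2 * (\<alpha> + 2)))))\<^sup>2 \<le> K\<^sup>2" using D2 B by (intro power_mono) auto
      then show "4 * (A\<^sup>2 * (D2 * (\<alpha> + 2))) \<le> K\<^sup>2" using D2 B by simp
    qed (simp add: K_def)
    have evK: "\<forall>\<^sub>F n in sequentially. K\<^sup>2 * (real n * ln (M n)) \<le> (M n)\<^sup>2"
    proof -
      have "\<forall>\<^sub>F n in sequentially. M n / sqrt (real n * ln (M n)) \<ge> K"
        using M_growth_gt_2[OF 3] by (simp add: filterlim_at_top)
      then show ?thesis using ev2
      proof eventually_elim
        case (elim n)
        have l: "ln (M n) \<ge> 0" using elim(2) by (smt (verit) exp_gt_one ln_ge_zero)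
        have nl: "real n * ln (M n) \<ge> 0" using l by simp
        have "sqrt (real n * ln (M n)) > 0"
        proof (rule ccontr)
          assume "\<not> ?thesis"
          then have "sqrt (real n * ln (M n)) = 0" using real_sqrt_ge_zero[OF nl] by linarith
          with elim K show False by simp
        qed
        then have "K * sqrt (real n * ln (M n)) \<le> M n" using elim(1) by (simp add: pos_le_divide_eq)
        then have "(K * sqrt (real n * ln (M n)))\<^sup>2 \<le> (M n)\<^sup>2" using K nl by (intro power_mono) auto
        then show ?case using nl by (simp add: power_mult_distrib)
      qed
    qed
    have gr: "\<forall>\<^sub>F n in sequentially. real n \<le> M n powr 2" using evK ev2
    proof eventually_elim
      case (elim n)
      have l: "ln (M n) \<ge> 1" using elim(2) by (subst ln_ge_iff) (auto intro: less_le_trans[OF exp_gt_zero])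
      have "1 * (real n * 1) \<le> K\<^sup>2 * (real n * ln (M n))"
        using K l by (intro mult_mono) auto
      moreover have "M n > 0" using elim(2) less_le_trans[OF exp_gt_zero] by blast
      ultimately show ?case using elim by (simp add: powr_numeral)
    qed
    show ?thesis
    proof (rule that[of "(s - 2) / (2 * (A * (\<alpha> + 2)))" 1 s])
      fix \<delta> assume d: "0 < \<delta>" "\<delta> \<le> (s - 2) / (2 * (A * (\<alpha> + 2)))"
      have d2: "\<delta> * (A * (\<alpha> + 2)) \<le> (s - 2) / 2" by (rule half[OF d(2)]) (use A B in simp)
      have "\<forall>\<^sub>F n in sequentially. real n * ((A * ell n / M n) powr s * exp (A * ell n / M n * (\<delta> * M n)) * tm s (\<delta> * M n)) \<le> 1/4 * ell n"
        by (rule eventually_le_mult_ell[OF high_moment_negligible[OF s(1) _ D gr A d(1) d2], of "1/4"]) (use s in auto)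
      then show "\<forall>\<^sub>F n in sequentially. real n * (1 * (A * ell n / M n)\<^sup>2 * tm 2 (\<delta> * M n)
          + (A * ell n / M n) powr s * exp (A * ell n / M n * (\<delta> * M n)) * tm s (\<delta> * M n)) \<le> ell n / 2"
        using evK ev1 ev2 ell_le_ln
      proof eventually_elim
        case (elim n)
        have Mp: "M n > 0" using elim(4) less_le_trans[OF exp_gt_zero] by blast
        have "real n * ell n \<le> real n * ((\<alpha> + 2) * ln (M n))" using elim(5) by (rule mult_left_mono) simp
        then have "K\<^sup>2 * (real n * ell n) \<le> K\<^sup>2 * (real n * ((\<alpha> + 2) * ln (M n)))" by (rule mult_left_mono) simp
        also have "\<dots> = (\<alpha> + 2) * (K\<^sup>2 * (real n * ln (M n)))" by simp
        also have "\<dots> \<le> (\<alpha> + 2) * (M n)\<^sup>2" using elim B by (intro mult_left_mono) auto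
        finally have kn: "K\<^sup>2 * (real n * ell n) \<le> (\<alpha> + 2) * (M n)\<^sup>2" .
        have "4 * (A\<^sup>2 * (D2 * (\<alpha> + 2))) * (real n * ell n) \<le> K\<^sup>2 * (real n * ell n)"
          using elim by (intro mult_right_mono K) auto
        also note kn
        finally have "4 * (A\<^sup>2 * D2 * (real n * ell n)) * (\<alpha> + 2) \<le> (M n)\<^sup>2 * (\<alpha> + 2)" by (simp add: mult_ac)
        then have x: "4 * (A\<^sup>2 * D2 * (real n * ell n)) \<le> (M n)\<^sup>2" using B by (rule mult_right_le_imp_le)
        have "real n * ((A * ell n / M n)\<^sup>2 * tm 2 (\<delta> * M n)) \<le> real n * ((A * ell n / M n)\<^sup>2 * D2)"
          by (intro mult_left_mono D2) auto
        also have "\<dots> = (A\<^sup>2 * D2 * (real n * ell n)) * ell n / (M n)\<^sup>2"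
          by (simp add: power2_eq_square)
        also have "\<dots> \<le> ((M n)\<^sup>2 / 4) * ell n / (M n)\<^sup>2"
          using x elim by (intro divide_right_mono mult_right_mono) auto
        also have "\<dots> = 1/4 * ell n" using Mp by simp
        finally have "real n * ((A * ell n / M n)\<^sup>2 * tm 2 (\<delta> * M n)) \<le> 1/4 * ell n" .
        with elim(1) show ?case by (simp add: distrib_left)
      qed
    qed (use s A B in auto)
  qed
qed

text \<open>
  In the Chernoff bound with exponent \<open>A * ell n / M n\<close>, the level \<open>\<epsilon> * M n\<close> contributes
  \<open>A * \<epsilon> * ell n = (k + 2) * ell n\<close>, while drift and exponential moments take at most \<open>ell n / 2\<close> each.
  The remaining \<open>(k + 1) * ell n\<close> is the logarithm of the bound.
\<close>

lemma small_jumps_directional: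
  assumes e: "\<epsilon> > 0" and h: "\<eta> > 0"
  obtains \<delta> where "0 < \<delta>" "\<delta> < \<eta>" "\<delta> \<le> 1"
    "\<And>b. norm b \<le> 1 \<Longrightarrow> \<forall>\<^sub>F n in sequentially.
       prob {\<omega> \<in> space \<Omega>. (\<Sum>j=1..n. cut_inner b (\<delta> * M n) (H j \<omega>)) \<ge> \<epsilon> * M n} \<le> p n ^ (k + 1)"
proof -
  define A where "A = (real k + 2) / \<epsilon>"
  have A: "A > 0" using e by (auto simp: A_def)
  obtain \<delta>0 \<kappa> s where es: "\<delta>0 > 0" "\<kappa> = 0 \<and> 1 \<le> s \<and> s \<le> 2 \<or> \<kappa> = (1::real) \<and> 2 \<le> s"
    "\<And>\<delta>. 0 < \<delta> \<Longrightarrow> \<delta> \<le> \<delta>0 \<Longrightarrow> \<forall>\<^sub>F n in sequentially.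
       real n * (\<kappa> * (A * ell n / M n)\<^sup>2 * tm 2 (\<delta> * M n)
          + (A * ell n / M n) powr s * exp (A * ell n / M n * (\<delta> * M n)) * tm s (\<delta> * M n)) \<le> ell n / 2"
    using exponent_small[OF A] by blast
  define \<delta> where "\<delta> = min (min \<delta>0 1) (\<eta> / 2)"
  have d: "0 < \<delta>" "\<delta> < \<eta>" "\<delta> \<le> 1" "\<delta> \<le> \<delta>0" using es(1) h by (auto simp: \<delta>_def min_less_iff_disj)
  show ?thesis
  proof (rule that[OF d(1-3)])
    fix b :: 'a assume b: "norm b \<le> 1"
    let ?E = "\<lambda>n. \<bar>\<integral>\<omega>. cut_inner b (\<delta> * M n) (H 0 \<omega>) \<partial>\<Omega>\<bar>"
    have "\<forall>\<^sub>F n in sequentially. real n * ?E n / M n < 1 / (2 * A)"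
      using order_tendstoD(2)[OF drift_negligible[OF b d(1,3)], of "1 / (2 * A)"] A by simp
    moreover have "\<forall>\<^sub>F n in sequentially. ell n > 0" using ell_at_top by (simp add: filterlim_at_top_dense)
    moreover note es(3)[OF d(1,4)] eventually_ge_at_top[of 1]
    ultimately show "\<forall>\<^sub>F n in sequentially.
       prob {\<omega> \<in> space \<Omega>. (\<Sum>j=1..n. cut_inner b (\<delta> * M n) (H j \<omega>)) \<ge> \<epsilon> * M n} \<le> p n ^ (k + 1)"
    proof eventually_elim
      case (elim n)
      have Mp: "M n > 0" using elim M_pos by auto
      let ?t = "\<delta> * M n" and ?l = "A * ell n / M n"
      have t: "?t \<ge> 0" and l: "?l > 0" using d Mp A elim by auto
      let ?w = "\<kappa> * ?l\<^sup>2 * tm 2 ?t + ?l powr s * exp (?l * ?t) * tm s ?t"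
      have "prob {\<omega> \<in> space \<Omega>. (\<Sum>j=1..n. cut_inner b ?t (H j \<omega>)) \<ge> \<epsilon> * M n}
         \<le> exp (real n * (?l * ?E n + ?w) - ?l * (\<epsilon> * M n))"
        by (rule chernoff[OF b t l exp_moment[OF b t l es(2)]])
      also have "\<dots> \<le> exp (real (k + 1) * (- ell n))"
      proof -
        have "real n * (?l * ?E n) = A * ell n * (real n * ?E n / M n)" by simp
        also have "\<dots> \<le> A * ell n * (1 / (2 * A))" using elim A by (intro mult_left_mono) auto
        also have "\<dots> = ell n / 2" using A by simp
        finally have 1: "real n * (?l * ?E n) \<le> ell n / 2" .
        have "?l * (\<epsilon> * M n) = (real k + 2) * ell n" using Mp e by (simp add: A_def)
        moreover have "real n * (?l * ?E n + ?w) = real n * (?l * ?E n) + real n * ?w" by (rule distrib_left)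
        ultimately have "real n * (?l * ?E n + ?w) - ?l * (\<epsilon> * M n) \<le> ell n / 2 + ell n / 2 - (real k + 2) * ell n"
          using 1 elim(3) by linarith
        also have "\<dots> = real (k + 1) * (- ell n)" by (simp add: algebra_simps)
        finally show ?thesis by simp
      qed
      also have "\<dots> = p n ^ (k + 1)" unfolding exp_of_nat_mult using exp_ell[of n] elim by simp
      finally show ?case .
    qed
  qed
qed

lemma small_jumps:
  assumes e: "\<epsilon> > 0" and h: "\<eta> > 0"
  obtains \<delta> where "0 < \<delta>" "\<delta> < \<eta>" "\<delta> \<le> 1"
    "\<forall>\<^sub>F n in sequentially.
       prob {\<omega> \<in> space \<Omega>. norm (\<Sum>j=1..n. if norm (H j \<omega>) \<le> \<delta> * M n then H j \<omega> else 0) > \<epsilon> * M n}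
         \<le> 2 * real DIM('a) * p n ^ (k + 1)"
proof -
  have D: "real DIM('a) > 0" by simp
  define \<epsilon>' where "\<epsilon>' = \<epsilon> / real DIM('a)"
  have e': "\<epsilon>' > 0" "\<epsilon>' * real DIM('a) = \<epsilon>" using e by (auto simp: \<epsilon>'_def)
  obtain \<delta> where d: "0 < \<delta>" "\<delta> < \<eta>" "\<delta> \<le> 1"
    and dir: "\<And>b. norm b \<le> 1 \<Longrightarrow> \<forall>\<^sub>F n in sequentially.
       prob {\<omega> \<in> space \<Omega>. (\<Sum>j=1..n. cut_inner b (\<delta> * M n) (H j \<omega>)) \<ge> \<epsilon>' * M n} \<le> p n ^ (k + 1)"
    using small_jumps_directional[OF e'(1) h] by blast
  define U where "U = (Basis :: 'a set) \<union> uminus ` Basis"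
  have finU: "finite U" by (simp add: U_def)
  have cardU: "card U \<le> 2 * DIM('a)"
    unfolding U_def using card_Un_le[of Basis "uminus ` (Basis::'a set)"] card_image_le[of "Basis::'a set" uminus] by simp
  have "\<forall>\<^sub>F n in sequentially. \<forall>b\<in>U.
       prob {\<omega> \<in> space \<Omega>. (\<Sum>j=1..n. cut_inner b (\<delta> * M n) (H j \<omega>)) \<ge> \<epsilon>' * M n} \<le> p n ^ (k + 1)"
    unfolding eventually_ball_finite_distrib[OF finU]
  proof (intro ballI dir)
    fix b assume "b \<in> U" then show "norm b \<le> 1" by (auto simp: U_def)
  qed
  then have "\<forall>\<^sub>F n in sequentially.
       prob {\<omega> \<in> space \<Omega>. norm (\<Sum>j=1..n. if norm (H j \<omega>) \<le> \<delta> * M n then H j \<omega> else 0) > \<epsilon> * M n}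
         \<le> 2 * real DIM('a) * p n ^ (k + 1)"
    using eventually_ge_at_top[of 1]
  proof eventually_elim
    case (elim n)
    let ?T = "\<lambda>\<omega>. \<Sum>j=1..n. if norm (H j \<omega>) \<le> \<delta> * M n then H j \<omega> else 0"
    let ?A = "\<lambda>b. {\<omega> \<in> space \<Omega>. (\<Sum>j=1..n. cut_inner b (\<delta> * M n) (H j \<omega>)) \<ge> \<epsilon>' * M n}"
    have A: "?A b \<in> events" for b by measurable
    have inner: "b \<bullet> ?T \<omega> = (\<Sum>j=1..n. cut_inner b (\<delta> * M n) (H j \<omega>))" for b \<omega>
      by (simp add: inner_sum_right cut_inner_def if_distrib cong: if_cong)
    have "{\<omega> \<in> space \<Omega>. norm (?T \<omega>) > \<epsilon> * M n} \<subseteq> (\<Union>b\<in>U. ?A b)"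
    proof
      fix \<omega> assume w: "\<omega> \<in> {\<omega> \<in> space \<Omega>. norm (?T \<omega>) > \<epsilon> * M n}"
      have "\<exists>b\<in>Basis. \<bar>?T \<omega> \<bullet> b\<bar> \<ge> \<epsilon>' * M n"
      proof (rule ccontr)
        assume "\<not> ?thesis"
        then have "(\<Sum>b\<in>Basis. \<bar>?T \<omega> \<bullet> b\<bar>) \<le> (\<Sum>b\<in>(Basis::'a set). \<epsilon>' * M n)" by (intro sum_mono) force
        with norm_le_l1[of "?T \<omega>"] have "norm (?T \<omega>) \<le> real DIM('a) * (\<epsilon>' * M n)" by simp
        also have "\<dots> = \<epsilon> * M n" using e'(2) by (metis mult.assoc mult.commute)
        finally show False using w by simp
      qed
      then obtain b where b: "b \<in> Basis" "\<bar>?T \<omega> \<bullet> b\<bar> \<ge> \<epsilon>' * M n" by blast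
      then consider "b \<bullet> ?T \<omega> \<ge> \<epsilon>' * M n" | "(- b) \<bullet> ?T \<omega> \<ge> \<epsilon>' * M n"
        by (auto simp: inner_commute abs_if split: if_splits)
      then show "\<omega> \<in> (\<Union>b\<in>U. ?A b)" using w b(1) unfolding inner by cases (auto simp: U_def)
    qed
    then have "prob {\<omega> \<in> space \<Omega>. norm (?T \<omega>) > \<epsilon> * M n} \<le> prob (\<Union>b\<in>U. ?A b)"
      using A finU by (intro finite_measure_mono) auto
    also have "\<dots> \<le> (\<Sum>b\<in>U. prob (?A b))"
      using A finU by (intro finite_measure_subadditive_finite) auto
    also have "\<dots> \<le> (\<Sum>b\<in>U. p n ^ (k + 1))" using elim by (intro sum_mono) auto
    also have "\<dots> = real (card U) * p n ^ (k + 1)" by simp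
    also have "\<dots> \<le> real (2 * DIM('a)) * p n ^ (k + 1)"
      using cardU p_pos[OF elim(2)] by (intro mult_right_mono) (auto simp only: of_nat_le_iff, simp)
    finally show ?case by simp
  qed
  with d that show ?thesis by blast
qed

end

section \<open>Reduction to k big jumps\<close>

lemma soft_trunc_scale:
  fixes h :: "'a::euclidean_space"
  assumes "m > 0"
  shows "(1 / m) *\<^sub>R soft_trunc m h l = soft_trunc 1 ((1 / m) *\<^sub>R h) (l / m)"
proof (cases "norm h \<le> m")
  case True
  then show ?thesis using assms by (simp add: soft_trunc_def)
next
  case False
  then have h: "norm h > 0" using assms by linarith
  have "norm ((1 / m) *\<^sub>R h) > 1" using False assms by (simp add: field_simps)
  moreover have "(1 / m) * ((m + l) * (1 / norm h)) = (1 + l / m) * (1 / norm ((1 / m) *\<^sub>R h) * (1 / m))"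
    using assms h by (simp add: field_simps)
  ultimately show ?thesis using False by (simp add: soft_trunc_def)
qed

lemma soft_trunc_minus_clip:
  fixes y :: "'a::euclidean_space"
  assumes "l \<ge> 0"
  shows "norm (soft_trunc 1 y l - clip 1 y) \<le> (if norm y > 1 then l else 0)"
proof (cases "norm y \<le> 1")
  case True
  then show ?thesis by (simp add: soft_trunc_def clip_eq)
next
  case False
  then have "soft_trunc 1 y l - clip 1 y = l *\<^sub>R ((1 / norm y) *\<^sub>R y)"
    by (simp add: soft_trunc_def clip_def max_def scaleR_add_left[symmetric] scaleR_diff_left[symmetric] add_divide_distrib)
  then show ?thesis using False assms by simp
qed

lemma choose_le_choose_Suc:
  assumes "k < n" shows "n choose k \<le> Suc k * (n choose Suc k)"
proof -
  have "Suc k * (n choose Suc k) = (n - k) * (n choose k)"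
    using binomial_absorb_comp[of n k] binomial_absorption[of k n] by (metis mult.commute)
  then show ?thesis using assms by simp
qed

text \<open>
  One small summand prevents a sum of clipped vectors from reaching the norm \<open>card J\<close>. This is why
  test functions that vanish near the ball of radius \<open>k - 1\<close> see only \<open>k\<close> genuinely big jumps.
\<close>

lemma norm_sum_clip_le:
  fixes y :: "'i \<Rightarrow> 'a::euclidean_space"
  assumes "finite J" "j0 \<in> J" "norm (y j0) \<le> s"
  shows "norm (\<Sum>j\<in>J. clip 1 (y j)) \<le> s + (real (card J) - 1)"
proof -
  have "norm (\<Sum>j\<in>J. clip 1 (y j)) \<le> norm (clip 1 (y j0)) + norm (\<Sum>j\<in>J - {j0}. clip 1 (y j))"
    using assms by (subst sum.remove[OF assms(1,2)]) (rule norm_triangle_ineq)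
  also have "norm (\<Sum>j\<in>J - {j0}. clip 1 (y j)) \<le> (\<Sum>j\<in>J - {j0}. 1)"
    by (rule order_trans[OF norm_sum]) (rule sum_mono, simp add: norm_clip)
  also have "\<dots> = real (card J) - 1"
    using assms(1,2) card_gt_0_iff[of J] by (auto simp: card_Diff_singleton of_nat_diff Suc_leI)
  finally show ?thesis using assms(3) by (simp add: norm_clip)
qed

text \<open>
  Call a jump big if its norm exceeds \<open>d\<close>. If there are more than \<open>k\<close> big jumps, both sides are at
  most \<open>C\<close> times a binomial coefficient, and the last term pays. If there are at most \<open>k\<close> of them but
  an excess or the sum of the small jumps is large, one of the two middle terms pays. Otherwise the sum
  is within \<open>e + k * d\<close> of the sum of the clipped big jumps. With fewer than \<open>k\<close> of these, or with one
  of norm at most \<open>e0\<close>, the zero set of \<open>f\<close> makes both sides vanish; with \<open>k\<close> of norm above \<open>e0\<close> the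
  error is \<open>\<omega>\<close>. It matters that the coefficient of \<open>\<omega>\<close> counts jumps above \<open>e0\<close> and not above
  \<open>d\<close>: the former threshold is fixed, whereas \<open>d\<close> has to tend to \<open>0\<close> together with \<open>\<omega>\<close>.
\<close>

lemma big_jump_approximation:
  fixes y :: "'i \<Rightarrow> 'a::euclidean_space" and f :: "'a \<Rightarrow> real"
  assumes I: "finite I" and l: "\<And>j. j \<in> I \<Longrightarrow> l j \<ge> 0" and k: "k \<ge> 1"
    and C: "\<And>x. \<bar>f x\<bar> \<le> C" and e0: "e0 > 0" and f0: "\<And>x. norm x \<le> real k - 1 + 2 * e0 \<Longrightarrow> f x = 0"
    and d: "0 < d" "d \<le> 1" and e: "0 \<le> e" "e + real k * d \<le> e0"
    and w: "\<And>x x'. norm (x - x') \<le> e + real k * d \<Longrightarrow> \<bar>f x - f x'\<bar> \<le> \<omega>"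
  defines "big \<equiv> \<lambda>s. {j \<in> I. norm (y j) > s}"
  shows "\<bar>f (\<Sum>j\<in>I. soft_trunc 1 (y j) (l j)) - (\<Sum>J | J \<subseteq> I \<and> card J = k. f (\<Sum>j\<in>J. clip 1 (y j)))\<bar>
    \<le> \<omega> * real (card (big e0) choose k)
      + 2 * C * of_bool (\<exists>j\<in>I. norm (y j) > 1 \<and> l j > d)
      + 2 * C * of_bool (norm (\<Sum>j\<in>I. if norm (y j) \<le> d then y j else 0) > e)
      + C * (real k + 2) * real (card (big d) choose (k + 1))"
    (is "\<bar>f ?S - ?U\<bar> \<le> ?b1 + ?b2 + ?b3 + ?b4")
proof -
  let ?B = "big d"
  define N where "N = card ?B"
  have finB: "finite ?B" using I by (simp add: big_def)
  have BI: "?B \<subseteq> I" by (auto simp: big_def)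
  have C0: "C \<ge> 0" using C[of 0] by linarith
  have w0: "\<omega> \<ge> 0" using w[of 0 0] e d by simp
  have "1 * d \<le> real k * d" using k d by (intro mult_right_mono) auto
  then have de0: "d \<le> e0" using e by linarith
  have nonneg: "?b1 \<ge> 0" "?b2 \<ge> 0" "?b3 \<ge> 0" "?b4 \<ge> 0" using w0 C0 by (auto intro!: mult_nonneg_nonneg)
  have zero: "f (\<Sum>j\<in>J. clip 1 (y j)) = 0" if J: "J \<subseteq> I" "card J = k" "\<not> J \<subseteq> ?B" for J
  proof (rule f0)
    obtain j0 where j0: "j0 \<in> J" "norm (y j0) \<le> d" using J unfolding big_def by (auto simp: subset_iff not_less)
    have "finite J" using J(1) I by (rule finite_subset)
    from norm_sum_clip_le[where y = y, OF this j0] show "norm (\<Sum>j\<in>J. clip 1 (y j)) \<le> real k - 1 + 2 * e0"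
      using de0 J(2) e0 by linarith
  qed
  have U_eq: "?U = (\<Sum>J | J \<subseteq> ?B \<and> card J = k. f (\<Sum>j\<in>J. clip 1 (y j)))"
    by (rule sum.mono_neutral_right) (use I BI zero in \<open>auto simp: finite_Collect_subsets\<close>)
  have U_le: "\<bar>?U\<bar> \<le> C * real (N choose k)"
  proof -
    have "\<bar>?U\<bar> \<le> (\<Sum>J | J \<subseteq> ?B \<and> card J = k. C)"
      unfolding U_eq by (rule order_trans[OF sum_abs]) (intro sum_mono C)
    also have "\<dots> = C * real (N choose k)" using n_subsets[OF finB, of k] by (simp add: N_def)
    finally show ?thesis .
  qed
  consider (many) "N \<ge> k + 1"
    | (bad) "N \<le> k" "(\<exists>j\<in>I. norm (y j) > 1 \<and> l j > d) \<or> norm (\<Sum>j\<in>I. if norm (y j) \<le> d then y j else 0) > e"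
    | (good) "N \<le> k" "\<And>j. j \<in> I \<Longrightarrow> norm (y j) > 1 \<Longrightarrow> l j \<le> d" "norm (\<Sum>j\<in>I. if norm (y j) \<le> d then y j else 0) \<le> e"
    by force
  then show ?thesis
  proof cases
    case many
    have "N choose k \<le> Suc k * (N choose Suc k)" by (rule choose_le_choose_Suc) (use many in simp)
    then have "real (N choose k) \<le> real (Suc k * (N choose Suc k))" by (simp only: of_nat_le_iff)
    then have "real (N choose k) \<le> (real k + 1) * real (N choose Suc k)"
      by (simp only: of_nat_mult of_nat_Suc add.commute)
    then have "C * real (N choose k) \<le> C * ((real k + 1) * real (N choose Suc k))" using C0 by (rule mult_left_mono)
    moreover have "1 \<le> real (N choose Suc k)" using many by (simp add: Suc_leI zero_less_binomial_iff)
    then have "C * 1 \<le> C * real (N choose Suc k)" using C0 by (rule mult_left_mono)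
    moreover have "\<bar>f ?S - ?U\<bar> \<le> C + C * real (N choose k)" using C[of ?S] U_le by linarith
    ultimately have "\<bar>f ?S - ?U\<bar> \<le> C * real (N choose Suc k) + C * ((real k + 1) * real (N choose Suc k))" by linarith
    also have "\<dots> = ?b4" by (simp add: N_def algebra_simps)
    finally have "\<bar>f ?S - ?U\<bar> \<le> ?b4" .
    then show ?thesis using nonneg by linarith
  next
    case bad
    have "N choose k \<le> 1" using bad(1) by (cases "N = k") (auto simp: binomial_eq_0)
    then have "real (N choose k) \<le> 1" by simp
    then have "C * real (N choose k) \<le> C * 1" using C0 by (intro mult_left_mono) auto
    then have "\<bar>f ?S - ?U\<bar> \<le> 2 * C" using C[of ?S] U_le by linarith
    also have "\<dots> \<le> ?b2 + ?b3" using bad(2) C0 by auto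
    finally show ?thesis using nonneg by linarith
  next
    case good
    let ?T = "\<Sum>j\<in>I. if norm (y j) \<le> d then y j else 0"
    have split: "?S = ?T + (\<Sum>j\<in>?B. soft_trunc 1 (y j) (l j))"
    proof -
      have "?S = (\<Sum>j\<in>I - ?B. soft_trunc 1 (y j) (l j)) + (\<Sum>j\<in>?B. soft_trunc 1 (y j) (l j))"
        by (rule sum.subset_diff[OF BI I])
      also have "(\<Sum>j\<in>I - ?B. soft_trunc 1 (y j) (l j)) = (\<Sum>j\<in>I - ?B. if norm (y j) \<le> d then y j else 0)"
        using d by (intro sum.cong) (auto simp: big_def soft_trunc_def)
      also have "\<dots> = ?T"
        by (rule sum.mono_neutral_left) (use I in \<open>auto simp: big_def\<close>)
      finally show ?thesis .
    qed
    let ?V = "\<Sum>j\<in>?B. clip 1 (y j)"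
    have "?S - ?V = ?T + (\<Sum>j\<in>?B. soft_trunc 1 (y j) (l j) - clip 1 (y j))"
      unfolding split by (simp add: sum_subtractf)
    also have "norm \<dots> \<le> e + (\<Sum>j\<in>?B. d)"
    proof (rule norm_triangle_le[OF add_mono[OF good(3) order_trans[OF norm_sum]]], rule sum_mono)
      fix j assume "j \<in> ?B"
      then have j: "j \<in> I" by (simp add: big_def)
      show "norm (soft_trunc 1 (y j) (l j) - clip 1 (y j)) \<le> d"
        using soft_trunc_minus_clip[OF l[OF j], of "y j"] good(2)[OF j] d by (auto split: if_splits)
    qed
    also have "(\<Sum>j\<in>?B. d) = real N * d" by (simp add: N_def)
    also have "e + real N * d \<le> e + real k * d" using good(1) d by (intro add_left_mono mult_right_mono) auto
    finally have close: "norm (?S - ?V) \<le> e + real k * d" .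
    have S_zero: "f ?S = 0" and V_zero: "f ?V = 0" if "norm ?V \<le> real k - 1 + e0"
    proof -
      have "norm ?S \<le> norm ?V + norm (?S - ?V)" by (metis add.commute diff_add_cancel norm_triangle_ineq)
      then show "f ?S = 0" using that close e by (intro f0) linarith
      show "f ?V = 0" using that e0 by (intro f0) linarith
    qed
    have V_card: "norm ?V \<le> real N"
    proof -
      have "norm ?V \<le> (\<Sum>j\<in>?B. 1)" by (rule order_trans[OF norm_sum]) (rule sum_mono, simp add: norm_clip)
      then show ?thesis by (simp add: N_def)
    qed
    show ?thesis
    proof (cases "N = k")
      case False
      then have "N < k" using good(1) by simp
      then have "?U = 0" using U_le by (simp add: binomial_eq_0)
      moreover have "real N \<le> real k - 1" using \<open>N < k\<close> by linarith
      then have "f ?S = 0" using V_card e0 by (intro S_zero) linarith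
      ultimately show ?thesis using nonneg by simp
    next
      case True
      have "{J. J \<subseteq> ?B \<and> card J = k} = {?B}"
        using True finB card_subset_eq[OF finB] by (auto simp: N_def)
      then have U: "?U = f ?V" unfolding U_eq by simp
      show ?thesis
      proof (cases "card (big e0) \<ge> k")
        case True
        then have "1 \<le> real (card (big e0) choose k)" by (simp add: Suc_leI zero_less_binomial_iff)
        then have "\<omega> * 1 \<le> ?b1" using w0 by (intro mult_left_mono)
        moreover have "\<bar>f ?S - ?U\<bar> \<le> \<omega>" unfolding U by (rule w[OF close])
        ultimately show ?thesis using nonneg by linarith
      next
        case False
        have "\<not> ?B \<subseteq> big e0"
          using False True card_mono[of "big e0" ?B] I by (auto simp: N_def big_def)
        then obtain j0 where j0: "j0 \<in> ?B" "norm (y j0) \<le> e0" unfolding big_def by (auto simp: subset_iff not_less)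
        have "norm ?V \<le> real k - 1 + e0"
          using norm_sum_clip_le[where y = y, OF finB j0] True by (simp add: N_def)
        then show ?thesis using nonneg U S_zero V_zero by simp
      qed
    qed
  qed
qed

lemma binomial_div_power_limit:
  "(\<lambda>n. real (n choose k) / real n ^ k) \<longlonglongrightarrow> 1 / fact k"
proof (induction k)
  case (Suc k)
  have "(\<lambda>n. (real n - real k) / real n) \<longlonglongrightarrow> 1" by real_asymp
  then have "(\<lambda>n. real (n choose k) / real n ^ k * ((real n - real k) / real n) * (1 / real (Suc k))) \<longlonglongrightarrow> 1 / fact k * 1 * (1 / real (Suc k))"
    by (intro tendsto_mult Suc tendsto_const)
  then have "(\<lambda>n. real (n choose k) / real n ^ k * ((real n - real k) / real n) * (1 / real (Suc k))) \<longlonglongrightarrow> 1 / fact (Suc k)"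
    by (simp add: field_simps)
  then show ?case
  proof (rule Lim_transform_eventually)
    show "\<forall>\<^sub>F n in sequentially. real (n choose k) / real n ^ k * ((real n - real k) / real n) * (1 / real (Suc k)) = real (n choose Suc k) / real n ^ Suc k"
      using eventually_ge_at_top[of "Suc k"]
    proof eventually_elim
      case (elim n)
      have "Suc k * (n choose Suc k) = (n - k) * (n choose k)"
        using binomial_absorb_comp[of n k] binomial_absorption[of k n] by (metis mult.commute)
      then have "real (Suc k) * real (n choose Suc k) = (real n - real k) * real (n choose k)"
        using elim by (metis Suc_leD of_nat_diff of_nat_mult)
      then have "real (n choose Suc k) = (real n - real k) * real (n choose k) / real (Suc k)"
        by (simp add: field_simps)
      then show ?case by (simp add: mult_ac)
    qed
  qed
qed simp

section \<open>Jump counts and the law of k big jumps\<close>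

definition cutoff :: "real \<Rightarrow> 'a::euclidean_space \<Rightarrow> real" where
  "cutoff e x = min 1 (max 0 (norm x / e - 1))"

lemma cutoff_continuous: "continuous_on S (cutoff e)"
  unfolding cutoff_def divide_inverse by (intro continuous_intros)

lemma cutoff_range: "0 \<le> cutoff e x" "cutoff e x \<le> 1"
  by (auto simp: cutoff_def)

lemma abs_cutoff: "\<bar>cutoff e x\<bar> \<le> 1"
  using cutoff_range[of e x] by simp

lemma cutoff_small: "e > 0 \<Longrightarrow> norm x \<le> e \<Longrightarrow> cutoff e x = 0"
  by (auto simp: cutoff_def)

lemma cutoff_large: "e > 0 \<Longrightarrow> 2 * e \<le> norm x \<Longrightarrow> cutoff e x = 1"
  by (auto simp: cutoff_def pos_le_divide_eq)

lemma cutoff_measurable [measurable]: "cutoff e \<in> borel_measurable borel"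
  by (intro borel_measurable_continuous_onI cutoff_continuous)

text \<open>
  Where \<open>f\<close> does not vanish, all \<open>k\<close> vectors have norm at least \<open>2 * e0\<close> and the weights are \<open>1\<close>. So
  the weights can be inserted freely, and they make the product integrable under \<open>\<nu>\<close>.
\<close>

lemma cutoff_prod:
  fixes f :: "'a::euclidean_space \<Rightarrow> real"
  assumes "e0 > 0" and f0: "\<And>x. norm x \<le> real k - 1 + 2 * e0 \<Longrightarrow> f x = 0"
    and J: "finite J" "card J = k" and x: "\<And>j. j \<in> J \<Longrightarrow> norm (x j) \<le> 1"
  shows "f (\<Sum>j\<in>J. x j) = f (0 + (\<Sum>j\<in>J. x j)) * (\<Prod>j\<in>J. cutoff e0 (x j))"
proof (cases "\<exists>j0\<in>J. norm (x j0) < 2 * e0")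
  case True
  then obtain j0 where j0: "j0 \<in> J" "norm (x j0) \<le> 2 * e0" by (auto intro: less_imp_le)
  have "(\<Sum>j\<in>J. x j) = (\<Sum>j\<in>J. clip 1 (x j))" using x by (intro sum.cong) (auto simp: clip_eq)
  then have "norm (\<Sum>j\<in>J. x j) \<le> real k - 1 + 2 * e0"
    using norm_sum_clip_le[where y = x, OF J(1) j0] J(2) by simp
  then show ?thesis by (simp add: f0)
next
  case False
  then have "(\<Prod>j\<in>J. cutoff e0 (x j)) = 1"
    using assms(1) by (intro prod.neutral) (auto simp: not_less cutoff_large)
  then show ?thesis by simp
qed

context regvar_row_sums begin

lemma expectation_indicator_prod:
  assumes J: "finite J" "J \<subseteq> {1..}"
  shows "(\<integral>\<omega>. (\<Prod>j\<in>J. indicat_real {x. norm x > t} (H j \<omega>)) \<partial>\<Omega>) = Q t ^ card J"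
    and "integrable \<Omega> (\<lambda>\<omega>. \<Prod>j\<in>J. indicat_real {x. norm x > t} (H j \<omega>))"
proof -
  let ?X = "\<lambda>j \<omega>. indicat_real {x. norm x > t} (H j \<omega>)"
  have fm: "indicat_real {x::'a. norm x > t} \<in> borel_measurable borel" by measurable
  have ii: "integrable \<Omega> (?X j)" for j
    by (rule integrable_const_bound[of _ 1]) (auto simp: indicator_def)
  have ind: "indep_vars (\<lambda>_. borel) ?X J"
    by (rule indep_vars_compose2[OF indep_vars_subset[OF H_indep J(2)]]) (rule fm)
  show "integrable \<Omega> (\<lambda>\<omega>. \<Prod>j\<in>J. ?X j \<omega>)"
    by (rule indep_vars_integrable[OF J(1) ind ii])
  have "(\<integral>\<omega>. (\<Prod>j\<in>J. ?X j \<omega>) \<partial>\<Omega>) = (\<Prod>j\<in>J. \<integral>\<omega>. ?X j \<omega> \<partial>\<Omega>)"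
    by (rule indep_vars_lebesgue_integral[OF J(1) ind ii])
  also have "\<dots> = (\<Prod>j\<in>J. Q t)"
  proof (rule prod.cong[OF refl])
    fix j
    show "(\<integral>\<omega>. ?X j \<omega> \<partial>\<Omega>) = Q t" unfolding expectation_H[OF fm, of j] by (rule Q_eq[symmetric])
  qed
  finally show "(\<integral>\<omega>. (\<Prod>j\<in>J. ?X j \<omega>) \<partial>\<Omega>) = Q t ^ card J" by simp
qed

text \<open>
  A binomial coefficient of a count is the number of index sets on which all the events occur.
\<close>

lemma choose_count_eq:
  "real (card {j \<in> {1..n}. norm (H j \<omega>) > t} choose k)
     = (\<Sum>J | J \<subseteq> {1..n} \<and> card J = k. \<Prod>j\<in>J. indicat_real {x. norm x > t} (H j \<omega>))"
proof -
  let ?B = "{j \<in> {1..n}. norm (H j \<omega>) > t}"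
  have "(\<Sum>J | J \<subseteq> {1..n} \<and> card J = k. \<Prod>j\<in>J. indicat_real {x. norm x > t} (H j \<omega>))
    = (\<Sum>J | J \<subseteq> {1..n} \<and> card J = k. if J \<subseteq> ?B then 1 else 0)"
  proof (rule sum.cong[OF refl])
    fix J assume J: "J \<in> {J. J \<subseteq> {1..n} \<and> card J = k}"
    then have fin: "finite J" using finite_subset by auto
    show "(\<Prod>j\<in>J. indicat_real {x. norm x > t} (H j \<omega>)) = (if J \<subseteq> ?B then 1 else 0)"
    proof (cases "J \<subseteq> ?B")
      case True
      then have "(\<Prod>j\<in>J. indicat_real {x. norm x > t} (H j \<omega>)) = 1" by (intro prod.neutral) auto
      then show ?thesis using True by simp
    next
      case False
      then obtain j where "j \<in> J" "\<not> norm (H j \<omega>) > t" using J by auto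
      then have "(\<Prod>j\<in>J. indicat_real {x. norm x > t} (H j \<omega>)) = 0" using fin by (intro prod_zero bexI[of _ j]) auto
      then show ?thesis using False by simp
    qed
  qed
  also have "\<dots> = (\<Sum>J | J \<subseteq> ?B \<and> card J = k. 1)"
  proof -
    have "{J \<in> {J. J \<subseteq> {1..n} \<and> card J = k}. J \<subseteq> ?B} = {J. J \<subseteq> ?B \<and> card J = k}" by auto
    moreover have "finite {J. J \<subseteq> {1..n} \<and> card J = k}" by (simp add: finite_Collect_subsets)
    ultimately show ?thesis by (subst sum.inter_filter[symmetric]) simp_all
  qed
  also have "\<dots> = real (card ?B choose k)" using n_subsets[of ?B k] by simp
  finally show ?thesis by simp
qed

lemma expectation_choose_count:
  shows "integrable \<Omega> (\<lambda>\<omega>. real (card {j \<in> {1..n}. norm (H j \<omega>) > t} choose k))"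
    and "(\<integral>\<omega>. real (card {j \<in> {1..n}. norm (H j \<omega>) > t} choose k) \<partial>\<Omega>) \<le> (real n * Q t) ^ k"
proof -
  have J: "finite J" "J \<subseteq> {1..}" if "J \<subseteq> {1..n}" for J :: "nat set"
    using that finite_subset by auto
  show "integrable \<Omega> (\<lambda>\<omega>. real (card {j \<in> {1..n}. norm (H j \<omega>) > t} choose k))"
    unfolding choose_count_eq by (intro Bochner_Integration.integrable_sum expectation_indicator_prod(2)) (auto intro: finite_subset)
  have "(\<integral>\<omega>. real (card {j \<in> {1..n}. norm (H j \<omega>) > t} choose k) \<partial>\<Omega>)
     = (\<Sum>J | J \<subseteq> {1..n} \<and> card J = k. \<integral>\<omega>. (\<Prod>j\<in>J. indicat_real {x. norm x > t} (H j \<omega>)) \<partial>\<Omega>)"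
    unfolding choose_count_eq by (rule Bochner_Integration.integral_sum) (use J in \<open>auto intro!: expectation_indicator_prod(2)\<close>)
  also have "\<dots> = (\<Sum>J | J \<subseteq> {1..n} \<and> card J = k. Q t ^ k)"
  proof (rule sum.cong[OF refl])
    fix J assume "J \<in> {J. J \<subseteq> {1..n} \<and> card J = k}"
    then show "(\<integral>\<omega>. (\<Prod>j\<in>J. indicat_real {x. norm x > t} (H j \<omega>)) \<partial>\<Omega>) = Q t ^ k"
      using expectation_indicator_prod(1)[of J t] J[of J] by simp
  qed
  also have "\<dots> = real (n choose k) * Q t ^ k" using n_subsets[of "{1..n}" k] by simp
  also have "\<dots> \<le> real n ^ k * Q t ^ k"
  proof (rule mult_right_mono)
    have "n choose k \<le> n ^ k"
      by (cases "k \<le> n") (auto simp: binomial_le_pow binomial_eq_0)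
    then have "real (n choose k) \<le> real (n ^ k)" by (simp only: of_nat_le_iff)
    then show "real (n choose k) \<le> real n ^ k" by simp
  qed (simp add: Q_nonneg)
  finally show "(\<integral>\<omega>. real (card {j \<in> {1..n}. norm (H j \<omega>) > t} choose k) \<partial>\<Omega>) \<le> (real n * Q t) ^ k"
    by (simp add: power_mult_distrib)
qed

text \<open>
  The law of one jump after scaling and clipping, which tends to \<open>\<nu>\<close> at rate \<open>Q (M n)\<close>.
\<close>

definition clip_law :: "nat \<Rightarrow> 'a measure" where
  "clip_law n = distr \<Omega> borel (\<lambda>\<omega>. clip 1 ((1 / M n) *\<^sub>R H 0 \<omega>))"

lemma clip1_measurable [measurable]: "clip 1 \<in> borel_measurable (borel :: 'a measure)"
  by (rule clip_measurable) simp

lemma clip_law_eq: "distr \<Omega> borel (\<lambda>\<omega>. clip 1 ((1 / M n) *\<^sub>R H j \<omega>)) = clip_law n"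
proof -
  have "distr \<Omega> borel (\<lambda>\<omega>. clip 1 ((1 / M n) *\<^sub>R H j \<omega>)) = distr (distr \<Omega> borel (H j)) borel (\<lambda>x. clip 1 ((1 / M n) *\<^sub>R x))"
    by (subst distr_distr) (auto simp: comp_def)
  also have "\<dots> = distr (distr \<Omega> borel (H 0)) borel (\<lambda>x. clip 1 ((1 / M n) *\<^sub>R x))"
    by (simp only: H_ident[of j])
  also have "\<dots> = clip_law n" unfolding clip_law_def by (subst distr_distr) (auto simp: comp_def)
  finally show ?thesis .
qed

lemma clip_law_kernel: "weighted_kernel (clip_law n) (cutoff e)"
proof -
  interpret P: prob_space "clip_law n" unfolding clip_law_def by (rule prob_space_distr) measurable
  show ?thesis
  proof
    show "(\<lambda>x. x) \<in> borel_measurable (clip_law n)" by (simp add: clip_law_def)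
    show "integrable (clip_law n) (cutoff e)"
      by (rule P.integrable_const_bound[of _ 1]) (simp_all add: abs_cutoff clip_law_def)
  qed (auto simp: cutoff_range)
qed

lemma expectation_clipped_sum:
  fixes f :: "'a \<Rightarrow> real"
  assumes J: "finite J" "J \<subseteq> {1..}" "card J = k" and k: "k \<ge> 1"
    and uc: "uniformly_continuous_on UNIV f" and C: "\<And>x. \<bar>f x\<bar> \<le> C"
    and e0: "e0 > 0" and f0: "\<And>x. norm x \<le> real k - 1 + 2 * e0 \<Longrightarrow> f x = 0"
  shows "(\<integral>\<omega>. f (\<Sum>j\<in>J. clip 1 ((1 / M n) *\<^sub>R H j \<omega>)) \<partial>\<Omega>) = (weighted_conv (clip_law n) (cutoff e0) ^^ k) f 0"
proof -
  interpret P: weighted_kernel "clip_law n" "cutoff e0" by (rule clip_law_kernel)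
  let ?Y = "\<lambda>j \<omega>. clip 1 ((1 / M n) *\<^sub>R H j \<omega>)"
  let ?F = "\<lambda>x. f (0 + (\<Sum>j\<in>J. x j)) * (\<Prod>j\<in>J. cutoff e0 (x j))"
  have Jne: "J \<noteq> {}" using J k by auto
  have fm: "f \<in> borel_measurable borel"
    by (intro borel_measurable_continuous_onI uniformly_continuous_imp_continuous uc)
  have ym: "?Y j \<in> borel_measurable \<Omega>" for j by measurable
  have ind: "indep_vars (\<lambda>_. borel) ?Y J"
    by (rule indep_vars_compose2[OF indep_vars_subset[OF H_indep J(2)]]) measurable
  have law: "distr \<Omega> (Pi\<^sub>M J (\<lambda>_. borel)) (\<lambda>\<omega>. \<lambda>j\<in>J. ?Y j \<omega>) = Pi\<^sub>M J (\<lambda>_. clip_law n)"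
    using indep_vars_iff_distr_eq_PiM'[OF Jne, where M' = "\<lambda>_. borel" and X = ?Y] ym ind unfolding clip_law_eq by simp
  have Ym: "(\<lambda>\<omega>. \<lambda>j\<in>J. ?Y j \<omega>) \<in> measurable \<Omega> (Pi\<^sub>M J (\<lambda>_. borel))"
    by (rule measurable_restrict) (rule ym)
  have Fm: "?F \<in> borel_measurable (Pi\<^sub>M J (\<lambda>_. borel))"
    using fm by measurable
  have "(\<integral>\<omega>. f (\<Sum>j\<in>J. ?Y j \<omega>) \<partial>\<Omega>) = (\<integral>\<omega>. ?F (\<lambda>j\<in>J. ?Y j \<omega>) \<partial>\<Omega>)"
  proof (rule Bochner_Integration.integral_cong[OF refl])
    fix \<omega>
    have "f (\<Sum>j\<in>J. ?Y j \<omega>) = f (0 + (\<Sum>j\<in>J. ?Y j \<omega>)) * (\<Prod>j\<in>J. cutoff e0 (?Y j \<omega>))"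
      by (rule cutoff_prod[OF e0 _ J(1,3)]) (auto simp: f0 norm_clip)
    also have "\<dots> = ?F (\<lambda>j\<in>J. ?Y j \<omega>)" by (simp cong: sum.cong prod.cong)
    finally show "f (\<Sum>j\<in>J. ?Y j \<omega>) = ?F (\<lambda>j\<in>J. ?Y j \<omega>)" .
  qed
  also have "\<dots> = integral\<^sup>L (Pi\<^sub>M J (\<lambda>_. clip_law n)) ?F"
    unfolding law[symmetric] by (rule integral_distr[OF Ym Fm, symmetric])
  also have "\<dots> = (weighted_conv (clip_law n) (cutoff e0) ^^ k) f 0"
    using P.product_integral_iterate[OF J(1) uc C, of 0] J(3) by simp
  finally show ?thesis .
qed

lemma ball_compl: "- cball (0::'a) 1 = {x. norm x > 1}" by auto

lemma nu_eq: "nu_meas \<mu> = scale_measure (ennreal (1 / m)) (distr \<mu> (restrict_space borel (- {0})) (clip 1))"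
  unfolding nu_meas_eq[OF mu_sets sphere_null] ball_compl emeasure_outer_1
  using m_pos by (simp add: inverse_ennreal inverse_eq_divide)

lemma sets_nu: "sets (nu_meas \<mu>) = sets (restrict_space borel (- {0}))"
  unfolding nu_eq by simp

lemma space_nu: "space (nu_meas \<mu>) = - {0}"
  using sets_eq_imp_space_eq[OF sets_nu] by (simp add: space_restrict_space)

lemma in_sets_nu: "B \<in> sets borel \<Longrightarrow> 0 \<notin> B \<Longrightarrow> B \<in> sets (nu_meas \<mu>)"
  unfolding sets_nu by (auto simp: sets_restrict_space intro!: image_eqI[of _ _ B])

lemma emeasure_nu:
  assumes "B \<in> sets borel" "0 \<notin> B"
  shows "emeasure (nu_meas \<mu>) B = ennreal (1 / m) * emeasure \<mu> (clip 1 -` B \<inter> - {0})"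
proof -
  have "B \<in> sets (restrict_space borel (- {0}))" using in_sets_nu[OF assms] by (simp only: sets_nu)
  then show ?thesis
    unfolding nu_eq emeasure_scale_measure
    by (subst emeasure_distr[OF clip_measurable_punctured[OF mu_sets zero_less_one]]) (simp_all add: space_mu)
qed

lemma nu_outside: "emeasure (nu_meas \<mu>) {x. norm x > 1} = 0"
proof -
  have "clip 1 -` {x::'a. norm x > 1} \<inter> - {0} = {}" by (auto simp: norm_clip)
  then show ?thesis by (subst emeasure_nu) auto
qed

lemma nu_finite: "t > 0 \<Longrightarrow> emeasure (nu_meas \<mu>) {x. norm x \<ge> t} < \<infinity>"
proof -
  assume t: "t > 0"
  have "emeasure \<mu> (clip 1 -` {x. norm x \<ge> t} \<inter> - {0}) \<le> emeasure \<mu> {x. norm x \<ge> t}"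
    using t by (intro emeasure_mono outer_in_sets) (auto simp: norm_clip)
  also have "\<dots> < \<infinity>" by (rule mu_finite[OF t])
  finally show ?thesis using t by (subst emeasure_nu) (auto simp: ennreal_mult_less_top)
qed

lemma nu_id_measurable: "(\<lambda>x. x) \<in> measurable (nu_meas \<mu>) borel"
proof -
  have "(\<lambda>x. x) \<in> measurable (restrict_space borel (- {0})) (borel :: 'a measure)"
    by (rule measurable_restrict_space1) simp
  then show ?thesis by (simp cong: measurable_cong_sets add: sets_nu)
qed

lemma nu_sigma_finite: "sigma_finite_measure (nu_meas \<mu>)"
proof
  let ?A = "range (\<lambda>n::nat. {x::'a. norm x \<ge> 1 / Suc n})"
  have "?A \<subseteq> sets (nu_meas \<mu>)" by (auto intro!: in_sets_nu)
  moreover have "\<Union> ?A = space (nu_meas \<mu>)"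
  proof safe
    fix x :: 'a assume "x \<in> space (nu_meas \<mu>)"
    then have "norm x > 0" by (simp add: space_nu)
    then obtain n where "1 / Suc n < norm x" using nat_approx_posE by blast
    then show "x \<in> \<Union> ?A" by (auto intro: less_imp_le)
  next
    fix x :: 'a and n assume "1 / real (Suc n) \<le> norm x"
    moreover have "1 / real (Suc n) > 0" by simp
    ultimately have "norm x > 0" by linarith
    then show "x \<in> space (nu_meas \<mu>)" by (auto simp: space_nu)
  qed
  moreover have "\<forall>a\<in>?A. emeasure (nu_meas \<mu>) a \<noteq> \<infinity>" using nu_finite by (auto simp: less_top)
  ultimately show "\<exists>A. countable A \<and> A \<subseteq> sets (nu_meas \<mu>) \<and> \<Union> A = space (nu_meas \<mu>) \<and> (\<forall>a\<in>A. emeasure (nu_meas \<mu>) a \<noteq> \<infinity>)"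
    by (intro exI[of _ ?A]) auto
qed

lemma nu_kernel: assumes "e > 0" shows "weighted_kernel (nu_meas \<mu>) (cutoff e)"
proof -
  interpret sigma_finite_measure "nu_meas \<mu>" by (rule nu_sigma_finite)
  show ?thesis
  proof
    have i: "integrable (nu_meas \<mu>) (indicat_real {x. norm x \<ge> e})"
      using nu_finite[OF assms] in_sets_nu[of "{x. norm x \<ge> e}"] assms by auto
    show "integrable (nu_meas \<mu>) (cutoff e)"
    proof (rule Bochner_Integration.integrable_bound[OF i])
      show "cutoff e \<in> borel_measurable (nu_meas \<mu>)"
        by (rule measurable_compose[OF nu_id_measurable cutoff_measurable])
      show "AE x in nu_meas \<mu>. norm (cutoff e x) \<le> norm (indicat_real {x. norm x \<ge> e} x)"
      proof (rule AE_I2)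
        fix x
        show "norm (cutoff e x) \<le> norm (indicat_real {x. norm x \<ge> e} x)"
          using abs_cutoff[of e x] cutoff_small[OF assms, of x] by (cases "norm x \<ge> e") auto
      qed
    qed
  qed (auto simp: cutoff_range nu_id_measurable)
qed

lemma integral_nu:
  fixes g :: "'a \<Rightarrow> real"
  assumes g: "g \<in> borel_measurable borel"
  shows "(\<integral>x. g x \<partial>nu_meas \<mu>) = (\<integral>x. g (clip 1 x) \<partial>\<mu>) / m"
proof -
  have gr: "g \<in> borel_measurable (restrict_space borel (- {0}))" by (rule measurable_restrict_space1[OF g])
  have "(\<integral>x. g x \<partial>nu_meas \<mu>) = 1 / m * (\<integral>x. g x \<partial>distr \<mu> (restrict_space borel (- {0})) (clip 1))"
    unfolding nu_eq by (rule integral_scale_measure) (use m_pos gr in auto)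
  also have "(\<integral>x. g x \<partial>distr \<mu> (restrict_space borel (- {0})) (clip 1)) = (\<integral>x. g (clip 1 x) \<partial>\<mu>)"
    by (rule integral_distr[OF clip_measurable_punctured[OF mu_sets zero_less_one] gr])
  finally show ?thesis by simp
qed

lemma clip_law_limit:
  fixes f :: "'a \<Rightarrow> real"
  assumes uc: "uniformly_continuous_on UNIV f" and C: "\<And>x. \<bar>f x\<bar> \<le> C" and e: "e > 0"
  shows "(\<lambda>n. (weighted_conv (clip_law n) (cutoff e) ^^ k) f 0 / Q (M n) ^ k)
     \<longlonglongrightarrow> (weighted_conv (nu_meas \<mu>) (cutoff e) ^^ k) f 0"
proof -
  have "(\<lambda>n. (1 / Q (M n)) ^ k * (weighted_conv (clip_law n) (cutoff e) ^^ k) f 0)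
     \<longlonglongrightarrow> (weighted_conv (nu_meas \<mu>) (cutoff e) ^^ k) f 0"
  proof (rule weighted_conv_limit[OF clip_law_kernel nu_kernel[OF e] _ _ _ uc C])
    show "AE x in clip_law n. norm x \<le> 1" for n
      unfolding clip_law_def by (subst AE_distr_iff) (auto simp: norm_clip)
    show "1 / Q (M n) \<ge> 0" for n by (simp add: Q_nonneg)
    fix g :: "'a \<Rightarrow> real" and B assume g: "uniformly_continuous_on UNIV g" "\<And>x. \<bar>g x\<bar> \<le> B"
    let ?g = "\<lambda>x. g x * cutoff e x"
    have cg: "continuous_on UNIV ?g"
      by (intro continuous_on_mult cutoff_continuous uniformly_continuous_imp_continuous g)
    have gm: "?g \<in> borel_measurable borel" by (rule borel_measurable_continuous_onI[OF cg])
    have "((\<lambda>x. (\<integral>\<omega>. ?g (clip 1 ((1 / x) *\<^sub>R H 0 \<omega>)) \<partial>\<Omega>) / Q x) \<longlongrightarrow> (\<integral>x. ?g (clip 1 x) \<partial>\<mu>) / m) at_top"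
      by (rule clip_limit[OF cg e]) (simp add: cutoff_small e)
    from filterlim_compose[OF this M_lim]
    have "(\<lambda>n. (\<integral>\<omega>. ?g (clip 1 ((1 / M n) *\<^sub>R H 0 \<omega>)) \<partial>\<Omega>) / Q (M n)) \<longlonglongrightarrow> (\<integral>x. ?g x \<partial>nu_meas \<mu>)"
      unfolding integral_nu[OF gm] .
    moreover have "(\<integral>x. ?g x \<partial>clip_law n) = (\<integral>\<omega>. ?g (clip 1 ((1 / M n) *\<^sub>R H 0 \<omega>)) \<partial>\<Omega>)" for n
      unfolding clip_law_def by (rule integral_distr[OF _ gm]) measurable
    ultimately show "(\<lambda>n. 1 / Q (M n) * (\<integral>x. ?g x \<partial>clip_law n)) \<longlonglongrightarrow> (\<integral>x. ?g x \<partial>nu_meas \<mu>)"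
      by simp
  qed
  then show ?thesis by (simp add: power_one_over)
qed

section \<open>The limit theorem\<close>

lemma AE_nu_product:
  assumes I: "finite I"
  shows "AE x in Pi\<^sub>M I (\<lambda>_. nu_meas \<mu>). \<forall>j\<in>I. norm (x j) \<le> 1"
proof (rule AE_finite_allI[OF I])
  fix j assume j: "j \<in> I"
  interpret sigma_finite_measure "nu_meas \<mu>" by (rule nu_sigma_finite)
  interpret product_sigma_finite "\<lambda>_. nu_meas \<mu>" by unfold_locales
  let ?A = "\<lambda>i. if i = j then {x. norm x > 1} else space (nu_meas \<mu>)"
  have A: "?A i \<in> sets (nu_meas \<mu>)" for i by (auto intro: in_sets_nu)
  have "emeasure (Pi\<^sub>M I (\<lambda>_. nu_meas \<mu>)) (Pi\<^sub>E I ?A) = (\<Prod>i\<in>I. emeasure (nu_meas \<mu>) (?A i))"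
    by (rule emeasure_PiM[OF I A])
  also have "\<dots> = 0" using I j by (intro prod_zero bexI[of _ j]) (auto simp: nu_outside)
  finally have "Pi\<^sub>E I ?A \<in> null_sets (Pi\<^sub>M I (\<lambda>_. nu_meas \<mu>))"
    using A I by (auto simp: null_sets_def intro!: sets_PiM_I_finite)
  from AE_not_in[OF this] AE_space show "AE x in Pi\<^sub>M I (\<lambda>_. nu_meas \<mu>). norm (x j) \<le> 1"
  proof eventually_elim
    case (elim x)
    then show ?case by (auto simp: space_PiM PiE_iff not_le split: if_splits)
  qed
qed

lemma sum_measurable_nu: "(\<lambda>x. \<Sum>j\<in>I. x j) \<in> measurable (Pi\<^sub>M I (\<lambda>_. nu_meas \<mu>)) (borel :: 'a measure)"
proof (rule borel_measurable_sum)
  fix j assume "j \<in> I"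
  show "(\<lambda>x. x j) \<in> measurable (Pi\<^sub>M I (\<lambda>_. nu_meas \<mu>)) (borel :: 'a measure)"
    by (rule measurable_compose[OF measurable_component_singleton[OF \<open>j \<in> I\<close>] nu_id_measurable])
qed

lemma sets_nu_pow: "sets (nu_pow \<mu> k) = sets (restrict_space borel (- cball 0 (real k - 1)))"
  by (simp add: nu_pow_def sets_restrict_space)

lemma integral_nu_pow:
  fixes f :: "'a \<Rightarrow> real"
  assumes uc: "uniformly_continuous_on UNIV f" and C: "\<And>x. \<bar>f x\<bar> \<le> C"
    and e0: "e0 > 0" and f0: "\<And>x. norm x \<le> real k - 1 + 2 * e0 \<Longrightarrow> f x = 0"
  shows "(\<integral>x. f x \<partial>nu_pow \<mu> k) = (weighted_conv (nu_meas \<mu>) (cutoff e0) ^^ k) f 0"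
proof -
  interpret P: weighted_kernel "nu_meas \<mu>" "cutoff e0" by (rule nu_kernel[OF e0])
  let ?\<Pi> = "Pi\<^sub>M {1..k} (\<lambda>_. nu_meas \<mu>)"
  have fm: "f \<in> borel_measurable borel"
    by (intro borel_measurable_continuous_onI uniformly_continuous_imp_continuous uc)
  have sm: "(\<lambda>x. \<Sum>j = 1..k. x j) \<in> measurable ?\<Pi> borel" by (rule sum_measurable_nu)
  have it: "integrable ?\<Pi> (\<lambda>x. f (0 + (\<Sum>j\<in>{1..k}. x j)) * (\<Prod>j\<in>{1..k}. cutoff e0 (x j)))"
    "(\<integral>x. f (0 + (\<Sum>j\<in>{1..k}. x j)) * (\<Prod>j\<in>{1..k}. cutoff e0 (x j)) \<partial>?\<Pi>) = (weighted_conv (nu_meas \<mu>) (cutoff e0) ^^ k) f 0"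
    using P.product_integral_iterate[OF finite_atLeastAtMost[of 1 k] uc C, of 0] by simp_all
  have "(\<integral>x. f x \<partial>nu_pow \<mu> k) = (\<integral>x. indicator (- cball 0 (real k - 1)) x *\<^sub>R f x \<partial>distr ?\<Pi> borel (\<lambda>x. \<Sum>j = 1..k. x j))"
    unfolding nu_pow_def by (rule integral_restrict_space) (simp add: borel_open open_Compl)
  also have "\<dots> = (\<integral>x. f x \<partial>distr ?\<Pi> borel (\<lambda>x. \<Sum>j = 1..k. x j))"
    using e0 by (intro Bochner_Integration.integral_cong) (auto simp: indicator_def f0)
  also have "\<dots> = (\<integral>x. f (\<Sum>j = 1..k. x j) \<partial>?\<Pi>)" by (rule integral_distr[OF sm fm])
  also have "\<dots> = (\<integral>x. f (0 + (\<Sum>j\<in>{1..k}. x j)) * (\<Prod>j\<in>{1..k}. cutoff e0 (x j)) \<partial>?\<Pi>)"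
  proof (rule integral_cong_AE)
    show "(\<lambda>x. f (\<Sum>j = 1..k. x j)) \<in> borel_measurable ?\<Pi>" by (rule measurable_compose[OF sm fm])
    show "(\<lambda>x. f (0 + (\<Sum>j\<in>{1..k}. x j)) * (\<Prod>j\<in>{1..k}. cutoff e0 (x j))) \<in> borel_measurable ?\<Pi>"
      using it(1) by (rule borel_measurable_integrable)
    show "AE x in ?\<Pi>. f (\<Sum>j = 1..k. x j) = f (0 + (\<Sum>j\<in>{1..k}. x j)) * (\<Prod>j\<in>{1..k}. cutoff e0 (x j))"
      using AE_nu_product[OF finite_atLeastAtMost[of 1 k]]
    proof eventually_elim
      case (elim x)
      show ?case by (rule cutoff_prod[OF e0, of k]) (use f0 elim in auto)
    qed
  qed
  also note it(2)
  finally show ?thesis .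
qed

text \<open>
  The weights that may be inserted by \<open>cutoff_prod\<close> dominate the indicator of \<open>{x. t \<le> norm x}\<close>, and
  they are integrable.
\<close>

lemma nu_pow_finite:
  assumes t: "t > real k - 1"
  shows "emeasure (nu_pow \<mu> k) {x. t \<le> norm x} < \<infinity>"
proof -
  define e0 where "e0 = (t - (real k - 1)) / 3"
  have e0: "e0 > 0" "real k - 1 + 2 * e0 < t" using t by (auto simp: e0_def field_simps)
  interpret P: weighted_kernel "nu_meas \<mu>" "cutoff e0" by (rule nu_kernel[OF e0(1)])
  interpret product_sigma_finite "\<lambda>_. nu_meas \<mu>" by unfold_locales
  let ?\<Pi> = "Pi\<^sub>M {1..k} (\<lambda>_. nu_meas \<mu>)"
  have sm: "(\<lambda>x. \<Sum>j = 1..k. x j) \<in> measurable ?\<Pi> borel" by (rule sum_measurable_nu)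
  let ?c = "\<lambda>x. \<Prod>j\<in>{1..k}. cutoff e0 (x j)"
  have ic: "integrable ?\<Pi> ?c" by (intro product_integrable_prod P.\<phi>_int) auto
  have A: "{x::'a. t \<le> norm x} \<in> sets borel" by measurable
  have "emeasure (nu_pow \<mu> k) {x. t \<le> norm x} = emeasure (distr ?\<Pi> borel (\<lambda>x. \<Sum>j = 1..k. x j)) {x. t \<le> norm x}"
    unfolding nu_pow_def by (rule emeasure_restrict_space) (use t in \<open>auto simp: borel_open open_Compl\<close>)
  also have "\<dots> = (\<integral>\<^sup>+x. indicator {x. t \<le> norm x} x \<partial>distr ?\<Pi> borel (\<lambda>x. \<Sum>j = 1..k. x j))"
    using A by simp
  also have "\<dots> = (\<integral>\<^sup>+x. indicator {x. t \<le> norm x} (\<Sum>j = 1..k. x j) \<partial>?\<Pi>)"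
    by (rule nn_integral_distr[OF sm]) (use A in auto)
  also have "\<dots> \<le> (\<integral>\<^sup>+x. ennreal (?c x) \<partial>?\<Pi>)"
  proof (rule nn_integral_mono_AE)
    let ?f = "\<lambda>x::'a. indicat_real {x. t \<le> norm x} x"
    show "AE x in ?\<Pi>. indicator {x. t \<le> norm x} (\<Sum>j = 1..k. x j) \<le> ennreal (?c x)"
      using AE_nu_product[OF finite_atLeastAtMost[of 1 k]]
    proof eventually_elim
      case (elim x)
      have "?f (\<Sum>j\<in>{1..k}. x j) = ?f (0 + (\<Sum>j\<in>{1..k}. x j)) * ?c x"
        by (rule cutoff_prod[OF e0(1), of k]) (use e0(2) elim in \<open>auto simp: indicator_def\<close>)
      then show ?case by (cases "t \<le> norm (\<Sum>j = 1..k. x j)") auto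
    qed
  qed
  also have "\<dots> < \<infinity>"
    using ic by (subst nn_integral_eq_integral) (auto intro!: AE_I2 prod_nonneg cutoff_range)
  finally show ?thesis .
qed

end

locale soft_truncation = regvar_row_sums \<Omega> H \<mu> a \<alpha> M
  for \<Omega> :: "'w measure" and H :: "nat \<Rightarrow> 'w \<Rightarrow> 'a::euclidean_space" and \<mu> a \<alpha> M +
  fixes L :: "nat \<Rightarrow> 'w \<Rightarrow> real" and k :: nat
  assumes L_meas [measurable]: "\<And>j. L j \<in> borel_measurable \<Omega>"
    and L_nonneg: "\<And>j \<omega>. \<omega> \<in> space \<Omega> \<Longrightarrow> L j \<omega> \<ge> 0"
    and L_ident: "\<And>j. distr \<Omega> borel (L j) = distr \<Omega> borel (L 0)"
    and LH_indep: "indep_set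
         (sets (vimage_algebra (space \<Omega>) (\<lambda>\<omega> j. L j \<omega>) (Pi\<^sub>M UNIV (\<lambda>_. borel))))
         (sets (vimage_algebra (space \<Omega>) (\<lambda>\<omega> j. H j \<omega>) (Pi\<^sub>M UNIV (\<lambda>_. borel))))"
    and k: "k \<ge> 1"
    and L_tail: "tail \<Omega> (L 0) \<in> o[at_top](\<lambda>x. tail \<Omega> (\<lambda>\<omega>. norm (H 0 \<omega>)) x ^ (k - 1))"
begin

lemma prob_H: "A \<in> sets borel \<Longrightarrow> prob {\<omega> \<in> space \<Omega>. H j \<omega> \<in> A} = prob {\<omega> \<in> space \<Omega>. H 0 \<omega> \<in> A}"
proof -
  assume A: "A \<in> sets borel"
  have "measure (distr \<Omega> borel (H j)) A = measure (distr \<Omega> borel (H 0)) A" by (simp only: H_ident[of j])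
  then show ?thesis using A by (simp add: measure_distr vimage_def Int_def conj_commute)
qed

lemma prob_L: "A \<in> sets borel \<Longrightarrow> prob {\<omega> \<in> space \<Omega>. L j \<omega> \<in> A} = prob {\<omega> \<in> space \<Omega>. L 0 \<omega> \<in> A}"
proof -
  assume A: "A \<in> sets borel"
  have "measure (distr \<Omega> borel (L j)) A = measure (distr \<Omega> borel (L 0)) A" by (simp only: L_ident[of j])
  then show ?thesis using A by (simp add: measure_distr vimage_def Int_def conj_commute)
qed

lemma prob_overshoot:
  "prob {\<omega> \<in> space \<Omega>. \<exists>j\<in>{1..n}. norm (H j \<omega>) > M n \<and> L j \<omega> > s} \<le> p n * tail \<Omega> (L 0) s"
proof -
  let ?A = "\<lambda>j. {\<omega> \<in> space \<Omega>. norm (H j \<omega>) > M n \<and> L j \<omega> > s}"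
  have pj: "prob (?A j) = Q (M n) * tail \<Omega> (L 0) s" for j
  proof -
    let ?U = "{\<omega> \<in> space \<Omega>. L j \<omega> \<in> {s<..}}" and ?V = "{\<omega> \<in> space \<Omega>. H j \<omega> \<in> {x. norm x > M n}}"
    have "{x \<in> space (Pi\<^sub>M UNIV (\<lambda>_::nat. borel :: real measure)). x j \<in> {s<..}} \<in> sets (Pi\<^sub>M UNIV (\<lambda>_. borel))"
      by measurable
    from in_vimage_algebra[OF this, of "\<lambda>\<omega> j. L j \<omega>" "space \<Omega>"]
    have U: "?U \<in> sets (vimage_algebra (space \<Omega>) (\<lambda>\<omega> j. L j \<omega>) (Pi\<^sub>M UNIV (\<lambda>_. borel)))"
      by (simp add: space_PiM vimage_def Int_def conj_commute)
    have "{x \<in> space (Pi\<^sub>M UNIV (\<lambda>_::nat. borel :: 'a measure)). x j \<in> {x. norm x > M n}} \<in> sets (Pi\<^sub>M UNIV (\<lambda>_. borel))"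
      by measurable
    from in_vimage_algebra[OF this, of "\<lambda>\<omega> j. H j \<omega>" "space \<Omega>"]
    have V: "?V \<in> sets (vimage_algebra (space \<Omega>) (\<lambda>\<omega> j. H j \<omega>) (Pi\<^sub>M UNIV (\<lambda>_. borel)))"
      by (simp add: space_PiM vimage_def Int_def conj_commute)
    have "?A j = ?U \<inter> ?V" by auto
    then have "prob (?A j) = prob ?U * prob ?V" using indep_setD[OF LH_indep U V] by simp
    also have "prob ?U = prob {\<omega> \<in> space \<Omega>. L 0 \<omega> \<in> {s<..}}" by (rule prob_L) simp
    also have "prob ?V = prob {\<omega> \<in> space \<Omega>. H 0 \<omega> \<in> {x. norm x > M n}}" by (rule prob_H) measurable
    finally show ?thesis by (simp add: tail_def)
  qed
  have "{\<omega> \<in> space \<Omega>. \<exists>j\<in>{1..n}. norm (H j \<omega>) > M n \<and> L j \<omega> > s} = (\<Union>j\<in>{1..n}. ?A j)" by auto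
  also have "prob \<dots> \<le> (\<Sum>j\<in>{1..n}. prob (?A j))"
    by (rule finite_measure_subadditive_finite) auto
  also have "\<dots> = p n * tail \<Omega> (L 0) s" unfolding pj by (simp add: p_def)
  finally show ?thesis .
qed

text \<open>
  The tail condition compares \<open>L\<close> with \<open>Q\<close> to the power \<open>k - 1\<close> at \<open>d * M n\<close>, regular variation moves
  this to \<open>M n\<close>, and \<open>Q (M n) \<le> p n\<close>.
\<close>

lemma overshoot_negligible:
  assumes d: "d > 0"
  shows "(\<lambda>n. p n * tail \<Omega> (L 0) (d * M n) / p n ^ k) \<longlonglongrightarrow> 0"
proof (rule tendsto_sandwich[OF _ _ tendsto_const])
  have dM: "filterlim (\<lambda>n. d * M n) at_top sequentially"
    by (rule filterlim_tendsto_pos_mult_at_top[OF tendsto_const d M_lim])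
  have 1: "(\<lambda>n. tail \<Omega> (L 0) (d * M n) / Q (d * M n) ^ (k - 1)) \<longlonglongrightarrow> 0"
    by (rule filterlim_compose[OF smalloD_tendsto[OF L_tail] dM])
  have "(\<lambda>n. tail \<Omega> (L 0) (d * M n) / Q (d * M n) ^ (k - 1) * (Q (d * M n) / Q (M n)) ^ (k - 1)) \<longlonglongrightarrow> 0 * (d powr (-\<alpha>)) ^ (k - 1)"
    by (intro tendsto_mult tendsto_power 1 Q_M_compose d)
  then show "(\<lambda>n. tail \<Omega> (L 0) (d * M n) / Q (M n) ^ (k - 1)) \<longlonglongrightarrow> 0"
    using Q_pos by (simp add: power_divide less_imp_neq[symmetric])
  have tn: "tail \<Omega> (L 0) s \<ge> 0" for s by (simp add: tail_def)
  have pn: "p n \<ge> 0" for n by (simp add: p_def Q_nonneg)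
  show "\<forall>\<^sub>F n in sequentially. 0 \<le> p n * tail \<Omega> (L 0) (d * M n) / p n ^ k"
    using tn pn by (intro always_eventually allI) simp
  show "\<forall>\<^sub>F n in sequentially. p n * tail \<Omega> (L 0) (d * M n) / p n ^ k \<le> tail \<Omega> (L 0) (d * M n) / Q (M n) ^ (k - 1)"
    using eventually_ge_at_top[of 1]
  proof eventually_elim
    case (elim n)
    have "p n ^ k = p n * p n ^ (k - 1)" using k by (cases k) auto
    then have "p n * tail \<Omega> (L 0) (d * M n) / p n ^ k = tail \<Omega> (L 0) (d * M n) / p n ^ (k - 1)"
      using p_pos[OF elim] by simp
    also have "\<dots> \<le> tail \<Omega> (L 0) (d * M n) / Q (M n) ^ (k - 1)"
    proof (rule divide_left_mono)
      have "1 * Q (M n) \<le> p n" unfolding p_def using elim Q_nonneg by (intro mult_right_mono) auto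
      then show "Q (M n) ^ (k - 1) \<le> p n ^ (k - 1)" using Q_nonneg by (intro power_mono) auto
      show "0 < p n ^ (k - 1) * Q (M n) ^ (k - 1)" using p_pos[OF elim] Q_pos by simp
    qed (rule tn)
    finally show ?case .
  qed
qed

text \<open>
  The contribution that the sum would make if it consisted of exactly \<open>k\<close> clipped jumps, summed
  over all choices of their indices.
\<close>

definition Ustat :: "('a \<Rightarrow> real) \<Rightarrow> nat \<Rightarrow> 'w \<Rightarrow> real" where
  "Ustat f n \<omega> = (\<Sum>J | J \<subseteq> {1..n} \<and> card J = k. f (\<Sum>j\<in>J. clip 1 ((1 / M n) *\<^sub>R H j \<omega>)))"

lemma S_sum_scaled:
  assumes "n \<ge> 1"
  shows "(1 / M n) *\<^sub>R S_sum H L M n \<omega> = (\<Sum>j=1..n. soft_trunc 1 ((1 / M n) *\<^sub>R H j \<omega>) (L j \<omega> / M n))"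
  unfolding S_sum_def X_arr_def scaleR_sum_right
  by (intro sum.cong refl soft_trunc_scale M_pos assms)

lemma S_sum_measurable [measurable]: "S_sum H L M n \<in> borel_measurable \<Omega>"
  unfolding S_sum_def[abs_def] X_arr_def soft_trunc_def by measurable

context
  fixes f :: "'a \<Rightarrow> real" and C e0 :: real
  assumes uc: "uniformly_continuous_on UNIV f" and C: "\<And>x. \<bar>f x\<bar> \<le> C"
    and e0: "e0 > 0" and f0: "\<And>x. norm x \<le> real k - 1 + 2 * e0 \<Longrightarrow> f x = 0"
begin

lemma f_meas [measurable]: "f \<in> borel_measurable borel"
  by (intro borel_measurable_continuous_onI uniformly_continuous_imp_continuous uc)

lemma integrable_f: "X \<in> borel_measurable \<Omega> \<Longrightarrow> integrable \<Omega> (\<lambda>\<omega>. f (X \<omega>))"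
  using C by (intro integrable_const_bound[of _ C]) auto

lemma Ustat_integrable: "integrable \<Omega> (Ustat f n)"
  unfolding Ustat_def by (intro Bochner_Integration.integrable_sum integrable_f) measurable

lemma expectation_Ustat: "expectation (Ustat f n) = real (n choose k) * (weighted_conv (clip_law n) (cutoff e0) ^^ k) f 0"
proof -
  have "expectation (Ustat f n) = (\<Sum>J | J \<subseteq> {1..n} \<and> card J = k. \<integral>\<omega>. f (\<Sum>j\<in>J. clip 1 ((1 / M n) *\<^sub>R H j \<omega>)) \<partial>\<Omega>)"
    unfolding Ustat_def by (rule Bochner_Integration.integral_sum) (rule integrable_f, measurable)
  also have "\<dots> = (\<Sum>J | J \<subseteq> {1..n} \<and> card J = k. (weighted_conv (clip_law n) (cutoff e0) ^^ k) f 0)"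
  proof (rule sum.cong[OF refl])
    fix J assume J: "J \<in> {J. J \<subseteq> {1..n} \<and> card J = k}"
    then have "finite J" "J \<subseteq> {1..}" using finite_subset by auto
    then show "(\<integral>\<omega>. f (\<Sum>j\<in>J. clip 1 ((1 / M n) *\<^sub>R H j \<omega>)) \<partial>\<Omega>) = (weighted_conv (clip_law n) (cutoff e0) ^^ k) f 0"
      using J by (intro expectation_clipped_sum[OF _ _ _ k uc C e0 f0]) auto
  qed
  also have "\<dots> = real (n choose k) * (weighted_conv (clip_law n) (cutoff e0) ^^ k) f 0"
    using n_subsets[of "{1..n}" k] by simp
  finally show ?thesis .
qed

lemma Ustat_limit: "(\<lambda>n. expectation (Ustat f n) / p n ^ k) \<longlonglongrightarrow> (\<integral>x. f x \<partial>nu_pow \<mu> k) / fact k"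
proof -
  have "(\<lambda>n. real (n choose k) / real n ^ k * ((weighted_conv (clip_law n) (cutoff e0) ^^ k) f 0 / Q (M n) ^ k))
     \<longlonglongrightarrow> 1 / fact k * (weighted_conv (nu_meas \<mu>) (cutoff e0) ^^ k) f 0"
    by (intro tendsto_mult binomial_div_power_limit clip_law_limit[OF uc C e0])
  then show ?thesis
    by (simp add: expectation_Ustat integral_nu_pow[OF uc C e0 f0] p_def power_mult_distrib)
qed

lemma expectation_difference:
  assumes n: "n \<ge> 1" and d: "0 < d" "d \<le> 1" and e: "0 \<le> e" "e + real k * d \<le> e0"
    and w: "\<And>x x'. norm (x - x') \<le> e + real k * d \<Longrightarrow> \<bar>f x - f x'\<bar> \<le> \<omega>0"
  shows "\<bar>expectation (\<lambda>\<omega>. f ((1 / M n) *\<^sub>R S_sum H L M n \<omega>)) - expectation (Ustat f n)\<bar>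
    \<le> \<omega>0 * (real n * Q (e0 * M n)) ^ k + 2 * C * (p n * tail \<Omega> (L 0) (d * M n))
      + 2 * C * prob {\<omega> \<in> space \<Omega>. norm (\<Sum>j=1..n. if norm (H j \<omega>) \<le> d * M n then H j \<omega> else 0) > e * M n}
      + C * (real k + 2) * (real n * Q (d * M n)) ^ (k + 1)"
proof -
  have Mp: "M n > 0" by (rule M_pos[OF n])
  have C0: "C \<ge> 0" using C[of 0] by linarith
  have w0: "\<omega>0 \<ge> 0" using w[of 0 0] e d by simp
  let ?cnt = "\<lambda>s i \<omega>. real (card {j \<in> {1..n}. norm (H j \<omega>) > s * M n} choose i)"
  let ?B2 = "{\<omega> \<in> space \<Omega>. \<exists>j\<in>{1..n}. norm (H j \<omega>) > M n \<and> L j \<omega> > d * M n}"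
  let ?B3 = "{\<omega> \<in> space \<Omega>. norm (\<Sum>j=1..n. if norm (H j \<omega>) \<le> d * M n then H j \<omega> else 0) > e * M n}"
  let ?R = "\<lambda>\<omega>. \<omega>0 * ?cnt e0 k \<omega> + 2 * C * indicator ?B2 \<omega> + 2 * C * indicator ?B3 \<omega> + C * (real k + 2) * ?cnt d (k + 1) \<omega>"
  have B2: "?B2 \<in> events" by measurable
  have B3: "?B3 \<in> events" by measurable
  have i: "integrable \<Omega> (?cnt s i)" for s i by (rule expectation_choose_count(1))
  have iB: "integrable \<Omega> (indicat_real ?B2)" "integrable \<Omega> (indicat_real ?B3)"
    using B2 B3 by (auto intro!: integrable_real_indicator simp: less_top[symmetric])
  have iS: "integrable \<Omega> (\<lambda>\<omega>. f ((1 / M n) *\<^sub>R S_sum H L M n \<omega>))" by (rule integrable_f) measurable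
  have pt: "\<bar>f ((1 / M n) *\<^sub>R S_sum H L M n \<omega>) - Ustat f n \<omega>\<bar> \<le> ?R \<omega>" if \<omega>: "\<omega> \<in> space \<Omega>" for \<omega>
  proof -
    let ?y = "\<lambda>j. (1 / M n) *\<^sub>R H j \<omega>" and ?l = "\<lambda>j. L j \<omega> / M n"
    have ny: "norm (?y j) > s \<longleftrightarrow> norm (H j \<omega>) > s * M n" for j s using Mp by (simp add: pos_less_divide_eq)
    have ny': "norm (?y j) \<le> s \<longleftrightarrow> norm (H j \<omega>) \<le> s * M n" for j s using ny[of s j] by (meson not_le)
    have "\<bar>f (\<Sum>j\<in>{1..n}. soft_trunc 1 (?y j) (?l j)) - (\<Sum>J | J \<subseteq> {1..n} \<and> card J = k. f (\<Sum>j\<in>J. clip 1 (?y j)))\<bar>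
      \<le> \<omega>0 * real (card {j \<in> {1..n}. norm (?y j) > e0} choose k)
        + 2 * C * of_bool (\<exists>j\<in>{1..n}. norm (?y j) > 1 \<and> ?l j > d)
        + 2 * C * of_bool (norm (\<Sum>j\<in>{1..n}. if norm (?y j) \<le> d then ?y j else 0) > e)
        + C * (real k + 2) * real (card {j \<in> {1..n}. norm (?y j) > d} choose (k + 1))"
      by (rule big_jump_approximation[OF _ _ k C e0 f0 d e w]) (use Mp L_nonneg[OF \<omega>] in auto)
    moreover have "(\<exists>j\<in>{1..n}. norm (?y j) > 1 \<and> ?l j > d) \<longleftrightarrow> \<omega> \<in> ?B2"
      unfolding ny using \<omega> Mp by (simp add: pos_less_divide_eq)
    moreover have "(norm (\<Sum>j\<in>{1..n}. if norm (?y j) \<le> d then ?y j else 0) > e) \<longleftrightarrow> \<omega> \<in> ?B3"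
    proof -
      have "(\<Sum>j\<in>{1..n}. if norm (?y j) \<le> d then ?y j else 0) = (1 / M n) *\<^sub>R (\<Sum>j\<in>{1..n}. if norm (H j \<omega>) \<le> d * M n then H j \<omega> else 0)"
        unfolding scaleR_sum_right ny' by (intro sum.cong) auto
      then show ?thesis using \<omega> Mp by (simp add: pos_less_divide_eq)
    qed
    ultimately show ?thesis
      unfolding S_sum_scaled[OF n] Ustat_def ny by (simp add: indicator_def of_bool_def)
  qed
  have diff_eq: "expectation (\<lambda>\<omega>. f ((1 / M n) *\<^sub>R S_sum H L M n \<omega>)) - expectation (Ustat f n)
     = expectation (\<lambda>\<omega>. f ((1 / M n) *\<^sub>R S_sum H L M n \<omega>) - Ustat f n \<omega>)"
    by (rule Bochner_Integration.integral_diff[symmetric]) (rule iS Ustat_integrable)+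
  have "\<bar>expectation (\<lambda>\<omega>. f ((1 / M n) *\<^sub>R S_sum H L M n \<omega>)) - expectation (Ustat f n)\<bar> \<le> expectation ?R"
    unfolding diff_eq
  proof (rule order_trans[OF integral_abs_bound], rule integral_mono)
    show "integrable \<Omega> (\<lambda>\<omega>. \<bar>f ((1 / M n) *\<^sub>R S_sum H L M n \<omega>) - Ustat f n \<omega>\<bar>)"
      by (intro integrable_abs Bochner_Integration.integrable_diff iS Ustat_integrable)
    show "integrable \<Omega> ?R"
      by (intro Bochner_Integration.integrable_add integrable_mult_right i iB)
  qed (rule pt)
  also have "\<dots> = \<omega>0 * expectation (?cnt e0 k) + 2 * C * prob ?B2 + 2 * C * prob ?B3 + C * (real k + 2) * expectation (?cnt d (k + 1))"
  proof -
    have lin: "expectation (\<lambda>\<omega>. w * a1 \<omega> + x * b1 \<omega> + y * c1 \<omega> + z * d1 \<omega>)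
        = w * expectation a1 + x * expectation b1 + y * expectation c1 + z * expectation d1"
      if "integrable \<Omega> a1" "integrable \<Omega> b1" "integrable \<Omega> c1" "integrable \<Omega> d1"
      for a1 b1 c1 d1 :: "'w \<Rightarrow> real" and w x y z
      using that by simp
    have "expectation (indicat_real ?B2) = prob ?B2" "expectation (indicat_real ?B3) = prob ?B3"
      by (simp_all only: Bochner_Integration.integral_indicator Int_absorb2 sets.sets_into_space[OF B2] sets.sets_into_space[OF B3])
    then show ?thesis by (subst lin[OF i iB(1) iB(2) i]) (simp only:)
  qed
  also have "\<dots> \<le> \<omega>0 * (real n * Q (e0 * M n)) ^ k + 2 * C * (p n * tail \<Omega> (L 0) (d * M n)) + 2 * C * prob ?B3
     + C * (real k + 2) * (real n * Q (d * M n)) ^ (k + 1)"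
    by (intro add_mono mult_left_mono expectation_choose_count(2) prob_overshoot order_refl) (use w0 C0 in auto)
  finally show ?thesis .
qed

text \<open>
  The order in which the constants are chosen matters. First \<open>e0\<close> is given by \<open>f\<close>, which fixes the
  asymptotic bound \<open>(e0 powr (- \<alpha>)) ^ k\<close>, relative to \<open>p n ^ k\<close>, for the event that \<open>k\<close> scaled
  jumps exceed \<open>e0\<close>. Then the modulus \<open>\<omega>0\<close> is made small compared to its inverse, which determines how small the small jumps and the excess
  have to be, and only then \<open>d\<close> is chosen. All other error terms vanish in the limit.
\<close>

lemma S_sum_limit:
  "(\<lambda>n. expectation (\<lambda>\<omega>. f ((1 / M n) *\<^sub>R S_sum H L M n \<omega>)) / p n ^ k) \<longlonglongrightarrow> (\<integral>x. f x \<partial>nu_pow \<mu> k) / fact k"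
proof -
  let ?D = "\<lambda>n. expectation (\<lambda>\<omega>. f ((1 / M n) *\<^sub>R S_sum H L M n \<omega>)) - expectation (Ustat f n)"
  have C0: "C \<ge> 0" using C[of 0] by linarith
  have ratio: "(\<lambda>n. (real n * Q (s * M n)) ^ i / p n ^ i) \<longlonglongrightarrow> (s powr (-\<alpha>)) ^ i" if s: "s > 0" for s i
  proof (rule Lim_transform_eventually)
    show "(\<lambda>n. (Q (s * M n) / Q (M n)) ^ i) \<longlonglongrightarrow> (s powr (-\<alpha>)) ^ i"
      by (intro tendsto_power Q_M_compose s)
    show "\<forall>\<^sub>F n in sequentially. (Q (s * M n) / Q (M n)) ^ i = (real n * Q (s * M n)) ^ i / p n ^ i"
      using eventually_ge_at_top[of 1] by eventually_elim (simp add: p_def power_divide[symmetric])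
  qed
  have "(\<lambda>n. ?D n / p n ^ k) \<longlonglongrightarrow> 0"
  proof (rule tendstoI)
    fix \<eta> :: real assume h: "\<eta> > 0"
    define P where "P = (e0 powr (-\<alpha>)) ^ k + 1"
    have P: "P > 0" by (simp add: P_def add_nonneg_pos)
    define \<omega>0 where "\<omega>0 = \<eta> / (2 * P)"
    have w0: "\<omega>0 > 0" "\<omega>0 * P = \<eta> / 2" using h P by (auto simp: \<omega>0_def)
    obtain \<rho> where r: "\<rho> > 0" "\<And>x x'. norm (x - x') < \<rho> \<Longrightarrow> \<bar>f x - f x'\<bar> < \<omega>0"
      using uc w0(1) unfolding uniformly_continuous_on_UNIV_norm by blast
    define q where "q = min \<rho> e0"
    have q: "q > 0" "q \<le> \<rho>" "q \<le> e0" using r e0 by (auto simp: q_def)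
    have qk: "q / (4 * real k) > 0" "q / 4 > 0" using q k by auto
    obtain d where d: "0 < d" "d < q / (4 * real k)" "d \<le> 1"
      and small: "\<forall>\<^sub>F n in sequentially.
       prob {\<omega> \<in> space \<Omega>. norm (\<Sum>j=1..n. if norm (H j \<omega>) \<le> d * M n then H j \<omega> else 0) > q / 4 * M n}
         \<le> 2 * real DIM('a) * p n ^ (k + 1)"
      using small_jumps[OF qk(2) qk(1), of k] by blast
    have kd: "real k * d < q / 4" using d(2) k by (simp add: field_simps)
    have ek: "q / 4 + real k * d \<le> e0" using kd q by linarith
    have wq: "\<bar>f x - f x'\<bar> \<le> \<omega>0" if "norm (x - x') \<le> q / 4 + real k * d" for x x'
      using r(2)[of x x'] that kd q by linarith
    let ?Z = "\<lambda>n. \<omega>0 * ((real n * Q (e0 * M n)) ^ k / p n ^ k) + 2 * C * (p n * tail \<Omega> (L 0) (d * M n) / p n ^ k)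
       + 2 * C * (2 * real DIM('a) * p n) + C * (real k + 2) * (p n * ((real n * Q (d * M n)) ^ (k + 1) / p n ^ (k + 1)))"
    have "?Z \<longlonglongrightarrow> \<omega>0 * (e0 powr (-\<alpha>)) ^ k + 2 * C * 0 + 2 * C * (2 * real DIM('a) * 0)
        + C * (real k + 2) * (0 * (d powr (-\<alpha>)) ^ (k + 1))"
      by (intro tendsto_intros ratio overshoot_negligible p_lim e0 d(1))
    then have Z: "?Z \<longlonglongrightarrow> \<omega>0 * (e0 powr (-\<alpha>)) ^ k" by simp
    have "\<omega>0 * (e0 powr (-\<alpha>)) ^ k < \<eta>"
    proof -
      have "\<omega>0 * (e0 powr (-\<alpha>)) ^ k < \<omega>0 * P" using w0(1) by (simp add: P_def)
      also note w0(2)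
      finally show ?thesis using h by simp
    qed
    from order_tendstoD(2)[OF Z this] small eventually_ge_at_top[of 1]
    show "\<forall>\<^sub>F n in sequentially. dist (?D n / p n ^ k) 0 < \<eta>"
    proof eventually_elim
      case (elim n)
      have pp: "p n > 0" by (rule p_pos[OF elim(3)])
      let ?b3 = "prob {\<omega> \<in> space \<Omega>. norm (\<Sum>j=1..n. if norm (H j \<omega>) \<le> d * M n then H j \<omega> else 0) > q / 4 * M n}"
      have "\<bar>?D n\<bar> \<le> \<omega>0 * (real n * Q (e0 * M n)) ^ k + 2 * C * (p n * tail \<Omega> (L 0) (d * M n))
         + 2 * C * ?b3 + C * (real k + 2) * (real n * Q (d * M n)) ^ (k + 1)"
        by (rule expectation_difference[OF elim(3) d(1,3) less_imp_le[OF qk(2)] ek wq])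
      also have "\<dots> \<le> \<omega>0 * (real n * Q (e0 * M n)) ^ k + 2 * C * (p n * tail \<Omega> (L 0) (d * M n))
         + 2 * C * (2 * real DIM('a) * p n ^ (k + 1)) + C * (real k + 2) * (real n * Q (d * M n)) ^ (k + 1)"
        using elim(2) C0 by (intro add_mono mult_left_mono order_refl) auto
      finally have "\<bar>?D n\<bar> / p n ^ k \<le> (\<omega>0 * (real n * Q (e0 * M n)) ^ k + 2 * C * (p n * tail \<Omega> (L 0) (d * M n))
         + 2 * C * (2 * real DIM('a) * p n ^ (k + 1)) + C * (real k + 2) * (real n * Q (d * M n)) ^ (k + 1)) / p n ^ k"
        using pp by (intro divide_right_mono) auto
      also have "\<dots> = ?Z n" using pp by (simp add: add_divide_distrib)
      finally show ?case using elim(1) pp by simp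
    qed
  qed
  from tendsto_add[OF this Ustat_limit] show ?thesis by (simp add: diff_divide_distrib)
qed

end

lemma vague_limit:
  "vague_conv (cpt_minus_ball (real k - 1))
     (\<lambda>n. cpt_extend (real k - 1)
        (scale_measure (ennreal (1 / p n ^ k)) (distr \<Omega> borel (\<lambda>\<omega>. (1 / M n) *\<^sub>R S_sum H L M n \<omega>))))
     (cpt_extend (real k - 1) (scale_measure (ennreal (1 / fact k)) (nu_pow \<mu> k)))"
  unfolding vague_conv_def
proof (intro conjI allI impI)
  let ?r = "real k - 1"
  let ?N = "\<lambda>n. scale_measure (ennreal (1 / p n ^ k)) (distr \<Omega> borel (\<lambda>\<omega>. (1 / M n) *\<^sub>R S_sum H L M n \<omega>))"
  let ?N' = "scale_measure (ennreal (1 / fact k)) (nu_pow \<mu> k)"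
  have r: "?r \<ge> 0" using k by simp
  have setsN: "sets (?N n) = sets (restrict_space borel UNIV)" for n by (simp add: sets_restrict_UNIV[symmetric])
  have setsN': "sets ?N' = sets (restrict_space borel (- cball 0 ?r))" by (simp add: sets_nu_pow)
  have op: "- cball 0 ?r \<in> sets (borel :: 'a measure)" by (simp add: borel_open open_Compl)
  show "radon_on (cpt_minus_ball ?r) (cpt_extend ?r (?N n))" for n
  proof (rule radon_cpt_extend[OF r setsN])
    interpret D: prob_space "distr \<Omega> borel (\<lambda>\<omega>. (1 / M n) *\<^sub>R S_sum H L M n \<omega>)"
      by (rule prob_space_distr) measurable
    fix t :: real
    have "emeasure (distr \<Omega> borel (\<lambda>\<omega>. (1 / M n) *\<^sub>R S_sum H L M n \<omega>)) {x. t \<le> norm x} < \<infinity>"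
      by (simp add: D.emeasure_finite less_top[symmetric])
    then show "emeasure (?N n) {x. t \<le> norm x} < \<infinity>" by (simp add: ennreal_mult_less_top)
  qed auto
  show "radon_on (cpt_minus_ball ?r) (cpt_extend ?r ?N')"
    by (rule radon_cpt_extend[OF r setsN' order_refl op]) (use nu_pow_finite in \<open>simp add: ennreal_mult_less_top\<close>)
  fix F :: "'a cpt \<Rightarrow> real"
  assume "continuous_map (cpt_minus_ball ?r) euclideanreal F \<and>
    (\<exists>K. compactin (cpt_minus_ball ?r) K \<and> (\<forall>x\<in>topspace (cpt_minus_ball ?r) - K. F x = 0))"
  then obtain K where F: "continuous_map (cpt_minus_ball ?r) euclideanreal F"
    "compactin (cpt_minus_ball ?r) K" "\<forall>x\<in>topspace (cpt_minus_ball ?r) - K. F x = 0" by blast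
  define f where "f = (\<lambda>x. indicator (- cball 0 ?r) x * F (Proper x))"
  obtain e0 where e0: "e0 > 0" "\<And>x. norm x \<le> ?r + 2 * e0 \<Longrightarrow> f x = 0" "bounded (range f)"
    and uc: "uniformly_continuous_on UNIV f"
    using test_function_uniformly_continuous[OF r F] unfolding f_def by blast
  obtain C where C: "\<And>x. \<bar>f x\<bar> \<le> C" using e0(3) unfolding bounded_iff by auto
  have fm [measurable]: "f \<in> borel_measurable borel"
    by (intro borel_measurable_continuous_onI uniformly_continuous_imp_continuous uc)
  have 1: "integral\<^sup>L (cpt_extend ?r (?N n)) F = expectation (\<lambda>\<omega>. f ((1 / M n) *\<^sub>R S_sum H L M n \<omega>)) / p n ^ k" for n
  proof -
    have "integral\<^sup>L (cpt_extend ?r (?N n)) F = (\<integral>x. f x \<partial>?N n)"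
      unfolding f_def by (rule integral_cpt_extend[OF r setsN _ _ F(1)]) auto
    also have "\<dots> = 1 / p n ^ k * (\<integral>x. f x \<partial>distr \<Omega> borel (\<lambda>\<omega>. (1 / M n) *\<^sub>R S_sum H L M n \<omega>))"
      by (rule integral_scale_measure) (auto simp: p_def Q_nonneg)
    also have "(\<integral>x. f x \<partial>distr \<Omega> borel (\<lambda>\<omega>. (1 / M n) *\<^sub>R S_sum H L M n \<omega>)) = expectation (\<lambda>\<omega>. f ((1 / M n) *\<^sub>R S_sum H L M n \<omega>))"
      by (rule integral_distr) measurable
    finally show ?thesis by simp
  qed
  have 2: "integral\<^sup>L (cpt_extend ?r ?N') F = (\<integral>x. f x \<partial>nu_pow \<mu> k) / fact k"
  proof -
    have fm': "f \<in> borel_measurable (nu_pow \<mu> k)"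
      using measurable_restrict_space1[OF fm, of "- cball 0 ?r"] by (simp cong: measurable_cong_sets add: sets_nu_pow)
    have "integral\<^sup>L (cpt_extend ?r ?N') F = (\<integral>x. f x \<partial>?N')"
      unfolding f_def by (rule integral_cpt_extend[OF r setsN' order_refl op F(1)])
    also have "\<dots> = 1 / fact k * (\<integral>x. f x \<partial>nu_pow \<mu> k)"
      by (rule integral_scale_measure[OF _ fm']) simp
    finally show ?thesis by simp
  qed
  show "(\<lambda>n. integral\<^sup>L (cpt_extend ?r (?N n)) F) \<longlonglongrightarrow> integral\<^sup>L (cpt_extend ?r ?N') F"
    unfolding 1 2 by (rule S_sum_limit[OF uc C e0(1,2)])
qed

end

theorem theorem2p2:
  fixes \<Omega> :: "'w measure"
    and H :: "nat \<Rightarrow> 'w \<Rightarrow> 'a::euclidean_space"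
    and L :: "nat \<Rightarrow> 'w \<Rightarrow> real"
    and \<mu> :: "'a measure"
    and a M :: "nat \<Rightarrow> real"
    and \<alpha> :: real
    and k :: nat
  assumes prob: "prob_space \<Omega>"
    and H_meas: "\<And>j. H j \<in> borel_measurable \<Omega>"
    and L_meas: "\<And>j. L j \<in> borel_measurable \<Omega>"
    and mu_radon: "radon_on (top_of_set (- {0})) \<mu>"
    and mu_nonnull: "emeasure \<mu> (space \<mu>) \<noteq> 0"
    and a_lim: "filterlim a at_top sequentially"
    and H_regvar:
      "vague_conv (cpt_minus_ball 0)
         (\<lambda>n. cpt_extend 0
            (scale_measure (of_nat n) (distr \<Omega> borel (\<lambda>\<omega>. (1 / a n) *\<^sub>R H 0 \<omega>))))
         (cpt_extend 0 \<mu>)"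
    and alpha_pos: "\<alpha> > 0"
    and mu_scaling:
      "\<And>c A. c > 0 \<Longrightarrow> A \<in> sets \<mu> \<Longrightarrow>
         emeasure \<mu> ((\<lambda>x. c *\<^sub>R x) ` A) = ennreal (c powr (- \<alpha>)) * emeasure \<mu> A"
    and H_symmetric:
      "\<alpha> = 1 \<Longrightarrow> distr \<Omega> borel (H 0) = distr \<Omega> borel (\<lambda>\<omega>. - H 0 \<omega>)"
    and H_centered: "\<alpha> > 1 \<Longrightarrow> has_bochner_integral \<Omega> (H 0) 0"
    and H_indep: "prob_space.indep_vars \<Omega> (\<lambda>_. borel) H {1..}"
    and H_ident: "\<And>j. distr \<Omega> borel (H j) = distr \<Omega> borel (H 0)"
    and L_nonneg: "\<And>j \<omega>. \<omega> \<in> space \<Omega> \<Longrightarrow> L j \<omega> \<ge> 0"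
    and L_indep: "prob_space.indep_vars \<Omega> (\<lambda>_. borel) L UNIV"
    and L_ident: "\<And>j. distr \<Omega> borel (L j) = distr \<Omega> borel (L 0)"
    and LH_indep:
      "prob_space.indep_set \<Omega>
         (sets (vimage_algebra (space \<Omega>) (\<lambda>\<omega> j. L j \<omega>) (Pi\<^sub>M UNIV (\<lambda>_. borel))))
         (sets (vimage_algebra (space \<Omega>) (\<lambda>\<omega> j. H j \<omega>) (Pi\<^sub>M UNIV (\<lambda>_. borel))))"
    and M_pos: "\<And>n. n \<ge> 1 \<Longrightarrow> M n > 0"
    and M_lim: "filterlim M at_top sequentially"
    and soft: "(\<lambda>n. real n * tail \<Omega> (\<lambda>\<omega>. norm (H 0 \<omega>)) (M n)) \<longlonglongrightarrow> 0"
    and M_growth_eq_2: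
      "\<alpha> = 2 \<Longrightarrow>
         \<exists>\<gamma>>0. filterlim (\<lambda>n. M n / sqrt (real n powr (1 + \<gamma>))) at_top sequentially"
    and M_growth_gt_2:
      "\<alpha> > 2 \<Longrightarrow>
         filterlim (\<lambda>n. M n / sqrt (real n * ln (M n))) at_top sequentially"
    and k: "k \<ge> 1"
    and L_tail:
      "tail \<Omega> (L 0) \<in> o[at_top](\<lambda>x. tail \<Omega> (\<lambda>\<omega>. norm (H 0 \<omega>)) x ^ (k - 1))"
  shows
    "vague_conv (cpt_minus_ball (real k - 1))
       (\<lambda>n. cpt_extend (real k - 1)
          (scale_measure
             (ennreal (1 / (real n * tail \<Omega> (\<lambda>\<omega>. norm (H 0 \<omega>)) (M n)) ^ k))
             (distr \<Omega> borel (\<lambda>\<omega>. (1 / M n) *\<^sub>R S_sum H L M n \<omega>))))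
       (cpt_extend (real k - 1)
          (scale_measure (ennreal (1 / fact k)) (nu_pow \<mu> k)))"
proof -
  interpret prob_space \<Omega> by (rule prob)
  have mu_sets: "sets \<mu> = sets (restrict_space borel (- {0}))"
    using mu_radon sets_borel_of_top_of_set[of "- {0::'a}"] unfolding radon_on_def by simp
  have "radon_on (cpt_minus_ball 0) (cpt_extend 0 \<mu>)"
    using H_regvar unfolding vague_conv_def by blast
  then have mu_fin: "emeasure \<mu> {x. t \<le> norm x} < \<infinity>" if "t > 0" for t
    by (intro radon_cpt_extend_finite[OF order_refl mu_sets _ _ _ that]) auto
  interpret soft_truncation \<Omega> H \<mu> a \<alpha> M L k
    by unfold_locales (fact H_meas mu_sets mu_nonnull mu_fin mu_scaling alpha_pos a_lim H_regvar
        H_indep H_ident H_symmetric H_centered M_pos M_lim soft M_growth_eq_2 M_growth_gt_2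
        L_meas L_nonneg L_ident LH_indep k L_tail)+
  show ?thesis using vague_limit unfolding p_def .
qed

end
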